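(* Let $n, T$ be sufficiently large integers and let $S$ satisfy $\mathrm{polylog}(nT) \le S \le n$. There is an online learning algorithm for the experts problem with $n$ experts and $T$ days that uses at most $S$ words of memory and, against an oblivious adversary, with probability at least $1 - 1/(nT)^{\omega(1)}$ satisfies $$\sum_{t=1}^T \ell_t(i_t) - \min_{i^*\in[n]}\sum_{t=1}^T \ell_t(i^* ) \le \widetilde{O}\left(\sqrt{\tfrac{nT}{S}}\right).$$
   Context: Online learning with expert advice: there are $n$ experts and $T$ days. The algorithm starts with a memory state $M_0$. On day $t\in[T]$ the algorithm picks an expert $i_t\in[n]$ based on its memory state $M_{t-1}$ (and internal randomness); then a loss vector $\ell_t\in[0,1]^n$ is revealed; the algorithm incurs loss $\ell_t(i_t)$, observes $\ell_t$, and updates its memory state to $M_t$. The algorithm uses at most $S$ words of memory if $\max_t |M_t| \le S$. An oblivious adversary (possibly randomly) fixes the whole loss sequence $\ell_1,\dots,\ell_T$ in advance. $\widetilde{O}(\cdot)$ hides polylogarithmic factors in $nT$. *)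

theory Defs
  imports "HOL-Probability.Probability" "HOL-Library.Log_Nat"
begin

text \<open>
  Experts are \<open>1, \<dots>, n\<close> and days are \<open>1, \<dots>, T\<close>.  \<open>loss_vectors n\<close> is the Borel space
  \<open>[0,1]\<^sup>n\<close>, and \<open>loss_seqs n T\<close> is \<open>([0,1]\<^sup>n)\<^sup>T\<close>, with \<open>l t i\<close> the loss of expert \<open>i\<close> on day \<open>t\<close>.
\<close>

definition loss_vectors :: "nat \<Rightarrow> (nat \<Rightarrow> real) measure" where
  "loss_vectors n = PiM {1..n} (\<lambda>_. restrict_space borel {0..1})"

definition loss_seqs :: "nat \<Rightarrow> nat \<Rightarrow> (nat \<Rightarrow> nat \<Rightarrow> real) measure" where
  "loss_seqs n T = PiM {1..T} (\<lambda>_. loss_vectors n)"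

text \<open>
  A memory state is a list of words, \<open>|M|\<close> being its length.  The word size is the usual
  \<open>O(log (nT))\<close> bits; it is fixed to exactly \<open>\<lceil>log\<^sub>2 (nT)\<rceil>\<close> bits.
\<close>

type_synonym memory = "nat list"

definition mem_words :: "nat \<Rightarrow> nat \<Rightarrow> nat set" where
  "mem_words n T = {..< 2 ^ ceillog2 (n * T)}"

text \<open>
  One day of an algorithm in memory state \<open>M\<close>: the expert \<open>i\<close> is drawn from \<open>pick M\<close>, and once
  the loss vector \<open>v\<close> is revealed the next memory state is drawn from \<open>upd M i v\<close>.
  The random bits of a day may be shared between the two draws: this is why \<open>upd\<close> also depends
  on \<open>i\<close>, \<open>upd M i v\<close> being the conditional law of the new state given the expert picked.
  Nothing but the memory state is carried from one day to the next; in particular there is no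
  clock, and random bits that are to be reused later have to be stored.
\<close>

record expert_alg =
  init_mem :: memory
  pick :: "memory \<Rightarrow> nat pmf"
  upd :: "memory \<Rightarrow> nat \<Rightarrow> (nat \<Rightarrow> real) \<Rightarrow> memory pmf"

text \<open>
  The measurability condition makes \<open>upd M i\<close> a probability kernel on \<open>[0,1]\<^sup>n\<close>; it is needed
  for the joint law with a randomised loss sequence (\<open>play\<close> below) to be defined.
\<close>

definition is_expert_alg :: "nat \<Rightarrow> nat \<Rightarrow> expert_alg \<Rightarrow> bool" where
  "is_expert_alg n T A \<longleftrightarrow>
     init_mem A \<in> lists (mem_words n T) \<and>
     (\<forall>M \<in> lists (mem_words n T).
        set_pmf (pick A M) \<subseteq> {1..n} \<and>
        (\<forall>i \<in> {1..n}.
           (\<lambda>v. measure_pmf (upd A M i v))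
             \<in> loss_vectors n \<rightarrow>\<^sub>M subprob_algebra (count_space UNIV) \<and>
           (\<forall>v \<in> space (loss_vectors n). set_pmf (upd A M i v) \<subseteq> lists (mem_words n T))))"

text \<open>
  Law of the picks \<open>[i\<^sub>1, \<dots>, i\<^sub>t]\<close> together with the memory state \<open>M\<^sub>t\<close>, for a given loss sequence.
\<close>

primrec run :: "expert_alg \<Rightarrow> (nat \<Rightarrow> nat \<Rightarrow> real) \<Rightarrow> nat \<Rightarrow> (nat list \<times> memory) pmf" where
  "run A l 0 = return_pmf ([], init_mem A)"
| "run A l (Suc t) =
     bind_pmf (run A l t) (\<lambda>(is, M).
     bind_pmf (pick A M) (\<lambda>i.
     map_pmf (\<lambda>M'. (is @ [i], M')) (upd A M i (l (Suc t)))))"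

definition uses_memory_at_most :: "nat \<Rightarrow> nat \<Rightarrow> expert_alg \<Rightarrow> nat \<Rightarrow> bool" where
  "uses_memory_at_most n T A S \<longleftrightarrow>
     (\<forall>l \<in> space (loss_seqs n T). \<forall>t \<le> T. \<forall>(is, M) \<in> set_pmf (run A l t). length M \<le> S)"

definition regret :: "nat \<Rightarrow> nat \<Rightarrow> (nat \<Rightarrow> nat \<Rightarrow> real) \<Rightarrow> nat list \<Rightarrow> real" where
  "regret n T l is =
     (\<Sum>t = 1..T. l t (is ! (t - 1))) - (MIN i \<in> {1..n}. \<Sum>t = 1..T. l t i)"

text \<open>
  An oblivious adversary is a probability measure on loss sequences (point masses being the
  deterministic adversaries): the sequence is drawn before, and independently of, the
  algorithm's coins.
\<close>

definition oblivious_adversary :: "nat \<Rightarrow> nat \<Rightarrow> (nat \<Rightarrow> nat \<Rightarrow> real) measure \<Rightarrow> bool" where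
  "oblivious_adversary n T D \<longleftrightarrow> prob_space D \<and> sets D = sets (loss_seqs n T)"

text \<open>Joint law of the loss sequence, the picks of all \<open>T\<close> days, and the final memory state.\<close>

definition play ::
  "nat \<Rightarrow> nat \<Rightarrow> expert_alg \<Rightarrow> (nat \<Rightarrow> nat \<Rightarrow> real) measure
     \<Rightarrow> ((nat \<Rightarrow> nat \<Rightarrow> real) \<times> (nat list \<times> memory)) measure" where
  "play n T A D =
     Giry_Monad.bind D (\<lambda>l. distr (measure_pmf (run A l T))
                               (loss_seqs n T \<Otimes>\<^sub>M count_space UNIV) (\<lambda>\<omega>. (l, \<omega>)))"

end

theory Submission
  imports Defs "HOL-Real_Asymp.Real_Asymp"
begin

text \<open>
  The algorithm stores about \<open>k = S / polylog\<close> experts and plays fixed share over them.  For every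
  level \<open>b\<close>, an epoch of \<open>2\<^sup>b\<close> days starts at each multiple of \<open>2\<^sup>b\<close>, and every expert is then sampled
  with probability \<open>k / n\<close>.  At the end of each dyadic block of days that contains its entry day, a
  stored expert is dropped if its loss since entry is at least that of the best schedule switching
  among other stored experts.  To make survival independent of the expert's own sampling, the samples
  are split into layers of geometrically increasing rate, and an expert is only tested against lower
  layers.  Each layer shrinks a logarithmic potential of the pairs (expert, entry day) not yet covered,
  so that only polylogarithmically many sampled pairs of a block survive.

  Fix an expert \<open>i\<close> and walk through the days: from day \<open>x\<close>, use the longest epoch starting at \<open>x\<close>
  such that \<open>i\<close>, had it been sampled at \<open>x\<close>, would have been dropped at some later time \<open>y\<close>.  Up to
  \<open>y\<close> the stored experts do as well as \<open>i\<close> with few switches, and the walk continues from \<open>y\<close>; if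
  there is no such epoch, one day is lost.  Every step off the grid of the longest epochs is charged to a visited
  epoch in which \<open>i\<close> would survive to the end, and after \<open>n / k\<close> (up to logarithms) such epochs \<open>i\<close>
  has been sampled in one of them with high probability.  So the stored experts follow \<open>i\<close> with about
  \<open>n / k\<close> switches, and fixed share pays \<open>sqrt (n T / k)\<close> for them.
\<close>

subsection \<open>Covering schedules\<close>

text \<open>The number of survivors has to be controlled although survival depends on the samples.
  Hence every random set below is a function of lower layers alone: given those, the coins of the
  layer under study are still independent. Schedules may switch only on entry days of stored pairs.
  This is compatible with the potential argument and makes the test computable in little memory:
  between entry days a schedule is constant, so its cost is made of differences of stored loss
  tails. The roughly k fresh samples of an epoch share one entry day, so distinct entry days are
  polylogarithmically many, and the table of tails (stored expert by entry day) has about k entries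
  up to logarithms instead of k^2. Losses are rounded down to multiples of 1/T, at a total price of
  1. This gives integer advantages, finitely many states and measurability. There is neither a clock
  nor a stored random tape: the state carries the day, and seeds are drawn on the day they are used.
  The analysis collects these draws into one product law, in which memory is a function of seeds and
  losses.\<close>

definition cumloss :: "(nat \<Rightarrow> nat \<Rightarrow> nat) \<Rightarrow> nat \<Rightarrow> nat \<Rightarrow> nat \<Rightarrow> nat" where
  "cumloss g i s t = (\<Sum>d = s..<t. g d i)"

text \<open>\<open>None\<close> is a dummy expert that loses \<open>N\<close>, the maximal integer loss, every day.\<close>

fun choice_cost :: "nat \<Rightarrow> (nat \<Rightarrow> nat \<Rightarrow> nat) \<Rightarrow> nat \<Rightarrow> nat option \<Rightarrow> nat" where
  "choice_cost N g d None = N"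
| "choice_cost N g d (Some i) = g d i"

definition sched_cost :: "nat \<Rightarrow> (nat \<Rightarrow> nat \<Rightarrow> nat) \<Rightarrow> (nat \<Rightarrow> nat option) \<Rightarrow> nat \<Rightarrow> nat \<Rightarrow> nat" where
  "sched_cost N g \<sigma> s t = (\<Sum>d = s..<t. choice_cost N g d (\<sigma> d))"

text \<open>Switching only on entry days bounds the number of switches by the size of
  \<open>F\<close> and makes the cost a function of cumulated losses between entry days. The choice
  at \<open>s\<close> itself is free.\<close>

definition schedule :: "(nat \<times> nat) set \<Rightarrow> nat \<Rightarrow> nat \<Rightarrow> (nat \<Rightarrow> nat option) \<Rightarrow> bool" where
  "schedule F s t \<sigma> \<longleftrightarrow>
     (\<forall>d i. s \<le> d \<longrightarrow> d < t \<longrightarrow> \<sigma> d = Some i \<longrightarrow> (\<exists>e\<le>d. (i, e) \<in> F)) \<and>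
     (\<forall>d. s < d \<longrightarrow> d < t \<longrightarrow> \<sigma> d \<noteq> \<sigma> (d - 1) \<longrightarrow> d \<in> snd ` F)"

definition cover_cost :: "nat \<Rightarrow> (nat \<Rightarrow> nat \<Rightarrow> nat) \<Rightarrow> (nat \<times> nat) set \<Rightarrow> nat \<Rightarrow> nat \<Rightarrow> nat" where
  "cover_cost N g F s t = (LEAST v. \<exists>\<sigma>. schedule F s t \<sigma> \<and> v = sched_cost N g \<sigma> s t)"

lemma cover_cost_attained: "\<exists>\<sigma>. schedule F s t \<sigma> \<and> cover_cost N g F s t = sched_cost N g \<sigma> s t"
proof -
  have "\<exists>v \<sigma>. schedule F s t \<sigma> \<and> v = sched_cost N g \<sigma> s t"
    by (rule exI, rule exI[of _ "\<lambda>_. None"]) (simp add: schedule_def)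
  from LeastI_ex[OF this] show ?thesis
    unfolding cover_cost_def .
qed

lemma cover_cost_le: "schedule F s t \<sigma> \<Longrightarrow> cover_cost N g F s t \<le> sched_cost N g \<sigma> s t"
  unfolding cover_cost_def by (rule Least_le) blast

lemma schedule_mono: "schedule F s t \<sigma> \<Longrightarrow> F \<subseteq> F' \<Longrightarrow> schedule F' s t \<sigma>"
  unfolding schedule_def by (meson image_mono subset_iff)

lemma cover_cost_antimono: "F \<subseteq> F' \<Longrightarrow> cover_cost N g F' s t \<le> cover_cost N g F s t"
  by (metis cover_cost_attained cover_cost_le schedule_mono)

lemma cover_cost_bound: "cover_cost N g F s t \<le> N * (t - s)"
proof -
  have "schedule F s t (\<lambda>_. None)" by (simp add: schedule_def)
  from cover_cost_le[OF this, of N g] show ?thesis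
    by (simp add: sched_cost_def mult.commute)
qed

lemma sched_cost_split:
  "s \<le> e \<Longrightarrow> e \<le> t \<Longrightarrow> sched_cost N g \<sigma> s t = sched_cost N g \<sigma> s e + sched_cost N g \<sigma> e t"
  by (simp add: sched_cost_def sum.atLeastLessThan_concat)

lemma cumloss_split: "s \<le> e \<Longrightarrow> e \<le> t \<Longrightarrow> cumloss g i s t = cumloss g i s e + cumloss g i e t"
  by (simp add: cumloss_def sum.atLeastLessThan_concat)

lemma sched_cost_cong:
  "(\<And>d. s \<le> d \<Longrightarrow> d < t \<Longrightarrow> \<sigma> d = \<sigma>' d) \<Longrightarrow> sched_cost N g \<sigma> s t = sched_cost N g \<sigma>' s t"
  by (simp add: sched_cost_def)

lemma sched_cost_const: "sched_cost N g (\<lambda>_. Some i) s t = cumloss g i s t"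
  by (simp add: sched_cost_def cumloss_def)

text \<open>The optimal schedule from \<open>s\<close> has a suffix that is a schedule from \<open>e\<close>; replacing this suffix
  by \<open>i\<close> saves at least \<open>cover_cost N g F e t - cumloss g i e t\<close>.\<close>

lemma cover_cost_insert:
  assumes "F \<subseteq> F'" "(i, e) \<in> F'" "s \<le> e" "e \<le> t"
  shows "cover_cost N g F' s t + cover_cost N g F e t \<le> cover_cost N g F s t + cumloss g i e t"
proof -
  obtain \<sigma> where \<sigma>: "schedule F s t \<sigma>" "cover_cost N g F s t = sched_cost N g \<sigma> s t"
    using cover_cost_attained by blast
  have "schedule F e t \<sigma>"
    using \<sigma>(1) assms(3) by (auto simp: schedule_def)
  then have 1: "cover_cost N g F e t \<le> sched_cost N g \<sigma> e t"
    by (rule cover_cost_le)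
  define \<sigma>' where "\<sigma>' = (\<lambda>d. if d < e then \<sigma> d else Some i)"
  have s': "schedule F' s t \<sigma>'"
    unfolding schedule_def
  proof (intro conjI allI impI)
    fix d j assume d: "s \<le> d" "d < t" "\<sigma>' d = Some j"
    show "\<exists>e\<le>d. (j, e) \<in> F'"
    proof (cases "d < e")
      case True
      then have "\<sigma> d = Some j" using d by (simp add: \<sigma>'_def)
      then show ?thesis using \<sigma>(1) d assms(1) by (force simp: schedule_def)
    next
      case False
      then have "j = i" "e \<le> d" using d by (auto simp: \<sigma>'_def)
      then show ?thesis using assms(2) by blast
    qed
  next
    fix d assume d: "s < d" "d < t" "\<sigma>' d \<noteq> \<sigma>' (d - 1)"
    consider "d < e" | "d = e" | "d > e" by linarith
    then show "d \<in> snd ` F'"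
    proof cases
      case 1
      then have "d - 1 < e" by simp
      then have "\<sigma> d \<noteq> \<sigma> (d - 1)" using d 1 unfolding \<sigma>'_def by simp
      then have "d \<in> snd ` F" using \<sigma>(1) d by (simp add: schedule_def)
      then show ?thesis using assms(1) by blast
    next
      case 2
      then show ?thesis using assms(2) by force
    next
      case 3
      then have "\<not> d - 1 < e" "\<not> d < e" by auto
      then show ?thesis using d unfolding \<sigma>'_def by simp
    qed
  qed
  have "sched_cost N g \<sigma>' s t = sched_cost N g \<sigma>' s e + sched_cost N g \<sigma>' e t"
    using assms by (intro sched_cost_split) auto
  also have "sched_cost N g \<sigma>' s e = sched_cost N g \<sigma> s e"
    by (rule sched_cost_cong) (simp add: \<sigma>'_def)
  also have "sched_cost N g \<sigma>' e t = cumloss g i e t"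
    unfolding sched_cost_const[where N = N, symmetric] by (rule sched_cost_cong) (simp add: \<sigma>'_def)
  finally show ?thesis
    using cover_cost_le[OF s', of N g] 1 \<sigma>(2) sched_cost_split[OF assms(3,4), of N g \<sigma>] by linarith
qed

text \<open>Between consecutive entry days the schedule is constant, and the loss of an expert on
  such a stretch is the difference of two of its tails up to \<open>t\<close>. Only tails starting
  at \<open>e\<close> or at an entry day, and not before the expert's own entry, are read; these are
  the tails kept in memory.\<close>

lemma sched_cost_determined:
  assumes sch: "schedule F e t \<sigma>" and et: "e \<le> t"
    and eq: "\<And>j e' c. (j, e') \<in> F \<Longrightarrow> c \<in> insert e (snd ` F) \<Longrightarrow> e' \<le> c \<Longrightarrow> c \<le> t \<Longrightarrow>
               cumloss g j c t = cumloss g' j c t"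
    and s: "s \<in> insert e (snd ` F)" "e \<le> s" "s \<le> t"
  shows "sched_cost N g \<sigma> s t = sched_cost N g' \<sigma> s t"
  using s
proof (induction "t - s" arbitrary: s rule: less_induct)
  case less
  show ?case
  proof (cases "s = t")
    case True
    then show ?thesis by (simp add: sched_cost_def)
  next
    case False
    define P where "P = (\<lambda>d. s < d \<and> (d = t \<or> d < t \<and> d \<in> snd ` F))"
    define s' where "s' = (LEAST d. P d)"
    have "P t" using False less.prems by (simp add: P_def)
    then have P: "P s'" and le: "s' \<le> t"
      unfolding s'_def by (auto intro: LeastI Least_le)
    have notP: "\<not> P d" if "d < s'" for d
      using not_less_Least that unfolding s'_def by blast
    have const: "\<sigma> d = \<sigma> s" if "s \<le> d" "d < s'" for d
      using that
    proof (induction d)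
      case 0
      then show ?case by simp
    next
      case (Suc d)
      show ?case
      proof (cases "s = Suc d")
        case False
        then have "\<not> P (Suc d)" "s \<le> d" using notP Suc.prems by auto
        then have "Suc d \<notin> snd ` F" using Suc.prems le by (auto simp: P_def)
        moreover have "e < Suc d" "Suc d < t" using Suc.prems le less.prems False by auto
        ultimately have "\<sigma> (Suc d) = \<sigma> d"
          using sch unfolding schedule_def by (metis diff_Suc_1)
        then show ?thesis using Suc \<open>s \<le> d\<close> by simp
      qed simp
    qed
    have ss': "s < s'" using P by (simp add: P_def)
    have first: "sched_cost N g \<sigma> s s' = sched_cost N g' \<sigma> s s'"
    proof (cases "\<sigma> s")
      case None
      have "sched_cost N h \<sigma> s s' = sched_cost N h (\<lambda>_. None) s s'" for h
        by (rule sched_cost_cong) (simp add: const None)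
      then show ?thesis by (simp add: sched_cost_def)
    next
      case (Some j)
      have c: "sched_cost N h \<sigma> s s' = cumloss h j s s'" for h
        unfolding sched_cost_const[where N = N, symmetric]
        by (rule sched_cost_cong) (simp add: const Some)
      obtain e' where e': "e' \<le> s" "(j, e') \<in> F"
        using sch Some less.prems False unfolding schedule_def by (metis le_neq_implies_less)
      have 1: "cumloss g j s t = cumloss g' j s t"
        using eq[OF e'(2)] less.prems e' by blast
      have 2: "cumloss g j s' t = cumloss g' j s' t"
      proof (cases "s' = t")
        case True
        then show ?thesis by (simp add: cumloss_def)
      next
        case False
        then have "s' \<in> snd ` F" using P by (auto simp: P_def)
        then show ?thesis using eq[OF e'(2)] e'(1) ss' le by auto
      qed
      have "cumloss h j s t = cumloss h j s s' + cumloss h j s' t" for h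
        using ss' le by (intro cumloss_split) auto
      then have "cumloss g j s s' = cumloss g' j s s'" using 1 2 by (metis add_right_imp_eq)
      then show ?thesis by (simp add: c)
    qed
    have "sched_cost N g \<sigma> s' t = sched_cost N g' \<sigma> s' t"
    proof (cases "s' = t")
      case True
      then show ?thesis by (simp add: sched_cost_def)
    next
      case False
      then have "s' \<in> snd ` F" using P by (auto simp: P_def)
      then show ?thesis using less.hyps[of s'] ss' le less.prems by auto
    qed
    then show ?thesis
      using first sched_cost_split[of s s' t N _ \<sigma>] ss' le by simp
  qed
qed

lemma cover_cost_determined:
  assumes "e \<le> t"
    and "\<And>j e' c. (j, e') \<in> F \<Longrightarrow> c \<in> insert e (snd ` F) \<Longrightarrow> e' \<le> c \<Longrightarrow> c \<le> t \<Longrightarrow>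
               cumloss g j c t = cumloss g' j c t"
  shows "cover_cost N g F e t = cover_cost N g' F e t"
proof -
  have "sched_cost N g \<sigma> e t = sched_cost N g' \<sigma> e t" if "schedule F e t \<sigma>" for \<sigma>
    by (rule sched_cost_determined[OF that assms]) (use assms(1) in auto)
  then show ?thesis unfolding cover_cost_def by metis
qed

section \<open>Logarithmic potential of the uncovered pairs\<close>

definition advantage :: "nat \<Rightarrow> (nat \<Rightarrow> nat \<Rightarrow> nat) \<Rightarrow> (nat \<times> nat) set \<Rightarrow> nat \<Rightarrow> nat \<times> nat \<Rightarrow> nat" where
  "advantage N g F t u = cover_cost N g F (snd u) t - cumloss g (fst u) (snd u) t"

text \<open>Subtraction in \<open>advantage\<close> truncates and \<open>floorlog 2 0 = 0\<close>,
  so pairs that the pool covers contribute nothing, while every other pair contributes at least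
  1.\<close>

definition potential :: "nat \<Rightarrow> (nat \<Rightarrow> nat \<Rightarrow> nat) \<Rightarrow> (nat \<times> nat) set \<Rightarrow> nat \<Rightarrow> (nat \<times> nat) set \<Rightarrow> nat" where
  "potential N g F t U = (\<Sum>u\<in>U. floorlog 2 (advantage N g F t u))"

lemma advantage_antimono: "F \<subseteq> F' \<Longrightarrow> advantage N g F' t u \<le> advantage N g F t u"
  unfolding advantage_def by (intro diff_le_mono cover_cost_antimono)

lemma last_true_nat:
  fixes P :: "nat \<Rightarrow> bool"
  assumes "P m" and "\<And>k. P k \<Longrightarrow> k \<le> b"
  obtains k where "m \<le> k" "P k" "\<not> P (Suc k)"
proof
  show "m \<le> (GREATEST k. P k)" by (rule Greatest_le_nat[where P = P, OF assms])
  show "P (GREATEST k. P k)" by (rule GreatestI_nat[where P = P, OF assms])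
  show "\<not> P (Suc (GREATEST k. P k))"
    using Greatest_le_nat[where P = P, OF _ assms(2)] by (meson Suc_n_not_le_n)
qed

text \<open>\<open>m\<close> is the largest threshold that at least half of \<open>U\<close>
  reaches; fewer than half reach \<open>m + 1\<close>, so more than half stay at or below
  \<open>m\<close>. Keys equal to \<open>m\<close> count on both sides.\<close>

lemma exists_median:
  fixes key :: "'a \<Rightarrow> nat"
  assumes "finite U" "U \<noteq> {}"
  shows "\<exists>m. card U \<le> 2 * card {u\<in>U. m \<le> key u} \<and> card U \<le> 2 * card {u\<in>U. key u \<le> m}"
proof -
  define P where "P = (\<lambda>m. card U \<le> 2 * card {u\<in>U. m \<le> key u})"
  have P0: "P 0" by (simp add: P_def)
  have bd: "m \<le> Max (key ` U)" if "P m" for m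
  proof (rule ccontr)
    assume "\<not> ?thesis"
    then have e: "{u\<in>U. m \<le> key u} = {}" using assms by (auto simp: not_le)
    have "card U = 0" using that unfolding P_def e by simp
    then show False using assms by simp
  qed
  obtain m where Pm: "P m" and "\<not> P (Suc m)" by (rule last_true_nat[of P, OF P0 bd])
  then have "2 * card {u\<in>U. Suc m \<le> key u} < card U" by (simp add: P_def)
  moreover have "card U = card {u\<in>U. Suc m \<le> key u} + card {u\<in>U. key u \<le> m}"
    using assms(1)
    by (subst card_Un_disjoint[symmetric]) (auto intro!: arg_cong[where f = card])
  ultimately show ?thesis using Pm unfolding P_def by (intro exI[of _ m]) linarith
qed

text \<open>Among the uncovered pairs take the largest class of equal \<open>floorlog\<close> and its later half \<open>W\<close>:
  adding one element of \<open>W\<close> to the pool at least halves the advantage of every earlier pair of the class.\<close>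

lemma potential_shrink:
  assumes fin: "finite U" "U \<noteq> {}"
    and pos: "\<And>u. u \<in> U \<Longrightarrow> 0 < advantage N g F t u"
    and bnd: "\<And>u. u \<in> U \<Longrightarrow> floorlog 2 (advantage N g F t u) \<le> c"
    and et: "\<And>u. u \<in> U \<Longrightarrow> snd u \<le> t"
  shows "\<exists>W\<subseteq>U. potential N g F t U \<le> 2 * c\<^sup>2 * card W \<and>
     (\<forall>F'. F \<subseteq> F' \<longrightarrow> F' \<inter> W \<noteq> {} \<longrightarrow>
        2 * c\<^sup>2 * potential N g F' t U + potential N g F t U \<le> 2 * c\<^sup>2 * potential N g F t U)"
proof -
  define fl where "fl = (\<lambda>F u. floorlog 2 (advantage N g F t u))"
  define C where "C = (\<lambda>y. {u\<in>U. fl F u = y})"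
  have fl1: "1 \<le> fl F u" if "u \<in> U" for u
    using pos[OF that] by (simp add: fl_def floorlog_def)
  have "U = (\<Union>y\<in>{1..c}. C y)"
    using bnd fl1 by (force simp: C_def fl_def)
  then have "card U \<le> (\<Sum>y\<in>{1..c}. card (C y))"
    by (metis card_UN_le finite_atLeastAtMost)
  have "\<exists>y. card U \<le> c * card (C y)"
  proof (rule ccontr)
    assume "\<not> ?thesis"
    then have "c * card (C y) < card U" for y by (metis not_le)
    moreover have "c > 0" using fin(2) fl1 bnd unfolding fl_def by fastforce
    ultimately have "(\<Sum>y\<in>{1..c}. c * card (C y)) < (\<Sum>y\<in>{1..c}. card U)"
      by (intro sum_strict_mono) auto
    then have "c * (\<Sum>y\<in>{1..c}. card (C y)) < c * card U"
      by (simp add: sum_distrib_left)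
    then show False using \<open>card U \<le> (\<Sum>y\<in>{1..c}. card (C y))\<close> by simp
  qed
  then obtain y where y: "card U \<le> c * card (C y)" by blast
  have finC: "finite (C y)" using fin by (simp add: C_def)
  have "C y \<noteq> {}" using y fin by (auto simp: card_eq_0_iff)
  then obtain m where m: "card (C y) \<le> 2 * card {u\<in>C y. m \<le> snd u}"
      "card (C y) \<le> 2 * card {u\<in>C y. snd u \<le> m}"
    using exists_median[OF finC] by blast
  define W where "W = {u\<in>C y. m \<le> snd u}"
  define E where "E = {u\<in>C y. snd u \<le> m}"
  have pot_le: "potential N g F t U \<le> c * card U"
    unfolding potential_def using sum_bounded_above[of U "\<lambda>u. floorlog 2 (advantage N g F t u)" c] bnd
    by (simp add: mult.commute)
  \<comment> \<open>Origin of \<open>2 * c\<^sup>2\<close>: one \<open>c\<close> bounds each summand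
    of the potential, the other comes from picking the largest of \<open>c\<close> classes, and the
    2 from the median.\<close>
  have big: "potential N g F t U \<le> 2 * c\<^sup>2 * card S" if "card (C y) \<le> 2 * card S" for S :: "(nat \<times> nat) set"
  proof -
    have "potential N g F t U \<le> c * (c * card (C y))"
      using pot_le y by (meson mult_le_mono2 order_trans)
    also have "\<dots> \<le> c * (c * (2 * card S))" using that by (intro mult_le_mono2)
    finally show ?thesis by (simp add: power2_eq_square algebra_simps)
  qed
  have step: "2 * c\<^sup>2 * potential N g F' t U + potential N g F t U \<le> 2 * c\<^sup>2 * potential N g F t U"
    if F': "F \<subseteq> F'" "F' \<inter> W \<noteq> {}" for F'
  proof -
    obtain f where f: "f \<in> F'" "f \<in> W" using F' by blast
    have le: "fl F' u \<le> fl F u" for u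
      unfolding fl_def by (intro floorlog_mono advantage_antimono F')
    \<comment> \<open>\<open>f\<close> enters no earlier than \<open>u\<close>, so a cover starting
      at \<open>snd u\<close> may switch to \<open>f\<close> on its entry day and saves the whole
      advantage of \<open>f\<close>. Both advantages lie between \<open>2 ^ (y - 1)\<close> and
      \<open>2 ^ y\<close>, so the difference drops below \<open>2 ^ (y - 1)\<close>.\<close>
    have less: "fl F' u + 1 \<le> fl F u" if "u \<in> E" for u
    proof -
      have u: "u \<in> U" "fl F u = y" "snd u \<le> snd f" using that f by (auto simp: E_def W_def C_def)
      have f': "f \<in> U" "fl F f = y" using f by (auto simp: W_def C_def)
      have "cover_cost N g F' (snd u) t + cover_cost N g F (snd f) t
              \<le> cover_cost N g F (snd u) t + cumloss g (fst f) (snd f) t"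
        using f(1) F'(1) u(3) et[OF f'(1)] by (intro cover_cost_insert) auto
      then have "advantage N g F' t u \<le> advantage N g F t u - advantage N g F t f"
        using pos[OF u(1)] pos[OF f'(1)] unfolding advantage_def by linarith
      moreover have "2 ^ (y - 1) \<le> advantage N g F t f" "advantage N g F t u < 2 ^ y"
        using floorlog_bounds[of "advantage N g F t f" 2] floorlog_bounds[of "advantage N g F t u" 2]
          pos[OF u(1)] pos[OF f'(1)] u(2) f'(2) by (auto simp: fl_def)
      moreover have "y \<ge> 1" using fl1[OF u(1)] u(2) by simp
      then have "(2::nat) ^ y = 2 * 2 ^ (y - 1)" by (metis power_eq_if not_one_le_zero)
      ultimately have "advantage N g F' t u < 2 ^ (y - 1)" by linarith
      then have "fl F' u \<le> y - 1" unfolding fl_def by (intro floorlog_leI) auto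
      then show ?thesis using u(2) \<open>y \<ge> 1\<close> by simp
    qed
    have "E \<subseteq> U" by (auto simp: E_def C_def)
    have "potential N g F' t U + card E = (\<Sum>u\<in>U. fl F' u + (if u \<in> E then 1 else 0))"
      using fin(1) \<open>E \<subseteq> U\<close> by (simp add: potential_def fl_def sum.distrib sum.If_cases Int_absorb1)
    also have "\<dots> \<le> (\<Sum>u\<in>U. fl F u)"
      using le less by (intro sum_mono) auto
    finally have d: "potential N g F' t U + card E \<le> potential N g F t U"
      by (simp add: potential_def fl_def)
    have "potential N g F t U \<le> 2 * c\<^sup>2 * card E" using big m(2) by (simp add: E_def)
    moreover have "2 * c\<^sup>2 * (potential N g F' t U + card E) \<le> 2 * c\<^sup>2 * potential N g F t U"
      using d by (rule mult_le_mono2)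
    ultimately show ?thesis by (simp add: distrib_left)
  qed
  have "W \<subseteq> U" by (auto simp: W_def C_def)
  moreover have "potential N g F t U \<le> 2 * c\<^sup>2 * card W" using big m(1) by (simp add: W_def)
  ultimately show ?thesis using step by blast
qed

subsection \<open>Sampled pools and their survivors\<close>

definition block_end :: "nat \<Rightarrow> nat \<Rightarrow> nat" where
  "block_end h e = (e div 2 ^ h + 1) * 2 ^ h"

lemma block_end_greater: "e < block_end h e"
  unfolding block_end_def using dividend_less_div_times[of "2 ^ h" e] by simp

lemma dvd_block_end: "2 ^ h dvd block_end h e"
  by (simp add: block_end_def)

lemma dvd_greater_add: "(d::nat) dvd x \<Longrightarrow> d dvd y \<Longrightarrow> x < y \<Longrightarrow> x + d \<le> y"
  by (metis add_diff_cancel_left' dvd_diff_nat dvd_imp_le le_add_diff_inverse nat_add_left_cancel_le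
      nat_less_le zero_less_diff)

lemma block_end_least: "2 ^ h dvd y \<Longrightarrow> e < y \<Longrightarrow> block_end h e \<le> y"
proof -
  assume "2 ^ h dvd y" "e < y"
  moreover have "e div 2 ^ h * 2 ^ h \<le> e" by simp
  ultimately have "e div 2 ^ h * 2 ^ h + 2 ^ h \<le> y"
    by (intro dvd_greater_add dvd_triv_right) linarith+
  then show ?thesis by (simp add: block_end_def algebra_simps)
qed

lemma block_end_mono: "h' \<le> h \<Longrightarrow> block_end h' e \<le> block_end h e"
  by (meson block_end_greater block_end_least dvd_block_end dvd_trans le_imp_power_dvd)

text \<open>The inequality is strict: failing the test means that a schedule over the pool does at
  least as well as the expert since its entry, which is what the comparison walk exploits.\<close>

definition beats :: "nat \<Rightarrow> (nat \<Rightarrow> nat \<Rightarrow> nat) \<Rightarrow> (nat \<Rightarrow> nat \<Rightarrow> (nat \<times> nat) set) \<Rightarrow> nat \<Rightarrow> nat \<times> nat \<Rightarrow> bool" where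
  "beats N g F h u \<longleftrightarrow>
     cumloss g (fst u) (snd u) (block_end h (snd u))
       < cover_cost N g (F h (snd u div 2 ^ h)) (snd u) (block_end h (snd u))"

text \<open>\<open>pool N g b sm r h c\<close> holds the pairs (expert, entry day) of the layers below \<open>r\<close> of level \<open>b\<close>
  that entered during the dyadic block \<open>[c 2\<^sup>h, (c + 1) 2\<^sup>h)\<close> and are still stored when it ends;
  \<open>sm r i e\<close> says that layer \<open>r\<close> samples expert \<open>i\<close> on day \<open>e\<close>.\<close>

primrec pool :: "nat \<Rightarrow> (nat \<Rightarrow> nat \<Rightarrow> nat) \<Rightarrow> nat \<Rightarrow> (nat \<Rightarrow> nat \<Rightarrow> nat \<Rightarrow> bool) \<Rightarrow> nat \<Rightarrow> nat \<Rightarrow> nat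
    \<Rightarrow> (nat \<times> nat) set" where
  "pool N g b sm 0 = (\<lambda>h c. {})"
| "pool N g b sm (Suc r) = (\<lambda>h c. pool N g b sm r h c \<union>
     {u. sm r (fst u) (snd u) \<and> 2 ^ b dvd snd u \<and> snd u div 2 ^ h = c \<and>
         (\<forall>h'. b \<le> h' \<longrightarrow> h' \<le> h \<longrightarrow> beats N g (pool N g b sm r) h' u)})"

text \<open>Sampled and unsampled pairs alike: those that would survive the block if layer
  \<open>r\<close> had sampled them. The set depends on layers below \<open>r\<close> only, so the
  coins that layer \<open>r\<close> tosses for its members are independent of it.\<close>

definition uncovered :: "nat \<Rightarrow> nat \<Rightarrow> (nat \<Rightarrow> nat \<Rightarrow> nat) \<Rightarrow> nat \<Rightarrow> (nat \<Rightarrow> nat \<Rightarrow> nat \<Rightarrow> bool) \<Rightarrow> nat \<Rightarrow> nat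
    \<Rightarrow> nat \<Rightarrow> (nat \<times> nat) set" where
  "uncovered n N g b sm r h c =
     {u. fst u \<in> {1..n} \<and> 2 ^ b dvd snd u \<and> snd u div 2 ^ h = c \<and>
         (\<forall>h'. b \<le> h' \<longrightarrow> h' \<le> h \<longrightarrow> beats N g (pool N g b sm r) h' u)}"

text \<open>Layer \<open>r\<close> at the beginning of day \<open>t\<close>: the tests due at
  \<open>t\<close>, which read losses of days before \<open>t\<close>, have been made, and the
  samples of day \<open>t\<close> are already included.\<close>

definition live :: "nat \<Rightarrow> (nat \<Rightarrow> nat \<Rightarrow> nat) \<Rightarrow> nat \<Rightarrow> (nat \<Rightarrow> nat \<Rightarrow> nat \<Rightarrow> bool) \<Rightarrow> nat \<Rightarrow> nat
    \<Rightarrow> (nat \<times> nat) set" where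
  "live N g b sm r t =
     {u. sm r (fst u) (snd u) \<and> 2 ^ b dvd snd u \<and> snd u \<le> t \<and>
         (\<forall>h. b \<le> h \<longrightarrow> block_end h (snd u) \<le> t \<longrightarrow> beats N g (pool N g b sm r) h u)}"

lemma pool_mono: "r \<le> r' \<Longrightarrow> pool N g b sm r h c \<subseteq> pool N g b sm r' h c"
  by (induction rule: dec_induct) (simp, force)

lemma beats_antimono: "(\<And>h c. F h c \<subseteq> F' h c) \<Longrightarrow> beats N g F' h u \<Longrightarrow> beats N g F h u"
  unfolding beats_def by (rule less_le_trans) (auto intro: cover_cost_antimono)

lemma uncovered_antimono: "uncovered n N g b sm (Suc r) h c \<subseteq> uncovered n N g b sm r h c"
proof -
  have "beats N g (pool N g b sm (Suc r)) h u \<Longrightarrow> beats N g (pool N g b sm r) h u" for h u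
    by (rule beats_antimono[rotated]) (auto intro!: pool_mono)
  then show ?thesis by (auto simp: uncovered_def simp del: pool.simps)
qed

lemma pool_Suc_eq:
  assumes "\<And>r i e. sm r i e \<Longrightarrow> i \<in> {1..n}"
  shows "pool N g b sm (Suc r) h c =
    pool N g b sm r h c \<union> {u \<in> uncovered n N g b sm r h c. sm r (fst u) (snd u)}"
  using assms by (auto simp: uncovered_def)

lemma pool_block: "u \<in> pool N g b sm r h c \<Longrightarrow> snd u div 2 ^ h = c"
  by (induction r) auto

lemma block_end_eq: "e div 2 ^ h = c \<Longrightarrow> block_end h e = (c + 1) * 2 ^ h"
  by (simp add: block_end_def)

lemma uncovered_subset: "uncovered n N g b sm r h c \<subseteq> {1..n} \<times> {..<(c + 1) * 2 ^ h}"
proof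
  fix u assume u: "u \<in> uncovered n N g b sm r h c"
  then have "fst u \<in> {1..n}" "snd u div 2 ^ h = c" by (auto simp: uncovered_def)
  moreover from this have "snd u < (c + 1) * 2 ^ h"
    by (metis block_end_eq block_end_greater)
  ultimately show "u \<in> {1..n} \<times> {..<(c + 1) * 2 ^ h}" by (simp add: mem_Times_iff)
qed

lemma finite_uncovered: "finite (uncovered n N g b sm r h c)"
  by (rule finite_subset[OF uncovered_subset]) simp

text \<open>Serves two purposes: independence (only layers below \<open>r\<close> matter) and
  causality (only coins and losses before the end of the block matter). The induction runs over all
  blocks at once because a pair is also tested at the ends of shorter blocks, which come no
  later.\<close>

lemma pool_determined:
  assumes "\<And>r' i e. r' < r \<Longrightarrow> e < (c + 1) * 2 ^ h \<Longrightarrow> sm r' i e = sm' r' i e"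
    and "\<And>d. d < (c + 1) * 2 ^ h \<Longrightarrow> g d = g' d"
  shows "pool N g b sm r h c = pool N g' b sm' r h c"
  using assms
proof (induction r arbitrary: h c)
  case 0
  then show ?case by simp
next
  case (Suc r)
  have IH: "pool N g b sm r h' c' = pool N g' b sm' r h' c'" if "(c' + 1) * 2 ^ h' \<le> (c + 1) * 2 ^ h" for h' c'
    using Suc.prems that by (intro Suc.IH) (meson less_SucI less_le_trans)+
  have beq: "beats N g (pool N g b sm r) h' u = beats N g' (pool N g' b sm' r) h' u"
    if "snd u div 2 ^ h = c" "h' \<le> h" for h' u
  proof -
    have le: "block_end h' (snd u) \<le> (c + 1) * 2 ^ h"
      using block_end_mono[OF that(2)] block_end_eq[OF that(1)] by metis
    have cl: "cumloss g j s (block_end h' (snd u)) = cumloss g' j s (block_end h' (snd u))" for j s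
      unfolding cumloss_def by (rule sum.cong) (use Suc.prems(2) le in auto)
    have "cover_cost N g F (snd u) (block_end h' (snd u)) = cover_cost N g' F (snd u) (block_end h' (snd u))" for F
      using cl block_end_greater by (intro cover_cost_determined) (auto intro: less_imp_le)
    moreover have "pool N g b sm r h' (snd u div 2 ^ h') = pool N g' b sm' r h' (snd u div 2 ^ h')"
      by (rule IH) (use le in \<open>simp add: block_end_def\<close>)
    ultimately show ?thesis unfolding beats_def cl by simp
  qed
  have sm: "sm r (fst u) (snd u) = sm' r (fst u) (snd u)" if "snd u div 2 ^ h = c" for u
    using Suc.prems(1)[of r "snd u"] block_end_greater[of "snd u" h] block_end_eq[OF that] by simp
  have "pool N g b sm r h c = pool N g' b sm' r h c" by (rule IH) simp
  then show ?case using beq sm by auto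
qed

text \<open>Tests due by a day inside the block of length \<open>2 ^ h\<close> belong to blocks of
  length at most \<open>2 ^ h\<close>, all of which a member of the pool has passed. So a schedule
  over the pool at the end of a block uses only experts that were stored on the days
  concerned.\<close>

lemma live_of_pool:
  assumes "u \<in> pool N g b sm r h c" "b \<le> h" "snd u \<le> d" "d < (c + 1) * 2 ^ h"
  shows "\<exists>r'<r. u \<in> live N g b sm r' d"
  using assms(1)
proof (induction r)
  case 0
  then show ?case by simp
next
  case (Suc r)
  show ?case
  proof (cases "u \<in> pool N g b sm r h c")
    case True
    then show ?thesis using Suc.IH less_SucI by blast
  next
    case False
    then have u: "sm r (fst u) (snd u)" "2 ^ b dvd snd u" "snd u div 2 ^ h = c"
        "\<And>h'. b \<le> h' \<Longrightarrow> h' \<le> h \<Longrightarrow> beats N g (pool N g b sm r) h' u"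
      using Suc.prems by auto
    have "h' \<le> h" if "block_end h' (snd u) \<le> d" for h'
    proof (rule ccontr)
      assume "\<not> h' \<le> h"
      then have "block_end h (snd u) \<le> block_end h' (snd u)" by (intro block_end_mono) simp
      then show False using that block_end_eq[OF u(3)] assms(4) by simp
    qed
    then have "u \<in> live N g b sm r d" using u assms(3) by (auto simp: live_def)
    then show ?thesis by blast
  qed
qed

text \<open>If the binary expansions of \<open>e\<close> and \<open>t\<close> first differ (from the top) at bit \<open>h\<close>, then \<open>e\<close> lies in
  the dyadic block of length \<open>2\<^sup>h\<close> just before the one containing \<open>t\<close>.\<close>

lemma live_subset:
  assumes sm: "\<And>r i e. sm r i e \<Longrightarrow> i \<in> {1..n}" and tH: "t < 2 ^ H"
  shows "live N g b sm r t \<subseteq>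
    {u. sm r (fst u) (snd u) \<and> snd u = t div 2 ^ b * 2 ^ b} \<union>
    (\<Union>h\<in>{h. h < H \<and> b \<le> h \<and> 1 \<le> t div 2 ^ h}.
        {u \<in> uncovered n N g b sm r h (t div 2 ^ h - 1). sm r (fst u) (snd u)})"
proof
  fix u assume u: "u \<in> live N g b sm r t"
  define e where "e = snd u"
  have e: "2 ^ b dvd e" "e \<le> t" using u by (auto simp: live_def e_def)
  show "u \<in> {u. sm r (fst u) (snd u) \<and> snd u = t div 2 ^ b * 2 ^ b} \<union>
    (\<Union>h\<in>{h. h < H \<and> b \<le> h \<and> 1 \<le> t div 2 ^ h}.
        {u \<in> uncovered n N g b sm r h (t div 2 ^ h - 1). sm r (fst u) (snd u)})"
  proof (cases "e div 2 ^ b = t div 2 ^ b")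
    case True
    then have "e = t div 2 ^ b * 2 ^ b" using e(1) by (metis dvd_div_mult_self)
    then show ?thesis using u by (auto simp: live_def e_def)
  next
    case False
    have bH: "b < H"
    proof (rule ccontr)
      assume "\<not> b < H"
      then have "t < 2 ^ b" using tH by (metis less_le_trans not_less one_le_numeral power_increasing)
      then show False using False e(2) by simp
    qed
    define P where "P = (\<lambda>h. e div 2 ^ h \<noteq> t div 2 ^ h)"
    have PH: "\<not> P h" if "H \<le> h" for h
    proof -
      have "t < 2 ^ h" using tH that by (metis less_le_trans one_le_numeral power_increasing)
      then show ?thesis using e(2) by (simp add: P_def)
    qed
    have "P b" using False by (simp add: P_def)
    moreover have "h \<le> H" if "P h" for h using PH[of h] that by (cases "H \<le> h") auto
    ultimately obtain h where h: "P h" "b \<le> h" and nP: "\<not> P (Suc h)" by (rule last_true_nat[of P])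
    have hH: "h < H" using h(1) PH not_le by blast
    have "e div 2 ^ h \<le> t div 2 ^ h" using e(2) by (rule div_le_mono)
    then have lt: "e div 2 ^ h < t div 2 ^ h" using h(1) by (simp add: P_def)
    have "e div 2 ^ h div 2 = t div 2 ^ h div 2"
      using nP by (simp add: P_def div_mult2_eq[symmetric] mult.commute)
    then have ed: "e div 2 ^ h = t div 2 ^ h - 1" using lt by linarith
    have "block_end h e \<le> t"
      unfolding block_end_def using lt ed by (metis One_nat_def Suc_eq_plus1 Suc_leI div_times_less_eq_dividend
        dual_order.trans mult_le_mono1)
    then have "beats N g (pool N g b sm r) h' u" if "b \<le> h'" "h' \<le> h" for h'
      using u that block_end_mono[OF that(2), of e] by (auto simp: live_def e_def)
    then have "u \<in> uncovered n N g b sm r h (t div 2 ^ h - 1)"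
      using u ed e sm by (auto simp: uncovered_def live_def e_def)
    then show ?thesis using hH h(2) lt u by (auto simp: live_def)
  qed
qed

section \<open>Decrease of the potential of a block from layer to layer\<close>

definition layer_potential :: "nat \<Rightarrow> nat \<Rightarrow> (nat \<Rightarrow> nat \<Rightarrow> nat) \<Rightarrow> nat \<Rightarrow> (nat \<Rightarrow> nat \<Rightarrow> nat \<Rightarrow> bool) \<Rightarrow> nat \<Rightarrow> nat
    \<Rightarrow> nat \<Rightarrow> nat" where
  "layer_potential n N g b sm r h c =
     potential N g (pool N g b sm r h c) ((c + 1) * 2 ^ h) (uncovered n N g b sm r h c)"

text \<open>One choice of the set \<open>W\<close> of \<open>potential_shrink\<close>. It is a
  function of \<open>uncovered\<close>, \<open>pool\<close> and the losses, hence of layers below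
  \<open>r\<close>, so layer \<open>r\<close> samples it with fresh coins.\<close>

definition critical :: "nat \<Rightarrow> nat \<Rightarrow> (nat \<Rightarrow> nat \<Rightarrow> nat) \<Rightarrow> nat \<Rightarrow> (nat \<Rightarrow> nat \<Rightarrow> nat \<Rightarrow> bool) \<Rightarrow> nat \<Rightarrow> nat
    \<Rightarrow> nat \<Rightarrow> nat \<Rightarrow> (nat \<times> nat) set" where
  "critical n N g b sm r h c L =
     (SOME W. W \<subseteq> uncovered n N g b sm r h c \<and> layer_potential n N g b sm r h c \<le> 2 * L\<^sup>2 * card W \<and>
       (\<forall>F'. pool N g b sm r h c \<subseteq> F' \<longrightarrow> F' \<inter> W \<noteq> {} \<longrightarrow>
          2 * L\<^sup>2 * potential N g F' ((c + 1) * 2 ^ h) (uncovered n N g b sm r h c)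
            + layer_potential n N g b sm r h c \<le> 2 * L\<^sup>2 * layer_potential n N g b sm r h c))"

lemma advantage_bound: "advantage N g F t u \<le> N * t"
  unfolding advantage_def using cover_cost_bound[of N g F "snd u" t]
  by (meson diff_le_self dual_order.trans mult_le_mono2)

lemma advantage_pos:
  assumes "u \<in> uncovered n N g b sm r h c" "b \<le> h"
  shows "0 < advantage N g (pool N g b sm r h c) ((c + 1) * 2 ^ h) u"
proof -
  have c: "snd u div 2 ^ h = c" using assms(1) by (simp add: uncovered_def)
  have "beats N g (pool N g b sm r) h u" using assms by (auto simp: uncovered_def)
  then show ?thesis unfolding advantage_def beats_def c block_end_eq[OF c] by simp
qed

lemma critical_props:
  assumes "b \<le> h" "N * ((c + 1) * 2 ^ h) < 2 ^ L"
  shows "critical n N g b sm r h c L \<subseteq> uncovered n N g b sm r h c"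
    and "layer_potential n N g b sm r h c \<le> 2 * L\<^sup>2 * card (critical n N g b sm r h c L)"
    and "\<And>F'. pool N g b sm r h c \<subseteq> F' \<Longrightarrow> F' \<inter> critical n N g b sm r h c L \<noteq> {} \<Longrightarrow>
          2 * L\<^sup>2 * potential N g F' ((c + 1) * 2 ^ h) (uncovered n N g b sm r h c)
            + layer_potential n N g b sm r h c \<le> 2 * L\<^sup>2 * layer_potential n N g b sm r h c"
proof -
  let ?U = "uncovered n N g b sm r h c"
  have "\<exists>W. W \<subseteq> ?U \<and> layer_potential n N g b sm r h c \<le> 2 * L\<^sup>2 * card W \<and>
       (\<forall>F'. pool N g b sm r h c \<subseteq> F' \<longrightarrow> F' \<inter> W \<noteq> {} \<longrightarrow>
          2 * L\<^sup>2 * potential N g F' ((c + 1) * 2 ^ h) ?U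
            + layer_potential n N g b sm r h c \<le> 2 * L\<^sup>2 * layer_potential n N g b sm r h c)"
  proof (cases "?U = {}")
    case True
    then show ?thesis by (intro exI[of _ "{}"]) (simp add: layer_potential_def potential_def)
  next
    case False
    have "\<exists>W\<subseteq>?U. potential N g (pool N g b sm r h c) ((c + 1) * 2 ^ h) ?U \<le> 2 * L\<^sup>2 * card W \<and>
     (\<forall>F'. pool N g b sm r h c \<subseteq> F' \<longrightarrow> F' \<inter> W \<noteq> {} \<longrightarrow>
        2 * L\<^sup>2 * potential N g F' ((c + 1) * 2 ^ h) ?U + potential N g (pool N g b sm r h c) ((c + 1) * 2 ^ h) ?U
         \<le> 2 * L\<^sup>2 * potential N g (pool N g b sm r h c) ((c + 1) * 2 ^ h) ?U)"
    proof (rule potential_shrink[OF finite_uncovered False])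
      show "0 < advantage N g (pool N g b sm r h c) ((c + 1) * 2 ^ h) u" if "u \<in> ?U" for u
        by (rule advantage_pos[OF that assms(1)])
      show "floorlog 2 (advantage N g (pool N g b sm r h c) ((c + 1) * 2 ^ h) u) \<le> L" for u
        using advantage_bound[of N g _ "(c + 1) * 2 ^ h" u] assms(2)
        by (intro floorlog_leI) (auto intro: le_less_trans)
      show "snd u \<le> (c + 1) * 2 ^ h" if "u \<in> ?U" for u
        using that block_end_greater[of "snd u" h] block_end_eq[of "snd u" h c]
        by (auto simp: uncovered_def)
    qed
    then show ?thesis unfolding layer_potential_def by blast
  qed
  from someI_ex[OF this] show
    "critical n N g b sm r h c L \<subseteq> ?U"
    "layer_potential n N g b sm r h c \<le> 2 * L\<^sup>2 * card (critical n N g b sm r h c L)"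
    "\<And>F'. pool N g b sm r h c \<subseteq> F' \<Longrightarrow> F' \<inter> critical n N g b sm r h c L \<noteq> {} \<Longrightarrow>
          2 * L\<^sup>2 * potential N g F' ((c + 1) * 2 ^ h) ?U
            + layer_potential n N g b sm r h c \<le> 2 * L\<^sup>2 * layer_potential n N g b sm r h c"
    unfolding critical_def[symmetric] by blast+
qed

lemma potential_mono: "F \<subseteq> F' \<Longrightarrow> U' \<subseteq> U \<Longrightarrow> finite U \<Longrightarrow> potential N g F' t U' \<le> potential N g F t U"
proof -
  assume a: "F \<subseteq> F'" "U' \<subseteq> U" "finite U"
  have "potential N g F' t U' \<le> potential N g F' t U"
    unfolding potential_def using a by (intro sum_mono2) auto
  also have "\<dots> \<le> potential N g F t U"
    unfolding potential_def by (intro sum_mono floorlog_mono advantage_antimono a)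
  finally show ?thesis .
qed

lemma layer_potential_Suc:
  "layer_potential n N g b sm (Suc r) h c \<le> layer_potential n N g b sm r h c"
  unfolding layer_potential_def
  by (intro potential_mono uncovered_antimono finite_uncovered pool_mono) simp

text \<open>A sampled critical pair is uncovered and therefore joins the next pool.
  \<open>critical_props\<close> bounds the new potential over the old uncovered set; that the
  uncovered set also shrinks can only help.\<close>

lemma layer_potential_hit:
  assumes sm: "\<And>r i e. sm r i e \<Longrightarrow> i \<in> {1..n}" and "b \<le> h" "N * ((c + 1) * 2 ^ h) < 2 ^ L"
    and hit: "u \<in> critical n N g b sm r h c L" "sm r (fst u) (snd u)"
  shows "2 * L\<^sup>2 * layer_potential n N g b sm (Suc r) h c + layer_potential n N g b sm r h c
           \<le> 2 * L\<^sup>2 * layer_potential n N g b sm r h c"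
proof -
  note cr = critical_props[OF assms(2,3), where n = n and g = g and sm = sm and r = r]
  have "u \<in> pool N g b sm (Suc r) h c"
    using cr(1) hit by (subst pool_Suc_eq[OF sm]) auto
  then have "2 * L\<^sup>2 * potential N g (pool N g b sm (Suc r) h c) ((c + 1) * 2 ^ h) (uncovered n N g b sm r h c)
      + layer_potential n N g b sm r h c \<le> 2 * L\<^sup>2 * layer_potential n N g b sm r h c"
    using hit(1) by (intro cr(3) pool_mono) auto
  moreover have "layer_potential n N g b sm (Suc r) h c
      \<le> potential N g (pool N g b sm (Suc r) h c) ((c + 1) * 2 ^ h) (uncovered n N g b sm r h c)"
    unfolding layer_potential_def by (intro potential_mono uncovered_antimono finite_uncovered) auto
  ultimately show ?thesis
    by (meson add_le_mono1 le_trans mult_le_mono2)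
qed

lemma card_uncovered_le:
  assumes "b \<le> h"
  shows "card (uncovered n N g b sm r h c) \<le> layer_potential n N g b sm r h c"
proof -
  have "card (uncovered n N g b sm r h c) = (\<Sum>u\<in>uncovered n N g b sm r h c. 1)" by simp
  also have "\<dots> \<le> layer_potential n N g b sm r h c"
    unfolding layer_potential_def potential_def
    using advantage_pos[OF _ assms] by (intro sum_mono) (auto simp: floorlog_def)
  finally show ?thesis .
qed

lemma layer_potential_le:
  assumes "N * ((c + 1) * 2 ^ h) < 2 ^ L"
  shows "layer_potential n N g b sm r h c \<le> L * (n * ((c + 1) * 2 ^ h))"
proof -
  have "layer_potential n N g b sm r h c \<le> (\<Sum>u\<in>uncovered n N g b sm r h c. L)"
    unfolding layer_potential_def potential_def
  proof (rule sum_mono)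
    fix u
    show "floorlog 2 (advantage N g (pool N g b sm r h c) ((c + 1) * 2 ^ h) u) \<le> L"
      using advantage_bound[of N g _ "(c + 1) * 2 ^ h" u] assms
      by (intro floorlog_leI) (auto intro: le_less_trans)
  qed
  also have "\<dots> = L * card (uncovered n N g b sm r h c)" by simp
  also have "\<dots> \<le> L * card ({1..n} \<times> {..<(c + 1) * 2 ^ h})"
    by (intro mult_le_mono2 card_mono uncovered_subset) simp
  finally show ?thesis by (simp del: One_nat_def)
qed

text \<open>The invariant is potential times rate at most \<open>X\<close>. If the product exceeds
  \<open>\<rho> * X\<close>, a critical pair is hit and the potential falls by the factor
  \<open>\<rho>\<close> by which the rate was below the next one. Otherwise the rate alone grows, by
  \<open>1 / \<rho>\<close>, and the product stays below \<open>X\<close>.\<close>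

lemma layer_potential_scaled:
  fixes q X :: real
  assumes sm: "\<And>r i e. sm r i e \<Longrightarrow> i \<in> {1..n}" and bh: "b \<le> h" and NL: "N * ((c + 1) * 2 ^ h) < 2 ^ L"
    and L: "L \<ge> 1" and q: "0 \<le> q" and rho: "\<rho> = 1 - 1 / (2 * real L ^ 2)"
    and start: "real (L * (n * ((c + 1) * 2 ^ h))) * (q * \<rho> ^ R) \<le> X"
    and hit: "\<And>r. r < R \<Longrightarrow> \<rho> * X < real (layer_potential n N g b sm r h c) * (q * \<rho> ^ (R - r)) \<Longrightarrow>
                \<exists>u\<in>critical n N g b sm r h c L. sm r (fst u) (snd u)"
    and "r \<le> R"
  shows "real (layer_potential n N g b sm r h c) * (q * \<rho> ^ (R - r)) \<le> X"
proof -
  have L2: "real L ^ 2 \<ge> 1" using L by simp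
  have "1 / (2 * real L ^ 2) \<le> 1 / 2" using L2 L by (intro divide_left_mono) auto
  then have rpos: "\<rho> > 0" by (simp add: rho)
  define A where "A = 2 * real L ^ 2"
  have A: "A > 0" using L by (simp add: A_def)
  show ?thesis
    using \<open>r \<le> R\<close>
  proof (induction r)
    case 0
    have "real (layer_potential n N g b sm 0 h c) * (q * \<rho> ^ (R - 0))
        \<le> real (L * (n * ((c + 1) * 2 ^ h))) * (q * \<rho> ^ (R - 0))"
      using layer_potential_le[OF NL, of n g b sm 0] q rpos
      by (intro mult_right_mono) (simp_all only: of_nat_le_iff, simp)
    also have "\<dots> \<le> X" using start unfolding diff_zero .
    finally show ?case .
  next
    case (Suc r)
    let ?P = "\<lambda>r. real (layer_potential n N g b sm r h c)"
    have pw: "\<rho> ^ (R - r) = \<rho> * \<rho> ^ (R - Suc r)" using Suc.prems by (metis Suc_diff_le diff_Suc_Suc power_Suc)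
    have IH: "?P r * (q * \<rho> ^ (R - r)) \<le> X" using Suc by simp
    show ?case
    proof (cases "\<rho> * X < ?P r * (q * \<rho> ^ (R - r))")
      case True
      then obtain u where "u \<in> critical n N g b sm r h c L" "sm r (fst u) (snd u)"
        using hit[OF Suc_le_lessD[OF Suc.prems] True] by blast
      from layer_potential_hit[OF sm bh NL this]
      have "real (2 * L\<^sup>2 * layer_potential n N g b sm (Suc r) h c + layer_potential n N g b sm r h c)
             \<le> real (2 * L\<^sup>2 * layer_potential n N g b sm r h c)" by (simp only: of_nat_le_iff)
      then have "2 * real L ^ 2 * ?P (Suc r) + ?P r \<le> 2 * real L ^ 2 * ?P r" by simp
      then have "A * ?P (Suc r) + ?P r \<le> A * ?P r" by (simp add: A_def)
      then have "?P (Suc r) \<le> (A * ?P r - ?P r) / A"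
        using A by (simp add: pos_le_divide_eq mult.commute)
      also have "\<dots> = \<rho> * ?P r" using A by (simp add: rho A_def[symmetric] field_simps)
      finally have le: "?P (Suc r) \<le> \<rho> * ?P r" .
      have "?P (Suc r) * (q * \<rho> ^ (R - Suc r)) \<le> \<rho> * ?P r * (q * \<rho> ^ (R - Suc r))"
        using q rpos by (intro mult_right_mono le) auto
      also have "\<dots> = ?P r * (q * \<rho> ^ (R - r))" by (simp add: pw)
      finally show ?thesis using IH by linarith
    next
      case False
      have "?P (Suc r) * (q * \<rho> ^ (R - Suc r)) \<le> ?P r * (q * \<rho> ^ (R - Suc r))"
        using q rpos layer_potential_Suc by (intro mult_right_mono) auto
      moreover have "\<rho> * (?P r * (q * \<rho> ^ (R - Suc r))) \<le> \<rho> * X" using False by (simp add: pw algebra_simps)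
      ultimately show ?thesis using rpos by (auto intro: order_trans)
    qed
  qed
qed

subsection \<open>The comparison walk\<close>

text \<open>A block of length at least \<open>2 ^ Suc v\<close> ends at a multiple of
  \<open>2 ^ Suc v\<close>, the first of which after \<open>y\<close> is
  \<open>y + 2 ^ Suc v\<close>, too far away. A shorter block starting before \<open>y\<close> ends
  at \<open>y\<close> or earlier, because \<open>y\<close> is a multiple of its length. A unit step
  cannot pass over \<open>y\<close>.\<close>

lemma block_crossing:
  assumes y: "2 ^ Suc v dvd y" and xy: "x < y" "y < z" "z \<le> y + 2 ^ v"
    and z: "z = x + 1 \<or> (\<exists>h. z = block_end h x)"
  shows False
proof -
  from z xy obtain h where h: "z = block_end h x" by auto
  show False
  proof (cases "Suc v \<le> h")
    case True
    then have "2 ^ Suc v dvd z" using h dvd_block_end le_imp_power_dvd dvd_trans by metis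
    then have "y + 2 ^ Suc v \<le> z" using y xy by (intro dvd_greater_add)
    moreover have "(0::nat) < 2 ^ v" by simp
    ultimately show ?thesis using xy(3) unfolding power_Suc by linarith
  next
    case False
    then have "(2::nat) ^ h dvd 2 ^ Suc v" by (intro le_imp_power_dvd) simp
    then have "2 ^ h dvd y" using y by (rule dvd_trans)
    then have "block_end h x \<le> y" using xy(1) by (rule block_end_least)
    then show ?thesis using h xy by simp
  qed
qed

text \<open>\<open>v\<close> is the position of the lowest set bit of \<open>x\<close>.\<close>

lemma lowest_bit_split:
  "\<not> (2::nat) ^ \<beta> dvd x \<Longrightarrow> \<exists>v<\<beta>. 2 ^ v \<le> x \<and> 2 ^ Suc v dvd x - 2 ^ v"
proof (induction \<beta>)
  case 0
  then show ?case by simp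
next
  case (Suc \<beta>)
  show ?case
  proof (cases "(2::nat) ^ \<beta> dvd x")
    case True
    then obtain k where k: "x = 2 ^ \<beta> * k" by (auto elim: dvdE)
    with Suc.prems have "odd k" by (auto simp: mult.commute)
    then obtain l where l: "k = 2 * l + 1" by (auto elim: oddE)
    have "x - 2 ^ \<beta> = 2 ^ Suc \<beta> * l" by (simp add: k l)
    moreover have "2 ^ \<beta> \<le> x" by (simp add: k l)
    ultimately show ?thesis by (metis dvd_triv_left lessI)
  next
    case False
    then show ?thesis using Suc.IH less_SucI by blast
  qed
qed

text \<open>A visited point that is not a multiple of \<open>2\<^sup>\<beta>\<close> is \<open>y + 2\<^sup>v\<close> with \<open>2\<^bsup>v+1\<^esup>\<close> dividing \<open>y\<close>.
  No jump passes over \<open>y\<close> and lands at \<open>y + 2\<^sup>v\<close>, so \<open>y\<close> was visited, and it was left by a jump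
  shorter than \<open>2\<^bsup>v+1\<^esup>\<close>.\<close>

lemma walk_count:
  fixes z :: "nat \<Rightarrow> nat"
  assumes z0: "z 0 = 0"
    and step: "\<And>j. z (Suc j) = z j + 1 \<or> (\<exists>h. z (Suc j) = block_end h (z j))"
    and fin: "finite Bad"
    and bad: "\<And>j b. j < m \<Longrightarrow> b \<le> \<beta> \<Longrightarrow> 2 ^ b dvd z j \<Longrightarrow> (b, z j) \<in> Bad \<or> z j + 2 ^ b \<le> z (Suc j)"
  shows "m \<le> z m div 2 ^ \<beta> + card Bad"
proof -
  have inc: "z j < z (Suc j)" for j
    using step[of j] block_end_greater[of "z j"] by auto
  have sm: "strict_mono z" using inc by (rule strict_monoI_Suc)
  \<comment> \<open>A point \<open>y + 2 ^ v\<close> off the grid is recovered from the bad pair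
    \<open>(Suc v, y)\<close>, which explains the exponent \<open>b - 1\<close>.\<close>
  have sub: "z ` {1..m} \<subseteq> (\<lambda>q. q * 2 ^ \<beta>) ` {1..z m div 2 ^ \<beta>} \<union> (\<lambda>(b, y). y + 2 ^ (b - 1)) ` Bad"
  proof
    fix x assume "x \<in> z ` {1..m}"
    then obtain k where k: "x = z k" "1 \<le> k" "k \<le> m" by auto
    have xpos: "0 < x" using strict_monoD[OF sm, of 0 k] k z0 by simp
    have xm: "x \<le> z m" using k strict_mono_less_eq[OF sm] by simp
    show "x \<in> (\<lambda>q. q * 2 ^ \<beta>) ` {1..z m div 2 ^ \<beta>} \<union> (\<lambda>(b, y). y + 2 ^ (b - 1)) ` Bad"
    proof (cases "2 ^ \<beta> dvd x")
      case True
      then obtain q where q: "x = q * 2 ^ \<beta>" by (auto elim: dvdE simp: mult.commute)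
      then have "q \<ge> 1" using xpos by (cases q) auto
      moreover have "q \<le> z m div 2 ^ \<beta>" using xm q by (simp add: less_eq_div_iff_mult_less_eq)
      ultimately show ?thesis using q by auto
    next
      case False
      then obtain v where v: "v < \<beta>" "2 ^ v \<le> x" "2 ^ Suc v dvd x - 2 ^ v" using lowest_bit_split by blast
      define y where "y = x - 2 ^ v"
      have yx: "x = y + 2 ^ v" using v by (simp add: y_def)
      have ylt: "y < x" by (simp add: yx)
      have bdd: "j \<le> y" if "z j \<le> y" for j
        using that strict_mono_imp_increasing[OF sm, of j] by simp
      have P0: "z 0 \<le> y" by (simp add: z0)
      obtain j where j: "z j \<le> y" and "\<not> z (Suc j) \<le> y"
        by (rule last_true_nat[of "\<lambda>j. z j \<le> y", OF P0 bdd])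
      then have j': "y < z (Suc j)" by simp
      have jk: "j < k" using j ylt k(1) strict_mono_less[OF sm, of j k] by simp
      then have le: "z (Suc j) \<le> x" using k(1) strict_mono_less_eq[OF sm, of "Suc j" k] by simp
      have zj: "z j = y"
      proof (rule ccontr)
        assume "z j \<noteq> y"
        then show False
          using block_crossing[of v y "z j" "z (Suc j)"] v(3) j j' le step[of j]
          by (simp add: y_def[symmetric] yx[symmetric])
      qed
      have "(Suc v, y) \<in> Bad"
      proof (rule ccontr)
        assume "(Suc v, y) \<notin> Bad"
        then have "y + 2 ^ Suc v \<le> z (Suc j)"
          using bad[of j "Suc v"] jk k(3) v(1) v(3)[folded y_def] zj by auto
        moreover have "(0::nat) < 2 ^ v" by simp
        ultimately show False using le yx unfolding power_Suc by linarith
      qed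
      then show ?thesis using yx by force
    qed
  qed
  have "m = card (z ` {1..m})"
    using inj_on_subset[OF strict_mono_on_imp_inj_on[OF sm], of "{1..m}"] by (simp add: card_image)
  also have "\<dots> \<le> card ((\<lambda>q. q * 2 ^ \<beta>) ` {1..z m div 2 ^ \<beta>} \<union> (\<lambda>(b, y). y + 2 ^ (b - 1)) ` Bad)"
    using fin by (intro card_mono sub) auto
  also have "\<dots> \<le> card ((\<lambda>q. q * 2 ^ \<beta>) ` {1..z m div 2 ^ \<beta>}) + card ((\<lambda>(b, y). y + 2 ^ (b - 1)) ` Bad)"
    by (rule card_Un_le)
  also have "\<dots> \<le> card {1..z m div 2 ^ \<beta>} + card Bad"
    using fin by (intro add_mono card_image_le) auto
  finally show ?thesis by simp
qed

section \<open>Schedules pieced together along the walk of an expert\<close>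

definition changes :: "(nat \<Rightarrow> nat option) \<Rightarrow> nat \<Rightarrow> nat \<Rightarrow> nat set" where
  "changes \<sigma> s t = {d. s < d \<and> d < t \<and> \<sigma> d \<noteq> \<sigma> (d - 1)}"

definition splice :: "nat \<Rightarrow> (nat \<Rightarrow> nat option) \<Rightarrow> (nat \<Rightarrow> nat option) \<Rightarrow> nat \<Rightarrow> nat option" where
  "splice s \<sigma> \<sigma>' d = (if d < s then \<sigma> d else \<sigma>' d)"

lemma finite_changes [simp]: "finite (changes \<sigma> s t)"
  by (rule finite_subset[of _ "{..<t}"]) (auto simp: changes_def)

lemma card_changes_splice:
  "card (changes (splice s \<sigma> \<sigma>') 0 t) \<le> card (changes \<sigma> 0 s) + 1 + card (changes \<sigma>' s t)"
proof -
  have "changes (splice s \<sigma> \<sigma>') 0 t \<subseteq> insert s (changes \<sigma> 0 s) \<union> changes \<sigma>' s t"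
    by (auto simp: changes_def splice_def split: if_splits)
  then have "card (changes (splice s \<sigma> \<sigma>') 0 t) \<le> card (insert s (changes \<sigma> 0 s) \<union> changes \<sigma>' s t)"
    by (intro card_mono) auto
  also have "\<dots> \<le> card (insert s (changes \<sigma> 0 s)) + card (changes \<sigma>' s t)" by (rule card_Un_le)
  also have "card (insert s (changes \<sigma> 0 s)) \<le> card (changes \<sigma> 0 s) + 1" by (simp add: card_insert_if)
  finally show ?thesis by simp
qed

lemma sched_cost_splice:
  "s \<le> t \<Longrightarrow> sched_cost N g (splice s \<sigma> \<sigma>') 0 t = sched_cost N g \<sigma> 0 s + sched_cost N g \<sigma>' s t"
  by (subst sched_cost_split[of 0 s]) (auto simp: splice_def intro!: arg_cong2[where f = plus] sched_cost_cong)

definition live_experts :: "nat \<Rightarrow> (nat \<Rightarrow> nat \<Rightarrow> nat) \<Rightarrow> nat \<Rightarrow> nat \<Rightarrow> (nat \<Rightarrow> nat \<Rightarrow> nat \<Rightarrow> nat \<Rightarrow> bool) \<Rightarrow> nat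
    \<Rightarrow> nat set" where
  "live_experts N g \<beta> R sm d = {i. \<exists>b\<le>\<beta>. \<exists>r\<le>R. \<exists>e. (i, e) \<in> live N g b (sm b) r d}"

definition follows :: "nat \<Rightarrow> (nat \<Rightarrow> nat \<Rightarrow> nat) \<Rightarrow> nat \<Rightarrow> nat \<Rightarrow> (nat \<Rightarrow> nat \<Rightarrow> nat \<Rightarrow> nat \<Rightarrow> bool)
    \<Rightarrow> (nat \<Rightarrow> nat option) \<Rightarrow> nat \<Rightarrow> nat \<Rightarrow> bool" where
  "follows N g \<beta> R sm \<sigma> s t \<longleftrightarrow>
     (\<forall>d i. s \<le> d \<longrightarrow> d < t \<longrightarrow> \<sigma> d = Some i \<longrightarrow> i \<in> live_experts N g \<beta> R sm d)"

lemma follows_splice: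
  "follows N g \<beta> R sm \<sigma> 0 s \<Longrightarrow> follows N g \<beta> R sm \<sigma>' s t \<Longrightarrow> follows N g \<beta> R sm (splice s \<sigma> \<sigma>') 0 t"
  by (auto simp: follows_def splice_def)

text \<open>The pools are those of the layers below \<open>R\<close>, so this is the fate that
  \<open>i\<close> would have if layer \<open>R\<close> sampled it at \<open>x\<close>; whether that
  happens does not enter. Tests due after the horizon \<open>D\<close> do not count.\<close>

definition caught :: "nat \<Rightarrow> (nat \<Rightarrow> nat \<Rightarrow> nat) \<Rightarrow> nat \<Rightarrow> (nat \<Rightarrow> nat \<Rightarrow> nat \<Rightarrow> nat \<Rightarrow> bool) \<Rightarrow> nat \<Rightarrow> nat
    \<Rightarrow> nat \<Rightarrow> nat \<Rightarrow> nat \<Rightarrow> bool" where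
  "caught N g R sm D i b h x \<longleftrightarrow>
     b \<le> h \<and> 2 ^ b dvd x \<and> block_end h x \<le> D \<and> \<not> beats N g (pool N g b (sm b) R) h (i, x)"

text \<open>With the greatest level the jump is at least as long as every epoch at \<open>x\<close>
  that could have been used. A shorter step thus certifies that all longer epochs starting at
  \<open>x\<close> are never caught, as the charging in \<open>walk_count\<close> demands.\<close>

definition walk_step :: "nat \<Rightarrow> (nat \<Rightarrow> nat \<Rightarrow> nat) \<Rightarrow> nat \<Rightarrow> nat \<Rightarrow> (nat \<Rightarrow> nat \<Rightarrow> nat \<Rightarrow> nat \<Rightarrow> bool) \<Rightarrow> nat \<Rightarrow> nat
    \<Rightarrow> nat \<Rightarrow> nat" where
  "walk_step N g \<beta> R sm D i x =
     (if \<exists>b\<le>\<beta>. \<exists>h. caught N g R sm D i b h x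
      then let b = (GREATEST b. b \<le> \<beta> \<and> (\<exists>h. caught N g R sm D i b h x))
           in block_end (SOME h. caught N g R sm D i b h x) x
      else x + 1)"

definition walk :: "nat \<Rightarrow> (nat \<Rightarrow> nat \<Rightarrow> nat) \<Rightarrow> nat \<Rightarrow> nat \<Rightarrow> (nat \<Rightarrow> nat \<Rightarrow> nat \<Rightarrow> nat \<Rightarrow> bool) \<Rightarrow> nat \<Rightarrow> nat
    \<Rightarrow> nat \<Rightarrow> nat" where
  "walk N g \<beta> R sm D i j = (walk_step N g \<beta> R sm D i ^^ j) 0"

lemma walk_0: "walk N g \<beta> R sm D i 0 = 0"
  by (simp add: walk_def)

lemma walk_Suc: "walk N g \<beta> R sm D i (Suc j) = walk_step N g \<beta> R sm D i (walk N g \<beta> R sm D i j)"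
  by (simp add: walk_def)

lemma walk_step_caught:
  assumes "b \<le> \<beta>" "caught N g R sm D i b h x"
  shows "\<exists>b' h'. b \<le> b' \<and> b' \<le> \<beta> \<and> caught N g R sm D i b' h' x \<and> walk_step N g \<beta> R sm D i x = block_end h' x"
proof -
  define P where "P = (\<lambda>b. b \<le> \<beta> \<and> (\<exists>h. caught N g R sm D i b h x))"
  have Pb: "P b" using assms by (auto simp: P_def)
  have bdd: "\<And>y. P y \<Longrightarrow> y \<le> \<beta>" by (simp add: P_def)
  define b' where "b' = (GREATEST b. P b)"
  have b': "P b'" "b \<le> b'"
    unfolding b'_def using GreatestI_nat[of P, OF Pb bdd] Greatest_le_nat[of P, OF Pb bdd] by auto
  have "walk_step N g \<beta> R sm D i x = block_end (SOME h. caught N g R sm D i b' h x) x"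
    unfolding walk_step_def Let_def b'_def P_def using assms by auto
  moreover have "caught N g R sm D i b' (SOME h. caught N g R sm D i b' h x) x"
    using b'(1) unfolding P_def by (metis someI_ex)
  ultimately show ?thesis using b' by (auto simp: P_def)
qed

lemma walk_step_cases:
  "(\<forall>b\<le>\<beta>. \<forall>h. \<not> caught N g R sm D i b h x) \<and> walk_step N g \<beta> R sm D i x = x + 1 \<or>
   (\<exists>b h. b \<le> \<beta> \<and> caught N g R sm D i b h x \<and> walk_step N g \<beta> R sm D i x = block_end h x)"
proof (cases "\<exists>b\<le>\<beta>. \<exists>h. caught N g R sm D i b h x")
  case True
  then show ?thesis using walk_step_caught by metis
next
  case False
  then have "walk_step N g \<beta> R sm D i x = x + 1" unfolding walk_step_def by (rule if_not_P)
  then show ?thesis using False by blast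
qed

text \<open>Both ends of the jump are multiples of \<open>2 ^ b\<close>: the level used is at least
  \<open>b\<close>, and the block length is at least that of the level.\<close>

lemma walk_step_long:
  assumes "b \<le> \<beta>" "caught N g R sm D i b h x"
  shows "x + 2 ^ b \<le> walk_step N g \<beta> R sm D i x"
proof -
  obtain b' h' where b': "b \<le> b'" "caught N g R sm D i b' h' x" "walk_step N g \<beta> R sm D i x = block_end h' x"
    using walk_step_caught[OF assms] by blast
  have "2 ^ b dvd block_end h' x"
    using b' le_imp_power_dvd[of b h' "2::nat"] dvd_block_end[of h' x]
    by (auto simp: caught_def intro: dvd_trans)
  then show ?thesis
    using assms(2) b'(3) block_end_greater[of x h'] by (auto simp: caught_def intro: dvd_greater_add)
qed

lemma walk_less: "walk N g \<beta> R sm D i j < walk N g \<beta> R sm D i (Suc j)"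
  unfolding walk_Suc using walk_step_cases[of \<beta> N g R sm D i "walk N g \<beta> R sm D i j"] block_end_greater by auto

text \<open>Epochs starting at visited points in which \<open>i\<close>, once sampled by layer
  \<open>R\<close>, would stay stored up to \<open>D\<close>.\<close>

definition bad_visits :: "nat \<Rightarrow> (nat \<Rightarrow> nat \<Rightarrow> nat) \<Rightarrow> nat \<Rightarrow> nat \<Rightarrow> (nat \<Rightarrow> nat \<Rightarrow> nat \<Rightarrow> nat \<Rightarrow> bool) \<Rightarrow> nat \<Rightarrow> nat
    \<Rightarrow> nat \<Rightarrow> (nat \<times> nat) set" where
  "bad_visits N g \<beta> R sm D i x =
     {(b, y). b \<le> \<beta> \<and> y < x \<and> 2 ^ b dvd y \<and> y \<in> range (walk N g \<beta> R sm D i) \<and> (\<forall>h. \<not> caught N g R sm D i b h y)}"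

lemma finite_bad_visits: "finite (bad_visits N g \<beta> R sm D i x)"
  by (rule finite_subset[of _ "{..\<beta>} \<times> {..<x}"]) (auto simp: bad_visits_def)

lemma walk_length:
  "m \<le> walk N g \<beta> R sm D i m div 2 ^ \<beta> + card (bad_visits N g \<beta> R sm D i (walk N g \<beta> R sm D i m))"
proof (rule walk_count[where z = "walk N g \<beta> R sm D i", OF walk_0 _ finite_bad_visits])
  fix j
  show "walk N g \<beta> R sm D i (Suc j) = walk N g \<beta> R sm D i j + 1 \<or>
     (\<exists>h. walk N g \<beta> R sm D i (Suc j) = block_end h (walk N g \<beta> R sm D i j))"
    unfolding walk_Suc using walk_step_cases[of \<beta> N g R sm D i "walk N g \<beta> R sm D i j"] by auto
next
  fix j b assume j: "j < m" "b \<le> \<beta>" "2 ^ b dvd walk N g \<beta> R sm D i j"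
  have "walk N g \<beta> R sm D i j < walk N g \<beta> R sm D i m"
    using strict_monoD[OF strict_monoI_Suc[of "walk N g \<beta> R sm D i", OF walk_less] j(1)] .
  then show "(b, walk N g \<beta> R sm D i j) \<in> bad_visits N g \<beta> R sm D i (walk N g \<beta> R sm D i m) \<or>
    walk N g \<beta> R sm D i j + 2 ^ b \<le> walk N g \<beta> R sm D i (Suc j)"
    unfolding walk_Suc using j walk_step_long[OF j(2)] by (auto simp: bad_visits_def)
qed

text \<open>A jump is followed by an optimal schedule over the pool that caught \<open>i\<close>: it
  costs no more than \<open>i\<close> and switches on entry days only, at most \<open>M\<close>
  times. A unit step uses the dummy, which costs at most \<open>N\<close> more. The
  \<open>+ 1\<close> per piece is the switch at the splice.\<close>

lemma walk_cover:
  assumes M: "\<And>b h c. b \<le> \<beta> \<Longrightarrow> b \<le> h \<Longrightarrow> (c + 1) * 2 ^ h \<le> D \<Longrightarrow>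
      finite (pool N g b (sm b) R h c) \<and> card (pool N g b (sm b) R h c) \<le> M"
    and "walk N g \<beta> R sm D i m \<le> D"
  shows "\<exists>\<sigma>. follows N g \<beta> R sm \<sigma> 0 (walk N g \<beta> R sm D i m) \<and>
      sched_cost N g \<sigma> 0 (walk N g \<beta> R sm D i m) \<le> cumloss g i 0 (walk N g \<beta> R sm D i m) + N * m \<and>
      card (changes \<sigma> 0 (walk N g \<beta> R sm D i m)) \<le> m * (M + 1)"
  using assms(2)
proof (induction m)
  case 0
  have "changes \<sigma> 0 0 = {}" for \<sigma> by (auto simp: changes_def)
  then show ?case by (simp add: walk_0 follows_def sched_cost_def)
next
  case (Suc m)
  let ?x = "walk N g \<beta> R sm D i m" and ?y = "walk N g \<beta> R sm D i (Suc m)"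
  have xy: "?x < ?y" by (rule walk_less)
  then obtain \<sigma> where \<sigma>: "follows N g \<beta> R sm \<sigma> 0 ?x"
      "sched_cost N g \<sigma> 0 ?x \<le> cumloss g i 0 ?x + N * m" "card (changes \<sigma> 0 ?x) \<le> m * (M + 1)"
    using Suc by auto
  have "\<exists>\<sigma>'. follows N g \<beta> R sm \<sigma>' ?x ?y \<and> sched_cost N g \<sigma>' ?x ?y \<le> cumloss g i ?x ?y + N \<and>
      card (changes \<sigma>' ?x ?y) \<le> M"
    using walk_step_cases[of \<beta> N g R sm D i ?x]
  proof (elim disjE conjE exE)
    assume "walk_step N g \<beta> R sm D i ?x = ?x + 1"
    then have y: "?y = Suc ?x" by (simp add: walk_Suc)
    have "changes (\<lambda>_. None) ?x ?y = {}" by (auto simp: changes_def)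
    then show ?thesis
      unfolding y by (intro exI[of _ "\<lambda>_. None"]) (simp add: follows_def sched_cost_def)
  next
    fix b h assume b: "b \<le> \<beta>" "caught N g R sm D i b h ?x" "walk_step N g \<beta> R sm D i ?x = block_end h ?x"
    define c where "c = ?x div 2 ^ h"
    have y: "?y = (c + 1) * 2 ^ h" using b(3) by (simp add: walk_Suc block_end_def c_def)
    have bh: "b \<le> h" using b by (simp add: caught_def)
    define F where "F = pool N g b (sm b) R h c"
    have F: "finite F" "card F \<le> M" using M[of b h c] b(1) bh Suc.prems y by (auto simp: F_def)
    obtain \<sigma>' where \<sigma>': "schedule F ?x ?y \<sigma>'" "cover_cost N g F ?x ?y = sched_cost N g \<sigma>' ?x ?y"
      using cover_cost_attained by blast
    have "sched_cost N g \<sigma>' ?x ?y \<le> cumloss g i ?x ?y"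
      using b(2,3) \<sigma>'(2) by (simp add: caught_def beats_def F_def c_def walk_Suc)
    moreover have "follows N g \<beta> R sm \<sigma>' ?x ?y"
      unfolding follows_def
    proof (intro allI impI)
      fix d j assume d: "?x \<le> d" "d < ?y" "\<sigma>' d = Some j"
      then obtain e where e: "e \<le> d" "(j, e) \<in> F" using \<sigma>'(1) unfolding schedule_def by blast
      then obtain r' where "r' < R" "(j, e) \<in> live N g b (sm b) r' d"
        using live_of_pool[of "(j, e)" N g b "sm b" R h c d] bh d(2) y by (auto simp: F_def)
      then show "j \<in> live_experts N g \<beta> R sm d" using b(1) unfolding live_experts_def
        by (blast intro: less_imp_le)
    qed
    moreover have "changes \<sigma>' ?x ?y \<subseteq> snd ` F"
      using \<sigma>'(1) by (auto simp: changes_def schedule_def)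
    then have "card (changes \<sigma>' ?x ?y) \<le> M"
      using F by (meson card_image_le card_mono finite_imageI le_trans)
    ultimately show ?thesis by (intro exI[of _ \<sigma>']) simp
  qed
  then obtain \<sigma>' where \<sigma>': "follows N g \<beta> R sm \<sigma>' ?x ?y"
      "sched_cost N g \<sigma>' ?x ?y \<le> cumloss g i ?x ?y + N" "card (changes \<sigma>' ?x ?y) \<le> M" by blast
  have "cumloss g i 0 ?y = cumloss g i 0 ?x + cumloss g i ?x ?y" using xy by (intro cumloss_split) auto
  moreover have "sched_cost N g (splice ?x \<sigma> \<sigma>') 0 ?y = sched_cost N g \<sigma> 0 ?x + sched_cost N g \<sigma>' ?x ?y"
    using xy by (intro sched_cost_splice) simp
  ultimately have "sched_cost N g (splice ?x \<sigma> \<sigma>') 0 ?y \<le> cumloss g i 0 ?y + N * Suc m"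
    using \<sigma>(2) \<sigma>'(2) by simp
  moreover have "card (changes (splice ?x \<sigma> \<sigma>') 0 ?y) \<le> Suc m * (M + 1)"
    using card_changes_splice[of ?x \<sigma> \<sigma>' ?y] \<sigma>(3) \<sigma>'(3) by simp
  ultimately show ?case using follows_splice[OF \<sigma>(1) \<sigma>'(1)] by blast
qed

text \<open>Expert \<open>i\<close> is compared with the live pool up to its first sampled bad visit, and with itself
  from then on. \<open>early_visits\<close> collects enough bad visits for one of them to be sampled.\<close>

definition early_visits :: "nat \<Rightarrow> (nat \<Rightarrow> nat \<Rightarrow> nat) \<Rightarrow> nat \<Rightarrow> nat \<Rightarrow> (nat \<Rightarrow> nat \<Rightarrow> nat \<Rightarrow> nat \<Rightarrow> bool) \<Rightarrow> nat \<Rightarrow> nat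
    \<Rightarrow> nat \<Rightarrow> (nat \<times> nat) set" where
  "early_visits N g \<beta> R sm D i k =
     (if card (bad_visits N g \<beta> R sm D i D) < k then {}
      else bad_visits N g \<beta> R sm D i (LEAST x. k \<le> card (bad_visits N g \<beta> R sm D i x)))"

lemma comparator_exists:
  assumes M: "\<And>b h c. b \<le> \<beta> \<Longrightarrow> b \<le> h \<Longrightarrow> (c + 1) * 2 ^ h \<le> D \<Longrightarrow>
      finite (pool N g b (sm b) R h c) \<and> card (pool N g b (sm b) R h c) \<le> M"
    and hit: "k \<le> card (early_visits N g \<beta> R sm D i k) \<Longrightarrow>
      \<exists>(b, x)\<in>early_visits N g \<beta> R sm D i k. sm b R i x"
    and k: "k > 0"
  shows "\<exists>\<sigma>. follows N g \<beta> R sm \<sigma> 0 D \<and>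
      sched_cost N g \<sigma> 0 D \<le> cumloss g i 0 D + N * (D div 2 ^ \<beta> + k) \<and>
      card (changes \<sigma> 0 D) \<le> (D div 2 ^ \<beta> + k) * (M + 1) + 1"
proof -
  let ?z = "walk N g \<beta> R sm D i" and ?B = "bad_visits N g \<beta> R sm D i"
  have "\<exists>m \<sigma>'. ?z m \<le> D \<and> card (?B (?z m)) < k \<and> follows N g \<beta> R sm \<sigma>' (?z m) D \<and>
      sched_cost N g \<sigma>' (?z m) D \<le> cumloss g i (?z m) D \<and> changes \<sigma>' (?z m) D = {}"
  proof (cases "card (?B D) < k")
    case True
    \<comment> \<open>The walk lands on \<open>D\<close> exactly: jumps end no later than
      \<open>D\<close> by the definition of \<open>caught\<close>, and a unit step cannot pass
      it.\<close>
    have "\<exists>m. ?z m = D"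
    proof -
      have bdd: "j \<le> D" if "?z j \<le> D" for j
        using that strict_mono_imp_increasing[OF strict_monoI_Suc[of ?z, OF walk_less], of j] by simp
      have P0: "?z 0 \<le> D" by (simp add: walk_0)
      obtain m where m: "?z m \<le> D" and "\<not> ?z (Suc m) \<le> D"
        by (rule last_true_nat[of "\<lambda>m. ?z m \<le> D", OF P0 bdd])
      then have "?z m = D"
        using walk_step_cases[of \<beta> N g R sm D i "?z m"] m unfolding walk_Suc by (auto simp: caught_def)
      then show ?thesis ..
    qed
    then obtain m where m: "?z m = D" ..
    have "changes (\<lambda>_. None) D D = {}" by (auto simp: changes_def)
    then show ?thesis
      using m True by (intro exI[of _ m] exI[of _ "\<lambda>_. None"]) (auto simp: follows_def sched_cost_def)
  next
    case False
    \<comment> \<open>\<open>x1\<close> is the first time preceded by \<open>k\<close> bad visits.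
      Each of these visits lies before \<open>x1\<close> and is therefore itself preceded by fewer
      than \<open>k\<close>.\<close>
    define x1 where "x1 = (LEAST x. k \<le> card (?B x))"
    have x1: "k \<le> card (?B x1)" "x1 \<le> D"
      unfolding x1_def using False
      by (auto intro: LeastI[of "\<lambda>x. k \<le> card (?B x)" D] Least_le)
    have ev: "early_visits N g \<beta> R sm D i k = ?B x1" using False by (simp add: early_visits_def x1_def)
    then obtain b x where bx: "(b, x) \<in> ?B x1" "sm b R i x" using hit x1 by auto
    then obtain m where m: "x = ?z m" by (auto simp: bad_visits_def)
    have b: "b \<le> \<beta>" "x < x1" "2 ^ b dvd x" "\<And>h. \<not> caught N g R sm D i b h x"
      using bx by (auto simp: bad_visits_def)
    have "card (?B x) < k" using not_less_Least[of x "\<lambda>x. k \<le> card (?B x)"] b(2) by (simp add: x1_def)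
    \<comment> \<open>\<open>i\<close> was sampled by layer \<open>R\<close> at \<open>x\<close> and
      fails no test due by \<open>D\<close>, so it stays stored and is followed to the end without a
      switch.\<close>
    moreover have "follows N g \<beta> R sm (\<lambda>_. Some i) x D"
    proof -
      have "(i, x) \<in> live N g b (sm b) R d" if "x \<le> d" "d < D" for d
        using that bx b by (auto simp: live_def caught_def)
      then show ?thesis using b(1) by (auto simp: follows_def live_experts_def)
    qed
    moreover have "changes (\<lambda>_. Some i) x D = {}" by (auto simp: changes_def)
    ultimately show ?thesis
      using m b(2) x1(2) by (intro exI[of _ m] exI[of _ "\<lambda>_. Some i"]) (auto simp: sched_cost_const)
  qed
  then obtain m \<sigma>' where m: "?z m \<le> D" "card (?B (?z m)) < k" "follows N g \<beta> R sm \<sigma>' (?z m) D"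
      "sched_cost N g \<sigma>' (?z m) D \<le> cumloss g i (?z m) D" "changes \<sigma>' (?z m) D = {}" by blast
  obtain \<sigma> where \<sigma>: "follows N g \<beta> R sm \<sigma> 0 (?z m)"
      "sched_cost N g \<sigma> 0 (?z m) \<le> cumloss g i 0 (?z m) + N * m"
      "card (changes \<sigma> 0 (?z m)) \<le> m * (M + 1)"
    using walk_cover[where m = m, OF M m(1)] by blast
  have mk: "m \<le> D div 2 ^ \<beta> + k"
    using walk_length[of m N g \<beta> R sm D i] m(2) div_le_mono[OF m(1), of "2 ^ \<beta>"] by linarith
  have "sched_cost N g (splice (?z m) \<sigma> \<sigma>') 0 D \<le> cumloss g i 0 D + N * m"
    using sched_cost_splice[OF m(1), of N g \<sigma> \<sigma>'] cumloss_split[of 0 "?z m" D g i] m \<sigma>(2) by simp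
  then have "sched_cost N g (splice (?z m) \<sigma> \<sigma>') 0 D \<le> cumloss g i 0 D + N * (D div 2 ^ \<beta> + k)"
    using mult_le_mono2[OF mk, of N] by linarith
  moreover have "card (changes (splice (?z m) \<sigma> \<sigma>') 0 D) \<le> (D div 2 ^ \<beta> + k) * (M + 1) + 1"
    using card_changes_splice[of "?z m" \<sigma> \<sigma>' D] \<sigma>(3) m(5) mult_le_mono1[OF mk, of "M + 1"] by simp
  ultimately show ?thesis using follows_splice[OF \<sigma>(1) m(3)] by blast
qed

subsection \<open>Fixed share and independent coins\<close>

lemma exp_minus_le: "0 \<le> y \<Longrightarrow> exp (- y) \<le> 1 - y + y\<^sup>2" for y :: real
proof -
  assume y: "0 \<le> y"
  have "1 + y \<le> exp y" by (rule exp_ge_add_one_self)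
  then have "exp (- y) \<le> 1 / (1 + y)" using y by (simp add: exp_minus field_simps)
  also have "1 / (1 + y) \<le> 1 - y + y\<^sup>2"
    using y by (simp add: divide_le_eq) (simp add: algebra_simps power2_eq_square)
  finally show ?thesis .
qed

lemma exp_le_quadratic: "\<bar>y\<bar> \<le> 1 \<Longrightarrow> exp y \<le> 1 + y + y\<^sup>2" for y :: real
  using exp_bound[of y] exp_minus_le[of "- y"] by (cases "0 \<le> y") auto

text \<open>Weights are assigned outside \<open>A\<close> as well: an expert that is stored on the
  next day for the first time already owns the uniform share.\<close>

definition share_update :: "real \<Rightarrow> real \<Rightarrow> nat \<Rightarrow> nat \<Rightarrow> nat \<Rightarrow> nat set \<Rightarrow> (nat \<Rightarrow> nat) \<Rightarrow> (nat \<Rightarrow> nat) \<Rightarrow> nat \<Rightarrow> nat" where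
  "share_update \<eta> \<mu> N m Q A w l a = nat \<lfloor>real Q * ((1 - \<mu>) *
     (if a \<in> A then real (w a) * exp (- \<eta> * real (l a) / real N) /
        (\<Sum>a'\<in>A. real (w a') * exp (- \<eta> * real (l a') / real N)) else 0) + \<mu> / real m)\<rfloor>"

text \<open>Fixed share over the changing sets \<open>A t\<close>, with weights rounded down to multiples of \<open>1/Q\<close>; the
  uniform share \<open>\<mu>/m\<close> is at least twice the rounding error.\<close>

primrec share_weight :: "real \<Rightarrow> real \<Rightarrow> nat \<Rightarrow> nat \<Rightarrow> nat \<Rightarrow> (nat \<Rightarrow> nat set) \<Rightarrow> (nat \<Rightarrow> nat \<Rightarrow> nat) \<Rightarrow> nat
    \<Rightarrow> nat \<Rightarrow> nat" where
  "share_weight \<eta> \<mu> N m Q A g 0 = (\<lambda>a. nat \<lfloor>real Q * (\<mu> / real m)\<rfloor>)"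
| "share_weight \<eta> \<mu> N m Q A g (Suc t) =
     share_update \<eta> \<mu> N m Q (A t) (share_weight \<eta> \<mu> N m Q A g t) (g t)"

lemma share_update_cong:
  assumes "A = A'" "\<And>a. a \<in> A' \<Longrightarrow> w a = w' a" "l = l'"
  shows "share_update \<eta> \<mu> N m Q A w l = share_update \<eta> \<mu> N m Q A' w' l'"
proof
  fix a
  have "(\<Sum>a'\<in>A'. real (w a') * exp (- \<eta> * real (l' a') / real N)) =
        (\<Sum>a'\<in>A'. real (w' a') * exp (- \<eta> * real (l' a') / real N))"
    by (rule sum.cong) (simp_all add: assms(2))
  then show "share_update \<eta> \<mu> N m Q A w l a = share_update \<eta> \<mu> N m Q A' w' l' a"
    unfolding share_update_def assms(1,3) using assms(2) by (simp cong: if_cong)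
qed

definition weighted_loss :: "nat \<Rightarrow> nat set \<Rightarrow> (nat \<Rightarrow> nat) \<Rightarrow> (nat \<Rightarrow> nat) \<Rightarrow> real" where
  "weighted_loss N A w l = (\<Sum>a\<in>A. real (w a) * (real (l a) / real N)) / (\<Sum>a\<in>A. real (w a))"

lemma le_nat_floor_add: "1 \<le> x \<Longrightarrow> 0 \<le> y \<Longrightarrow> y \<le> real (nat \<lfloor>y + x\<rfloor>)" for x y :: real
  by linarith

lemma half_le_nat_floor_add: "2 \<le> x \<Longrightarrow> 0 \<le> y \<Longrightarrow> x / 2 \<le> real (nat \<lfloor>y + x\<rfloor>)" for x y :: real
  by linarith

locale fixed_share =
  fixes \<eta> \<mu> :: real and N m Q :: nat and A :: "nat \<Rightarrow> nat set" and g :: "nat \<Rightarrow> nat \<Rightarrow> nat" and D :: nat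
  assumes eta: "0 < \<eta>" "\<eta> \<le> 1" and mu: "0 < \<mu>" "\<mu> \<le> 1 / 2" and N: "0 < N"
    and Q: "2 \<le> real Q * (\<mu> / real m)"
    and A: "\<And>t. t < D \<Longrightarrow> finite (A t) \<and> A t \<noteq> {} \<and> card (A t) \<le> m"
    and g: "\<And>t a. t < D \<Longrightarrow> a \<in> A t \<Longrightarrow> g t a \<le> N"
begin

abbreviation "w \<equiv> share_weight \<eta> \<mu> N m Q A g"

definition "W t = (\<Sum>a\<in>A t. real (w t a))"
definition "Z t = (\<Sum>a\<in>A t. real (w t a) * exp (- \<eta> * real (g t a) / real N))"
definition "\<Gamma> = ln (2 * real m / \<mu>)"

lemma m_pos: "0 < real m"
  using Q by (cases "m = 0") auto

lemma Q_pos: "0 < real Q"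
  using Q by (cases "Q = 0") auto

lemma weight_0_lower: "real Q * (\<mu> / (2 * real m)) \<le> real (w 0 a)"
proof -
  have "real Q * (\<mu> / (2 * real m)) = real Q * (\<mu> / real m) / 2" by simp
  also have "\<dots> \<le> real (nat \<lfloor>0 + real Q * (\<mu> / real m)\<rfloor>)" by (rule half_le_nat_floor_add[OF Q order_refl])
  finally show ?thesis by simp
qed

text \<open>The uniform share is at least 2 units and rounding costs less than one. So half of the
  share survives, and the exponential part loses nothing to rounding.\<close>

lemma weight_Suc_lower:
  assumes "t < D" "\<And>a. a \<in> A t \<Longrightarrow> 0 < w t a"
  shows "real Q * (\<mu> / (2 * real m)) \<le> real (w (Suc t) a)"
    and "a \<in> A t \<Longrightarrow> real Q * ((1 - \<mu>) * (real (w t a) * exp (- \<eta> * real (g t a) / real N) / Z t)) \<le> real (w (Suc t) a)"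
proof -
  define x where "x = (if a \<in> A t then real (w t a) * exp (- \<eta> * real (g t a) / real N) / Z t else 0)"
  have Zn: "0 \<le> Z t" unfolding Z_def by (intro sum_nonneg) auto
  have x0: "0 \<le> x" unfolding x_def using Zn by simp
  have wx: "w (Suc t) a = nat \<lfloor>real Q * ((1 - \<mu>) * x) + real Q * (\<mu> / real m)\<rfloor>"
    by (simp only: share_weight.simps share_update_def x_def Z_def distrib_left)
  have y0: "0 \<le> real Q * ((1 - \<mu>) * x)" using x0 mu by simp
  have "real Q * (\<mu> / (2 * real m)) = real Q * (\<mu> / real m) / 2" by simp
  also have "\<dots> \<le> real (w (Suc t) a)" unfolding wx by (rule half_le_nat_floor_add[OF Q y0])
  finally show "real Q * (\<mu> / (2 * real m)) \<le> real (w (Suc t) a)" .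
  show "real Q * ((1 - \<mu>) * (real (w t a) * exp (- \<eta> * real (g t a) / real N) / Z t)) \<le> real (w (Suc t) a)"
    if "a \<in> A t"
    using le_nat_floor_add[of "real Q * (\<mu> / real m)", OF _ y0] Q that unfolding wx x_def by simp
qed

lemma base_pos: "0 < real Q * (\<mu> / (2 * real m))"
  using Q mu m_pos Q_pos by simp

lemma weight_lower: "t \<le> D \<Longrightarrow> real Q * (\<mu> / (2 * real m)) \<le> real (w t a)"
proof (induction t arbitrary: a)
  case 0
  show ?case by (rule weight_0_lower)
next
  case (Suc t)
  have "0 < w t a" for a
    using Suc.IH[of a] Suc.prems base_pos by (metis Suc_leD less_le_trans of_nat_0_less_iff)
  then show ?case using Suc.prems by (intro weight_Suc_lower) auto
qed

lemma weight_pos: "t \<le> D \<Longrightarrow> 0 < w t a"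
  using weight_lower[of t a] base_pos by (metis less_le_trans of_nat_0_less_iff)

lemma W_pos: "t < D \<Longrightarrow> 0 < W t"
  unfolding W_def using A[of t] weight_pos[of t] by (intro sum_pos) auto

lemma Z_pos: "t < D \<Longrightarrow> 0 < Z t"
  unfolding Z_def using A[of t] weight_pos[of t] by (intro sum_pos) auto

text \<open>The exponential parts sum to at most \<open>1 - \<mu>\<close> because they vanish
  outside the previous set and are normalised on it. The shares add at most \<open>\<mu>\<close>,
  and rounding goes down.\<close>

lemma W_le: "t < D \<Longrightarrow> W t \<le> real Q"
proof (cases t)
  case 0
  assume tD: "t < D"
  have "W t \<le> (\<Sum>a\<in>A t. real Q * (\<mu> / real m))"
    unfolding W_def using 0 mu by (intro sum_mono) (simp add: of_nat_floor)
  also have "\<dots> = real (card (A t)) * (real Q * (\<mu> / real m))" by simp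
  also have "\<dots> \<le> real m * (real Q * (\<mu> / real m))"
    using A[OF tD] mu by (intro mult_right_mono) auto
  also have "\<dots> = real Q * \<mu>" using m_pos by simp
  also have "\<dots> \<le> real Q" using mu mult_left_mono[of \<mu> 1 "real Q"] by simp
  finally show ?thesis .
next
  case (Suc s)
  assume tD: "t < D"
  then have s: "s < D" using Suc by simp
  define x where "x = (\<lambda>a. if a \<in> A s then real (w s a) * exp (- \<eta> * real (g s a) / real N) / Z s else 0)"
  have x0: "0 \<le> x a" for a unfolding x_def using Z_pos[OF s] by simp
  have wx: "w t a = nat \<lfloor>real Q * ((1 - \<mu>) * x a + \<mu> / real m)\<rfloor>" for a
    by (simp only: Suc share_weight.simps share_update_def x_def Z_def)
  have "sum x (A t) \<le> sum x (A t \<union> A s)" using x0 A[OF tD] A[OF s] by (intro sum_mono2) auto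
  also have "\<dots> = sum x (A s)" using A[OF tD] A[OF s] by (intro sum.mono_neutral_right) (auto simp: x_def)
  also have "\<dots> = (\<Sum>a\<in>A s. real (w s a) * exp (- \<eta> * real (g s a) / real N)) / Z s"
    unfolding sum_divide_distrib by (rule sum.cong) (auto simp: x_def)
  also have "\<dots> = 1" using Z_pos[OF s] by (simp add: Z_def)
  finally have sx: "sum x (A t) \<le> 1" .
  have "W t \<le> (\<Sum>a\<in>A t. real Q * ((1 - \<mu>) * x a + \<mu> / real m))"
    unfolding W_def wx using x0 mu by (intro sum_mono of_nat_floor) auto
  also have "\<dots> = real Q * ((1 - \<mu>) * sum x (A t) + real (card (A t)) * (\<mu> / real m))"
    by (simp only: sum_distrib_left sum.distrib distrib_left sum_constant mult.left_commute)
  also have "\<dots> \<le> real Q * ((1 - \<mu>) * 1 + real m * (\<mu> / real m))"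
    using A[OF tD] mu sx by (intro mult_left_mono add_mono mult_right_mono) auto
  also have "\<dots> = real Q" using m_pos by simp
  finally show ?thesis .
qed

definition "loss t = weighted_loss N (A t) (w t) (g t)"

lemma ln_Z_W: "t < D \<Longrightarrow> ln (Z t / W t) \<le> - \<eta> * loss t + \<eta>\<^sup>2"
proof -
  assume t: "t < D"
  have "Z t \<le> (\<Sum>a\<in>A t. real (w t a) * (1 - \<eta> * (real (g t a) / real N) + \<eta>\<^sup>2))"
    unfolding Z_def
  proof (intro sum_mono mult_left_mono)
    fix a assume a: "a \<in> A t"
    define y where "y = real (g t a) / real N"
    have y: "0 \<le> y" "y \<le> 1" using g[OF t a] N by (auto simp: y_def)
    have "exp (- (\<eta> * y)) \<le> 1 - \<eta> * y + (\<eta> * y)\<^sup>2" using eta y by (intro exp_minus_le) simp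
    also have "(\<eta> * y)\<^sup>2 \<le> \<eta>\<^sup>2" using eta y by (intro power_mono) (auto simp: mult_le_cancel_left1)
    finally show "exp (- \<eta> * real (g t a) / real N) \<le> 1 - \<eta> * (real (g t a) / real N) + \<eta>\<^sup>2"
      by (simp add: y_def)
  qed simp
  also have "\<dots> = W t - \<eta> * (\<Sum>a\<in>A t. real (w t a) * (real (g t a) / real N)) + \<eta>\<^sup>2 * W t"
    by (simp add: W_def sum.distrib sum_subtractf algebra_simps sum_distrib_left)
  finally have "Z t / W t \<le> (W t - \<eta> * (\<Sum>a\<in>A t. real (w t a) * (real (g t a) / real N)) + \<eta>\<^sup>2 * W t) / W t"
    using W_pos[OF t] by (intro divide_right_mono) auto
  also have "\<dots> = 1 + (- \<eta> * loss t + \<eta>\<^sup>2)"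
    using W_pos[OF t] by (simp add: loss_def weighted_loss_def W_def add_divide_distrib diff_divide_distrib)
  finally have "Z t / W t \<le> 1 + (- \<eta> * loss t + \<eta>\<^sup>2)" .
  moreover have "0 < Z t / W t" using Z_pos[OF t] W_pos[OF t] by simp
  ultimately show ?thesis using ln_add_one_self_le_self2[of "Z t / W t - 1"] ln_le_minus_one[of "Z t / W t"]
    by linarith
qed

text \<open>The negative logarithm of the comparator's normalised weight, which serves as potential.
  The dummy gets 0: in units of \<open>N\<close> it loses 1 a day, as much as any mixture
  can.\<close>

definition "\<psi> t c = (case c of None \<Rightarrow> 0 | Some a \<Rightarrow> - ln (real (w t a) / W t))"

lemma psi_bounds:
  assumes "t < D" "\<And>a. c = Some a \<Longrightarrow> a \<in> A t"
  shows "0 \<le> \<psi> t c" "\<psi> t c \<le> \<Gamma>"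
proof -
  have Gam: "0 \<le> \<Gamma>"
  proof -
    have "1 \<le> m" using m_pos by simp
    then have "\<mu> \<le> 2 * real m" using mu by linarith
    then show ?thesis unfolding \<Gamma>_def using mu by simp
  qed
  have "0 \<le> \<psi> t c \<and> \<psi> t c \<le> \<Gamma>"
  proof (cases c)
    case None
    then show ?thesis using Gam by (simp add: \<psi>_def)
  next
    case (Some a)
    have a: "a \<in> A t" using assms(2) Some by simp
    have wp: "0 < real (w t a)" using weight_pos[of t a] assms by simp
    have "real (w t a) \<le> W t"
      unfolding W_def using A[OF assms(1)] a by (intro member_le_sum) auto
    then have "real (w t a) / W t \<le> 1" using W_pos[OF assms(1)] by simp
    then have 1: "ln (real (w t a) / W t) \<le> 0" using wp W_pos[OF assms(1)] by (simp add: ln_le_zero_iff)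
    have "\<mu> / (2 * real m) \<le> real (w t a) / real Q"
      using weight_lower[of t a] assms(1) Q_pos by (simp add: pos_le_divide_eq mult.commute)
    also have "\<dots> \<le> real (w t a) / W t"
      using W_le[OF assms(1)] W_pos[OF assms(1)] by (intro divide_left_mono) auto
    finally have "ln (\<mu> / (2 * real m)) \<le> ln (real (w t a) / W t)"
      using mu m_pos by (subst ln_le_cancel_iff) (auto intro: wp W_pos assms divide_pos_pos)
    moreover have "ln (\<mu> / (2 * real m)) = - \<Gamma>"
      unfolding \<Gamma>_def using mu m_pos by (simp add: ln_div)
    ultimately show ?thesis using 1 Some by (simp add: \<psi>_def)
  qed
  then show "0 \<le> \<psi> t c" "\<psi> t c \<le> \<Gamma>" by auto
qed

lemma loss_le_1: "t < D \<Longrightarrow> loss t \<le> 1"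
proof -
  assume t: "t < D"
  have "(\<Sum>a\<in>A t. real (w t a) * (real (g t a) / real N)) \<le> (\<Sum>a\<in>A t. real (w t a))"
    using g[OF t] N by (intro sum_mono mult_left_le) auto
  then show ?thesis using W_pos[OF t] by (simp add: loss_def weighted_loss_def W_def)
qed

text \<open>For the last day before the comparator switches, where nothing telescopes: the term of
  \<open>a\<close> alone bounds \<open>Z t\<close> from below.\<close>

lemma step_any:
  assumes t: "t < D" and c: "\<And>a. c = Some a \<Longrightarrow> a \<in> A t"
  shows "\<eta> * (loss t - real (choice_cost N g t c) / real N) \<le> \<psi> t c + \<eta>\<^sup>2"
proof (cases c)
  case None
  have "\<eta> * (loss t - 1) \<le> 0" using loss_le_1[OF t] eta by (simp add: mult_nonneg_nonpos)
  moreover have "real (choice_cost N g t c) / real N = 1" using None N by simp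
  moreover have "0 \<le> \<psi> t c + \<eta>\<^sup>2" using psi_bounds[OF t c] by simp
  ultimately show ?thesis by simp
next
  case (Some a)
  have a: "a \<in> A t" using c Some by simp
  have wp: "0 < real (w t a)" using weight_pos[of t a] t by simp
  have "real (w t a) * exp (- \<eta> * real (g t a) / real N) \<le> Z t"
    unfolding Z_def using A[OF t] a by (intro member_le_sum) auto
  then have "real (w t a) / W t * exp (- \<eta> * real (g t a) / real N) \<le> Z t / W t"
    using W_pos[OF t] by (simp add: divide_right_mono)
  then have "ln (real (w t a) / W t * exp (- \<eta> * real (g t a) / real N)) \<le> ln (Z t / W t)"
    using wp W_pos[OF t] Z_pos[OF t] by (subst ln_le_cancel_iff) auto
  also have "ln (real (w t a) / W t * exp (- \<eta> * real (g t a) / real N))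
      = ln (real (w t a) / W t) - \<eta> * real (g t a) / real N"
    using wp W_pos[OF t] by (subst ln_mult) auto
  finally show ?thesis using ln_Z_W[OF t] Some by (simp add: \<psi>_def right_diff_distrib)
qed

text \<open>The update keeps at least a fraction \<open>1 - \<mu>\<close> of the normalised
  exponential weight of \<open>a\<close>, so the increase of that weight pays for the day. The term
  \<open>2 * \<mu>\<close> comes from \<open>- ln (1 - \<mu>)\<close> for
  \<open>\<mu> \<le> 1 / 2\<close>.\<close>

lemma step_same:
  assumes t: "Suc t < D" and c: "\<And>a. c = Some a \<Longrightarrow> a \<in> A t \<and> a \<in> A (Suc t)"
  shows "\<eta> * (loss t - real (choice_cost N g t c) / real N) \<le> \<psi> t c - \<psi> (Suc t) c + \<eta>\<^sup>2 + 2 * \<mu>"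
proof (cases c)
  case None
  have t': "t < D" using t by simp
  have "\<eta> * (loss t - 1) \<le> 0" using loss_le_1[OF t'] eta by (simp add: mult_nonneg_nonpos)
  then have 1: "\<eta> * (loss t - 1) \<le> 0 - 0 + \<eta>\<^sup>2 + 2 * \<mu>"
    using mu zero_le_power2[of \<eta>] by linarith
  have 2: "real (choice_cost N g t c) / real N = 1" using None N by simp
  have 3: "\<psi> t c = 0" "\<psi> (Suc t) c = 0" using None by (auto simp: \<psi>_def)
  show ?thesis unfolding 2 3 by (rule 1)
next
  case (Some a)
  have t': "t < D" using t by simp
  have a: "a \<in> A t" using c Some by simp
  have wp: "0 < real (w t a)" "0 < real (w (Suc t) a)"
    using weight_pos[of t a] weight_pos[of "Suc t" a] t by auto
  define y where "y = real (w t a) * exp (- \<eta> * real (g t a) / real N) / Z t"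
  have yp: "0 < y" unfolding y_def using wp Z_pos[OF t'] by simp
  have "real Q * ((1 - \<mu>) * y) \<le> real (w (Suc t) a)"
    unfolding y_def using t' a weight_pos by (intro weight_Suc_lower(2)) auto
  then have "(1 - \<mu>) * y \<le> real (w (Suc t) a) / real Q"
    using Q_pos by (simp add: pos_le_divide_eq mult.commute)
  also have "\<dots> \<le> real (w (Suc t) a) / W (Suc t)"
    using W_le[OF t] W_pos[OF t] by (intro divide_left_mono) auto
  finally have "ln ((1 - \<mu>) * y) \<le> ln (real (w (Suc t) a) / W (Suc t))"
    using yp mu wp W_pos[OF t] by (subst ln_le_cancel_iff) auto
  moreover have "ln ((1 - \<mu>) * y) = ln (1 - \<mu>) + ln y" using yp mu by (subst ln_mult) auto
  moreover have "y = (real (w t a) / W t) * exp (- \<eta> * real (g t a) / real N) / (Z t / W t)"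
    unfolding y_def using W_pos[OF t'] by simp
  then have "ln y = ln (real (w t a) / W t) - \<eta> * real (g t a) / real N - ln (Z t / W t)"
    using wp W_pos[OF t'] Z_pos[OF t'] by (simp add: ln_div ln_mult)
  moreover have "- (2 * \<mu>) \<le> ln (1 - \<mu>)"
  proof -
    have "- ln (1 - \<mu>) = ln (1 / (1 - \<mu>))" using mu by (simp add: ln_div)
    also have "\<dots> \<le> 1 / (1 - \<mu>) - 1" using mu by (intro ln_le_minus_one) simp
    also have "\<dots> \<le> 2 * \<mu>"
    proof -
      have "1 \<le> (1 + 2 * \<mu>) * (1 - \<mu>)" using mu by (simp add: algebra_simps)
      then have "1 / (1 - \<mu>) \<le> 1 + 2 * \<mu>" using mu by (subst pos_divide_le_eq) auto
      then show ?thesis by simp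
    qed
    finally show ?thesis by simp
  qed
  ultimately show ?thesis using ln_Z_W[OF t'] Some by (simp add: \<psi>_def right_diff_distrib)
qed

text \<open>Potentials telescope while the comparator stays constant. Each constant segment opens
  with a potential of at most \<open>\<Gamma>\<close>: one per switch, and one for the first
  segment.\<close>

theorem switching_regret:
  assumes D: "0 < D" and \<sigma>: "\<And>t a. t < D \<Longrightarrow> \<sigma> t = Some a \<Longrightarrow> a \<in> A t"
  shows "\<eta> * (\<Sum>t<D. loss t - real (choice_cost N g t (\<sigma> t)) / real N)
    \<le> (real (card (changes \<sigma> 0 D)) + 1) * \<Gamma> + real D * (\<eta>\<^sup>2 + 2 * \<mu>)"
proof -
  let ?d = "\<lambda>t. loss t - real (choice_cost N g t (\<sigma> t)) / real N"
  have main: "\<eta> * (\<Sum>s<t. ?d s)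
      \<le> (real (card (changes \<sigma> 0 (Suc t))) + 1) * \<Gamma> + real t * (\<eta>\<^sup>2 + 2 * \<mu>) - \<psi> t (\<sigma> t)" if "t < D" for t
    using that
  proof (induction t)
    case 0
    have "changes \<sigma> 0 (Suc 0) = {}" by (auto simp: changes_def)
    then show ?case using psi_bounds[of 0 "\<sigma> 0"] \<sigma> 0 by simp
  next
    case (Suc t)
    note IH = Suc.IH[OF Suc_lessD[OF Suc.prems]]
    have t: "t < D" using Suc.prems by simp
    show ?case
    proof (cases "\<sigma> (Suc t) = \<sigma> t")
      case True
      have "\<eta> * ?d t \<le> \<psi> t (\<sigma> t) - \<psi> (Suc t) (\<sigma> t) + \<eta>\<^sup>2 + 2 * \<mu>"
        using Suc.prems \<sigma>[OF t] \<sigma>[OF Suc.prems] True by (intro step_same) auto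
      moreover have "changes \<sigma> 0 (Suc (Suc t)) = changes \<sigma> 0 (Suc t)"
        using True by (auto simp: changes_def less_Suc_eq)
      ultimately show ?thesis using IH True by (simp add: distrib_left distrib_right)
    next
      case False
      have "\<eta> * ?d t \<le> \<psi> t (\<sigma> t) + \<eta>\<^sup>2" using \<sigma>[OF t] by (intro step_any t) auto
      moreover have "changes \<sigma> 0 (Suc (Suc t)) = insert (Suc t) (changes \<sigma> 0 (Suc t))"
        using False by (auto simp: changes_def less_Suc_eq)
      then have "card (changes \<sigma> 0 (Suc (Suc t))) = Suc (card (changes \<sigma> 0 (Suc t)))"
        by (simp add: changes_def)
      moreover have "\<psi> (Suc t) (\<sigma> (Suc t)) \<le> \<Gamma>"
        using \<sigma>[OF Suc.prems] by (intro psi_bounds Suc.prems)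
      ultimately show ?thesis using IH mu by (simp add: distrib_left distrib_right)
    qed
  qed
  obtain t where t: "D = Suc t" using D by (cases D) auto
  have "\<eta> * ?d t \<le> \<psi> t (\<sigma> t) + \<eta>\<^sup>2" using \<sigma>[of t] t by (intro step_any) auto
  then show ?thesis using main[of t] mu unfolding t by (simp add: distrib_left distrib_right)
qed

end

section \<open>Exponential moments, and conditioning on the coins outside a block\<close>

lemma exp_moment_pmf:
  fixes X :: "'a \<Rightarrow> real"
  assumes X: "\<And>x. x \<in> set_pmf p \<Longrightarrow> 0 \<le> X x \<and> X x \<le> 1" and s: "0 \<le> s" "s \<le> 1"
  shows "measure_pmf.expectation p (\<lambda>x. exp (s * (X x - measure_pmf.expectation p X))) \<le> exp (s\<^sup>2)"
proof -
  define \<mu> where "\<mu> = measure_pmf.expectation p X"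
  have intX: "integrable p X"
    using X by (intro measure_pmf.integrable_const_bound[where B = 1]) (auto simp: AE_measure_pmf_iff)
  have "measure_pmf.expectation p (\<lambda>x. 0) \<le> \<mu>" "\<mu> \<le> measure_pmf.expectation p (\<lambda>x. 1)"
    unfolding \<mu>_def using X intX by (intro integral_mono_AE; simp add: AE_measure_pmf_iff)+
  then have mu: "0 \<le> \<mu>" "\<mu> \<le> 1" by auto
  have ab: "\<bar>s * (X x - \<mu>)\<bar> \<le> s" if "x \<in> set_pmf p" for x
    using X[OF that] mu s by (auto simp: abs_mult intro!: mult_left_le)
  \<comment> \<open>The linear term of the quadratic bound has mean zero, since \<open>\<mu>\<close>
    is the mean of \<open>X\<close>.\<close>
  have "measure_pmf.expectation p (\<lambda>x. exp (s * (X x - \<mu>))) \<le> measure_pmf.expectation p (\<lambda>x. 1 + s * (X x - \<mu>) + s\<^sup>2)"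
  proof (rule integral_mono_AE)
    show "integrable p (\<lambda>x. exp (s * (X x - \<mu>)))"
      using ab s by (intro measure_pmf.integrable_const_bound[where B = "exp 1"])
        (auto simp: AE_measure_pmf_iff abs_le_iff intro: order_trans)
    show "integrable p (\<lambda>x. 1 + s * (X x - \<mu>) + s\<^sup>2)" using intX by simp
    show "AE x in p. exp (s * (X x - \<mu>)) \<le> 1 + s * (X x - \<mu>) + s\<^sup>2"
      unfolding AE_measure_pmf_iff
    proof
      fix x assume x: "x \<in> set_pmf p"
      have "exp (s * (X x - \<mu>)) \<le> 1 + s * (X x - \<mu>) + (s * (X x - \<mu>))\<^sup>2"
        using ab[OF x] s by (intro exp_le_quadratic) auto
      also have "(s * (X x - \<mu>))\<^sup>2 \<le> s\<^sup>2"
        using ab[OF x] s by (metis abs_ge_zero abs_of_nonneg power2_abs power_mono)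
      finally show "exp (s * (X x - \<mu>)) \<le> 1 + s * (X x - \<mu>) + s\<^sup>2" by simp
    qed
  qed
  also have "\<dots> = 1 + s\<^sup>2" using intX by (simp add: \<mu>_def)
  also have "\<dots> \<le> exp (s\<^sup>2)" by (rule exp_ge_add_one_self)
  finally show ?thesis by (simp add: \<mu>_def)
qed

lemma prob_bind_pmf_le:
  assumes "\<And>x. x \<in> set_pmf M \<Longrightarrow> measure_pmf.prob (K x) E \<le> c"
  shows "measure_pmf.prob (bind_pmf M K) E \<le> c"
proof -
  have c: "0 \<le> c"
    using assms set_pmf_not_empty[of M] by (meson ex_in_conv measure_nonneg order_trans)
  have "emeasure (bind_pmf M K) E = (\<integral>\<^sup>+ x. emeasure (K x) E \<partial>measure_pmf M)" by (simp add: emeasure_bind_pmf)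
  also have "\<dots> \<le> (\<integral>\<^sup>+ x. ennreal c \<partial>measure_pmf M)"
    using assms by (intro nn_integral_mono_AE) (auto simp: AE_measure_pmf_iff measure_pmf.emeasure_eq_measure ennreal_leI)
  also have "\<dots> = ennreal c" by simp
  finally show ?thesis using c by (simp add: measure_pmf.emeasure_eq_measure)
qed

text \<open>Condition on the coins outside \<open>J\<close>: a bound that holds for each of their
  values \<open>f\<close> holds on average.\<close>

lemma prob_Pi_pmf_le:
  assumes "finite I" "J \<subseteq> I"
    and "\<And>f. measure_pmf.prob (Pi_pmf J dflt P) {h. (\<lambda>x. if x \<in> J then h x else f x) \<in> E} \<le> c"
  shows "measure_pmf.prob (Pi_pmf I dflt P) E \<le> c"
proof -
  have J: "finite J" using assms finite_subset by blast
  have I: "I = J \<union> (I - J)" using assms by auto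
  have "Pi_pmf I dflt P = map_pmf (\<lambda>(h, f) x. if x \<in> J then h x else f x)
       (pair_pmf (Pi_pmf J dflt P) (Pi_pmf (I - J) dflt P))"
    by (subst I, rule Pi_pmf_union) (use assms J in auto)
  also have "\<dots> = bind_pmf (Pi_pmf (I - J) dflt P) (\<lambda>f. map_pmf (\<lambda>h x. if x \<in> J then h x else f x) (Pi_pmf J dflt P))"
    by (subst pair_commute_pmf) (simp add: pair_pmf_def map_pmf_def bind_assoc_pmf bind_return_pmf)
  finally have eq: "Pi_pmf I dflt P = \<dots>" .
  show ?thesis unfolding eq
    by (rule prob_bind_pmf_le) (use assms(3) in \<open>simp add: vimage_def\<close>)
qed

text \<open>\<open>W\<close> is decided by the coins outside \<open>J\<close> but consists of coins
  in \<open>J\<close>. Once the outside is fixed, \<open>W\<close> is a fixed set of independent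
  coins of bias \<open>p\<close>, however adaptively it was formed.\<close>

locale independent_block =
  fixes I J :: "'i set" and P :: "'i \<Rightarrow> bool pmf" and p :: real and W :: "('i \<Rightarrow> bool) \<Rightarrow> 'i set"
  assumes I: "finite I" and J: "J \<subseteq> I" and P: "\<And>j. j \<in> J \<Longrightarrow> P j = bernoulli_pmf p"
    and p: "0 \<le> p" "p \<le> 1" and W: "\<And>\<omega>. W \<omega> \<subseteq> J"
    and dep: "\<And>\<omega> \<omega>'. (\<And>i. i \<notin> J \<Longrightarrow> \<omega> i = \<omega>' i) \<Longrightarrow> W \<omega> = W \<omega>'"
begin

lemma J_finite: "finite J"
  using I J finite_subset by blast

lemma miss_prob:
  "measure_pmf.prob (Pi_pmf I False P) {\<omega>. k \<le> card (W \<omega>) \<and> (\<forall>i\<in>W \<omega>. \<not> \<omega> i)} \<le> (1 - p) ^ k"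
proof (rule prob_Pi_pmf_le[OF I J])
  fix f
  define V where "V = W f"
  have WV: "W (\<lambda>x. if x \<in> J then h x else f x) = V" for h
    unfolding V_def by (rule dep) simp
  have V: "V \<subseteq> J" unfolding V_def by (rule W)
  show "measure_pmf.prob (Pi_pmf J False P) {h. (\<lambda>x. if x \<in> J then h x else f x) \<in>
      {\<omega>. k \<le> card (W \<omega>) \<and> (\<forall>i\<in>W \<omega>. \<not> \<omega> i)}} \<le> (1 - p) ^ k"
  proof (cases "k \<le> card V")
    case True
    have "measure_pmf.prob (Pi_pmf J False P) {h. (\<lambda>x. if x \<in> J then h x else f x) \<in>
      {\<omega>. k \<le> card (W \<omega>) \<and> (\<forall>i\<in>W \<omega>. \<not> \<omega> i)}}
      \<le> measure_pmf.prob (Pi_pmf J False P) (Pi J (\<lambda>j. if j \<in> V then {False} else UNIV))"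
      using V by (intro measure_pmf.finite_measure_mono) (auto simp: WV)
    also have "\<dots> = (\<Prod>j\<in>J. measure_pmf.prob (P j) (if j \<in> V then {False} else UNIV))"
      by (rule measure_Pi_pmf_Pi[OF J_finite])
    also have "\<dots> = (\<Prod>j\<in>J. if j \<in> V then 1 - p else 1)"
      using p by (intro prod.cong) (auto simp: P measure_pmf_single)
    also have "\<dots> = (1 - p) ^ card V"
      using J_finite V by (simp add: prod.If_cases Int_absorb1)
    also have "\<dots> \<le> (1 - p) ^ k" using True p by (intro power_decreasing) auto
    finally show ?thesis .
  next
    case False
    then show ?thesis using p by (simp add: WV)
  qed
qed

text \<open>Markov's inequality for 2 to the number of successes, whose mean is
  \<open>(1 + p) ^ card V \<le> exp X\<close>. Since \<open>W\<close> is random, the bound on its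
  size is part of the event.\<close>

lemma many_prob:
  "measure_pmf.prob (Pi_pmf I False P) {\<omega>. real (card (W \<omega>)) * p \<le> X \<and> k \<le> card {i\<in>W \<omega>. \<omega> i}}
     \<le> exp X * (1 / 2) ^ k"
proof (rule prob_Pi_pmf_le[OF I J])
  fix f
  define V where "V = W f"
  have WV: "W (\<lambda>x. if x \<in> J then h x else f x) = V" for h
    unfolding V_def by (rule dep) simp
  have V: "V \<subseteq> J" unfolding V_def by (rule W)
  have fV: "finite V" using V J_finite finite_subset by blast
  let ?M = "Pi_pmf J False P"
  show "measure_pmf.prob ?M {h. (\<lambda>x. if x \<in> J then h x else f x) \<in>
      {\<omega>. real (card (W \<omega>)) * p \<le> X \<and> k \<le> card {i\<in>W \<omega>. \<omega> i}}} \<le> exp X * (1 / 2) ^ k"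
  proof (cases "real (card V) * p \<le> X")
    case True
    define Y :: "('i \<Rightarrow> bool) \<Rightarrow> real" where "Y = (\<lambda>h. \<Prod>j\<in>J. if j \<in> V \<and> h j then 2 else 1)"
    have Y: "Y h = 2 ^ card {i\<in>V. h i}" for h
    proof -
      have "{j \<in> J. j \<in> V \<and> h j} = {i \<in> V. h i}" using V by auto
      then show ?thesis unfolding Y_def using J_finite by (simp add: prod.If_cases Int_def)
    qed
    have Yb: "Y h \<le> 2 ^ card V" for h
      unfolding Y using fV by (intro power_increasing card_mono) auto
    have "measure_pmf.expectation ?M Y = (\<Prod>j\<in>J. measure_pmf.expectation (P j) (\<lambda>v. if j \<in> V \<and> v then 2 else 1))"
      unfolding Y_def by (intro expectation_prod_Pi_pmf J_finite integrable_measure_pmf_finite) auto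
    also have "\<dots> = (\<Prod>j\<in>J. if j \<in> V then 1 + p else 1)"
      using p by (intro prod.cong) (auto simp: P integral_bernoulli_pmf)
    also have "\<dots> = (1 + p) ^ card V" using J_finite V by (simp add: prod.If_cases Int_absorb1)
    also have "\<dots> \<le> exp p ^ card V" using p by (intro power_mono exp_ge_add_one_self) auto
    also have "\<dots> = exp (real (card V) * p)" by (simp add: exp_of_nat_mult)
    also have "\<dots> \<le> exp X" using True by simp
    finally have EY: "measure_pmf.expectation ?M Y \<le> exp X" .
    have "measure_pmf.prob ?M {h. (\<lambda>x. if x \<in> J then h x else f x) \<in>
      {\<omega>. real (card (W \<omega>)) * p \<le> X \<and> k \<le> card {i\<in>W \<omega>. \<omega> i}}}
      \<le> measure_pmf.prob ?M {h \<in> space ?M. 2 ^ k \<le> Y h}"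
    proof (intro measure_pmf.finite_measure_mono subsetI)
      fix h assume "h \<in> {h. (\<lambda>x. if x \<in> J then h x else f x) \<in>
        {\<omega>. real (card (W \<omega>)) * p \<le> X \<and> k \<le> card {i\<in>W \<omega>. \<omega> i}}}"
      then have "k \<le> card {i \<in> V. if i \<in> J then h i else f i}" by (simp add: WV)
      also have "{i \<in> V. if i \<in> J then h i else f i} = {i \<in> V. h i}" using V by auto
      finally show "h \<in> {h \<in> space ?M. 2 ^ k \<le> Y h}" by (simp add: Y)
    qed simp
    also have "\<dots> \<le> measure_pmf.expectation ?M Y / 2 ^ k"
    proof (rule integral_Markov_inequality_measure[where A = "{}"])
      show "integrable ?M Y"
        using Yb by (intro measure_pmf.integrable_const_bound[where B = "2 ^ card V"])
          (auto simp: AE_measure_pmf_iff Y)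
    qed (auto simp: Y)
    also have "\<dots> \<le> exp X / 2 ^ k" using EY by (simp add: divide_right_mono)
    finally show ?thesis by (simp add: power_one_over)
  next
    case False
    then show ?thesis by (simp add: WV)
  qed
qed

end

subsection \<open>Good seeds\<close>

text \<open>The day comes first in the seed index, so that
  \<open>\<lambda>y. \<omega> (t, y)\<close> is the randomness of day \<open>t\<close>.\<close>

definition sampled :: "(nat \<times> nat \<times> nat \<times> nat \<Rightarrow> bool) \<Rightarrow> nat \<Rightarrow> nat \<Rightarrow> nat \<Rightarrow> nat \<Rightarrow> bool" where
  "sampled \<omega> b r i e = \<omega> (e, b, r, i)"

text \<open>The longest epoch \<open>2 ^ \<beta>\<close> is meant to be about
  \<open>k * T / n\<close>, so that its grid has about \<open>n / k\<close> points. Only the upper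
  bound is assumed here; the matching lower bound enters in \<open>slack_le\<close>.\<close>

locale parameters =
  fixes n T k w \<beta> :: nat
  assumes k: "1 \<le> k" "k \<le> n" and T: "2 \<le> T" and w: "1 \<le> w" "n * T \<le> 2 ^ w" and beta: "2 ^ \<beta> * n \<le> k * T"
begin

text \<open>Integer losses are at most \<open>T\<close> per day, so \<open>2\<^sup>L\<close> exceeds every advantage and there are at most \<open>L\<close>
  classes of the potential; \<open>\<rho>\<close> is its contraction per layer, and \<open>R\<close> layers bring the rate from \<open>q\<close>
  below \<open>q / (n T)\<close>.  Up to the normalisation by the rate, \<open>X\<close> bounds the potential of a layer, \<open>cap\<close> its survivors in a block
  and \<open>raw\<close> its samples on one day.  Seeds are indexed by (day, level, layer, expert).\<close>

definition "L = 2 * w"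
definition "R = 2 * L\<^sup>2 * w"
definition "\<rho> = 1 - 1 / (2 * real L ^ 2)"
definition "q = real k / real n"
definition "X = 4 * L\<^sup>2 * w\<^sup>2"
definition "cap = 2 * X + 2 * w\<^sup>2"
definition "raw = 2 * k + 2 * w\<^sup>2"
definition "rate r = q * \<rho> ^ (R - r)"
definition "D = T - 1"
text \<open>Chosen so that \<open>q * visits \<ge> w\<^sup>2\<close>: all of that many coins of bias
  \<open>q\<close> fail with probability at most \<open>exp (- w\<^sup>2)\<close>.\<close>

definition "visits = nat \<lceil>real n * real (w\<^sup>2) / real k\<rceil>"

definition "idx = {..<T} \<times> {..\<beta>} \<times> {..R} \<times> {1..n}"
definition "coin = (\<lambda>(x::nat, b::nat, r, i::nat). bernoulli_pmf (rate r))"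
definition "seeds = Pi_pmf idx False coin"

abbreviation "live_at g \<omega> b \<equiv> live T g b (sampled \<omega> b)"
abbreviation "pool_of g \<omega> b \<equiv> pool T g b (sampled \<omega> b)"
abbreviation "uncovered_of g \<omega> b \<equiv> uncovered n T g b (sampled \<omega> b)"
abbreviation "potential_of g \<omega> b \<equiv> layer_potential n T g b (sampled \<omega> b)"
abbreviation "critical_of g \<omega> b \<equiv> critical n T g b (sampled \<omega> b)"

lemma n_pos: "0 < n" using k by simp
lemma L_pos: "1 \<le> L" using w by (simp add: L_def)
lemma q: "0 < q" "q \<le> 1" using k by (auto simp: q_def)

lemma rho: "1 / 2 \<le> \<rho>" "\<rho> \<le> 1"
proof -
  have "1 \<le> real L ^ 2" using L_pos by simp
  then have "1 / (2 * real L ^ 2) \<le> 1 / 2" using L_pos by (intro divide_left_mono) auto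
  then show "1 / 2 \<le> \<rho>" by (simp add: \<rho>_def)
  show "\<rho> \<le> 1" by (simp add: \<rho>_def)
qed

lemma rate: "0 < rate r" "rate r \<le> q" "rate r \<le> 1"
proof -
  show "0 < rate r" using q rho by (simp add: rate_def)
  show "rate r \<le> q" unfolding rate_def using q rho by (intro mult_left_le power_le_one) auto
  then show "rate r \<le> 1" using q by simp
qed

lemma T_le: "T \<le> 2 ^ w"
proof -
  have "T \<le> n * T" using n_pos by (cases n) auto
  then show ?thesis using w(2) by linarith
qed

lemma D_less: "D < T" using T by (simp add: D_def)

lemma TD_less: "t \<le> D \<Longrightarrow> T * t < 2 ^ L"
proof -
  assume "t \<le> D"
  then have "t < T" using D_less by linarith
  then have "T * t < T * T" using T by (intro mult_strict_left_mono) auto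
  also have "\<dots> \<le> 2 ^ w * 2 ^ w" by (intro mult_le_mono T_le)
  also have "\<dots> = 2 ^ L" by (simp add: L_def mult_2 power_add)
  finally show ?thesis .
qed

lemma beta_le: "\<beta> \<le> w"
proof -
  have "k * T \<le> n * T" using k(2) by (rule mult_le_mono1)
  then have "n * 2 ^ \<beta> \<le> n * T" using beta by (simp only: mult.commute)
  then have "2 ^ \<beta> \<le> T" using n_pos by (simp only: nat_mult_le_cancel1)
  then have "(2::nat) ^ \<beta> \<le> 2 ^ w" using T_le by linarith
  then show ?thesis by (intro power_le_imp_le_exp[of 2 \<beta> w]) auto
qed

lemma block_bounds:
  assumes "(c + 1) * 2 ^ h \<le> D"
  shows "h < w" "c < T"
proof -
  have "2 ^ h \<le> (c + 1) * 2 ^ h" by simp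
  then have "(2::nat) ^ h < 2 ^ w" using assms D_less T_le by linarith
  then show "h < w" by simp
  have "(c + 1) * 1 \<le> (c + 1) * 2 ^ h" by (rule mult_le_mono2) simp
  then have "c + 1 \<le> D" using assms by simp
  then show "c < T" using D_less by linarith
qed

lemma finite_idx: "finite idx" by (simp add: idx_def)

lemma seeds_support: "\<omega> \<in> set_pmf seeds \<Longrightarrow> \<omega> z \<Longrightarrow> z \<in> idx"
proof -
  assume "\<omega> \<in> set_pmf seeds" "\<omega> z"
  then have "\<omega> \<in> {f. \<forall>x. x \<notin> idx \<longrightarrow> f x = False}"
    unfolding seeds_def by (intro subsetD[OF set_Pi_pmf_subset[OF finite_idx]])
  from CollectD[OF this] have "z \<notin> idx \<longrightarrow> \<omega> z = False" by (rule spec)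
  then show "z \<in> idx" using \<open>\<omega> z\<close> by metis
qed

lemma exp_power_le: "0 \<le> p \<Longrightarrow> p \<le> 1 \<Longrightarrow> c \<le> p * real m \<Longrightarrow> (1 - p) ^ m \<le> exp (- c)" for p c :: real
proof -
  assume a: "0 \<le> p" "p \<le> 1" "c \<le> p * real m"
  have "(1 - p) ^ m \<le> exp (- p) ^ m" using a exp_ge_add_one_self[of "- p"] by (intro power_mono) auto
  also have "\<dots> = exp (- (p * real m))" by (simp add: exp_of_nat_mult[symmetric] mult.commute)
  also have "\<dots> \<le> exp (- c)" using a by simp
  finally show ?thesis .
qed

text \<open>As \<open>exp 1 \<le> 4\<close>, two halvings gain a factor \<open>exp 1\<close>:
  \<open>2 * y\<close> of them cancel \<open>exp x\<close> and the remaining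
  \<open>2 * w\<^sup>2\<close> leave \<open>exp (- w\<^sup>2)\<close>. Hence the factors 2 in
  \<open>cap\<close> and \<open>raw\<close>.\<close>

lemma exp_half_power_le: "x \<le> real y \<Longrightarrow> exp x * (1 / 2) ^ (2 * y + 2 * w\<^sup>2) \<le> exp (- real (w\<^sup>2))"
proof -
  assume x: "x \<le> real y"
  have "exp 1 \<le> (4::real)" using exp_le by simp
  then have "(1 / 2 :: real) ^ 2 \<le> exp (- 1)" by (simp add: exp_minus field_simps power2_eq_square)
  then have "((1 / 2 :: real) ^ 2) ^ (y + w\<^sup>2) \<le> exp (- 1) ^ (y + w\<^sup>2)" by (intro power_mono) auto
  also have "\<dots> = exp (- real (y + w\<^sup>2))" by (simp add: exp_of_nat_mult[symmetric])
  finally have "(1 / 2 :: real) ^ (2 * y + 2 * w\<^sup>2) \<le> exp (- real (y + w\<^sup>2))"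
    by (simp add: power_mult[symmetric] distrib_left)
  then have "exp x * (1 / 2) ^ (2 * y + 2 * w\<^sup>2) \<le> exp x * exp (- real (y + w\<^sup>2))" by simp
  also have "\<dots> = exp (x - real y - real (w\<^sup>2))" by (simp add: exp_add[symmetric])
  also have "\<dots> \<le> exp (- real (w\<^sup>2))" using x by simp
  finally show ?thesis .
qed

text \<open>The set \<open>V\<close> reads only layers below \<open>r\<close> of level
  \<open>b\<close>, while its coins belong to layer \<open>r\<close> of that level; the image map
  turns a pair into its seed index.\<close>

lemma layer_block:
  assumes "b \<le> \<beta>" "r \<le> R"
    and W: "\<And>\<omega>. V \<omega> \<subseteq> {1..n} \<times> {..<T}"
    and dep: "\<And>\<omega> \<omega>'. (\<And>r' i e. r' < r \<Longrightarrow> sampled \<omega> b r' i e = sampled \<omega>' b r' i e) \<Longrightarrow> V \<omega> = V \<omega>'"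
  shows "independent_block idx {z \<in> idx. fst (snd z) = b \<and> fst (snd (snd z)) = r} coin (rate r)
           (\<lambda>\<omega>. (\<lambda>u. (snd u, b, r, fst u)) ` V \<omega>)"
proof
  show "(\<lambda>u. (snd u, b, r, fst u)) ` V \<omega> \<subseteq> {z \<in> idx. fst (snd z) = b \<and> fst (snd (snd z)) = r}" for \<omega>
    using W[of \<omega>] assms(1,2) by (auto simp: idx_def)
  show "(\<lambda>u. (snd u, b, r, fst u)) ` V \<omega> = (\<lambda>u. (snd u, b, r, fst u)) ` V \<omega>'"
    if "\<And>i. i \<notin> {z \<in> idx. fst (snd z) = b \<and> fst (snd (snd z)) = r} \<Longrightarrow> \<omega> i = \<omega>' i" for \<omega> \<omega>'
  proof -
    have "V \<omega> = V \<omega>'" by (rule dep) (simp add: sampled_def that)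
    then show ?thesis by simp
  qed
qed (use finite_idx rate[of r] in \<open>auto simp: coin_def less_imp_le\<close>)

lemma card_index_image: "card ((\<lambda>u. (snd u, b, r, fst u)) ` V) = card V"
  by (intro card_image inj_onI) (auto simp: prod_eq_iff)

lemma pool_layers: "(\<And>r' i e. r' < r \<Longrightarrow> sampled \<omega> b r' i e = sampled \<omega>' b r' i e) \<Longrightarrow>
    pool N g b (sampled \<omega> b) r = pool N g b (sampled \<omega>' b) r"
  by (intro ext pool_determined) auto

text \<open>A product of potential and rate above \<open>\<rho> * X\<close> forces
  \<open>w\<^sup>2 / rate r\<close> critical pairs. The factor \<open>4 * L\<^sup>2\<close> in
  \<open>X\<close> is made for this: \<open>2 * L\<^sup>2\<close> from
  \<open>critical_props\<close>, and 2 from \<open>\<rho> \<ge> 1 / 2\<close>.\<close>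

lemma prob_critical_missed:
  assumes "b \<le> \<beta>" "b \<le> h" "(c + 1) * 2 ^ h \<le> D" "r \<le> R"
  shows "measure_pmf.prob seeds {\<omega>.
      \<rho> * real X < real (potential_of g \<omega> b r h c) * rate r \<and>
      (\<forall>u\<in>critical_of g \<omega> b r h c L. \<not> sampled \<omega> b r (fst u) (snd u))} \<le> exp (- real (w\<^sup>2))"
proof -
  define V where "V = (\<lambda>\<omega>. critical_of g \<omega> b r h c L)"
  note cp = critical_props[OF assms(2) TD_less[OF assms(3)], where n = n and g = g and r = r]
  interpret independent_block idx "{z \<in> idx. fst (snd z) = b \<and> fst (snd (snd z)) = r}" coin "rate r"
    "\<lambda>\<omega>. (\<lambda>u. (snd u, b, r, fst u)) ` V \<omega>"
  proof (rule layer_block)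
    show "V \<omega> \<subseteq> {1..n} \<times> {..<T}" for \<omega>
      using cp(1)[of "sampled \<omega> b"] uncovered_subset[of n T g b "sampled \<omega> b" r h c] assms(3) D_less
      unfolding V_def by fastforce
    show "V \<omega> = V \<omega>'" if "\<And>r' i e. r' < r \<Longrightarrow> sampled \<omega> b r' i e = sampled \<omega>' b r' i e" for \<omega> \<omega>'
    proof -
      have "pool_of g \<omega> b r = pool_of g \<omega>' b r" by (rule pool_layers) (rule that)
      then show ?thesis by (simp only: V_def critical_def layer_potential_def uncovered_def)
    qed
  qed (use assms in auto)
  define K where "K = nat \<lceil>real (w\<^sup>2) / rate r\<rceil>"
  have "measure_pmf.prob seeds {\<omega>.
      \<rho> * real X < real (potential_of g \<omega> b r h c) * rate r \<and>
      (\<forall>u\<in>V \<omega>. \<not> sampled \<omega> b r (fst u) (snd u))}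
    \<le> measure_pmf.prob seeds {\<omega>. K \<le> card ((\<lambda>u. (snd u, b, r, fst u)) ` V \<omega>) \<and>
        (\<forall>i\<in>(\<lambda>u. (snd u, b, r, fst u)) ` V \<omega>. \<not> \<omega> i)}"
  proof (intro measure_pmf.finite_measure_mono subsetI)
    fix \<omega> assume "\<omega> \<in> {\<omega>.
      \<rho> * real X < real (potential_of g \<omega> b r h c) * rate r \<and>
      (\<forall>u\<in>V \<omega>. \<not> sampled \<omega> b r (fst u) (snd u))}"
    then have o: "\<rho> * real X < real (potential_of g \<omega> b r h c) * rate r"
      "\<forall>u\<in>V \<omega>. \<not> sampled \<omega> b r (fst u) (snd u)" by auto
    have "1 / 2 * real X \<le> \<rho> * real X" using rho by (intro mult_right_mono) auto
    also have "\<dots> \<le> real (2 * L\<^sup>2 * card (V \<omega>)) * rate r"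
      using o(1) cp(2)[of "sampled \<omega> b"] rate(1)[of r] unfolding V_def
      by (meson less_imp_le mult_right_mono of_nat_le_iff order_trans)
    finally have "2 * real L ^ 2 * real (w\<^sup>2) \<le> 2 * real L ^ 2 * (real (card (V \<omega>)) * rate r)"
      by (simp add: X_def mult.commute mult.left_commute)
    then have "real (w\<^sup>2) \<le> real (card (V \<omega>)) * rate r"
      by (rule mult_left_le_imp_le) (use L_pos in simp)
    then have "real (w\<^sup>2) / rate r \<le> real (card (V \<omega>))" using rate(1)[of r] by (simp only: pos_divide_le_eq)
    then have "K \<le> card (V \<omega>)" by (simp add: K_def ceiling_le_iff)
    then show "\<omega> \<in> {\<omega>. K \<le> card ((\<lambda>u. (snd u, b, r, fst u)) ` V \<omega>) \<and>
        (\<forall>i\<in>(\<lambda>u. (snd u, b, r, fst u)) ` V \<omega>. \<not> \<omega> i)}"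
      using o(2) by (auto simp: card_index_image sampled_def)
  qed simp
  also have "\<dots> \<le> (1 - rate r) ^ K" unfolding seeds_def by (rule miss_prob)
  also have "\<dots> \<le> exp (- real (w\<^sup>2))"
  proof (rule exp_power_le)
    have "real (w\<^sup>2) / rate r \<le> real K" by (simp add: K_def of_nat_ceiling)
    then show "real (w\<^sup>2) \<le> rate r * real K" using rate(1)[of r] by (simp only: pos_divide_le_eq mult.commute)
  qed (use rate[of r] in auto)
  finally show ?thesis unfolding V_def .
qed

lemma prob_many_survivors:
  assumes "b \<le> \<beta>" "(c + 1) * 2 ^ h \<le> D" "r \<le> R"
  shows "measure_pmf.prob seeds {\<omega>.
      real (card (uncovered_of g \<omega> b r h c)) * rate r \<le> real X \<and>
      cap \<le> card {u \<in> uncovered_of g \<omega> b r h c. sampled \<omega> b r (fst u) (snd u)}} \<le> exp (- real (w\<^sup>2))"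
proof -
  define V where "V = (\<lambda>\<omega>. uncovered_of g \<omega> b r h c)"
  interpret independent_block idx "{z \<in> idx. fst (snd z) = b \<and> fst (snd (snd z)) = r}" coin "rate r"
    "\<lambda>\<omega>. (\<lambda>u. (snd u, b, r, fst u)) ` V \<omega>"
  proof (rule layer_block)
    show "V \<omega> \<subseteq> {1..n} \<times> {..<T}" for \<omega>
      using uncovered_subset[of n T g b "sampled \<omega> b" r h c] assms(2) D_less
      unfolding V_def by fastforce
    show "V \<omega> = V \<omega>'" if "\<And>r' i e. r' < r \<Longrightarrow> sampled \<omega> b r' i e = sampled \<omega>' b r' i e" for \<omega> \<omega>'
    proof -
      have "pool_of g \<omega> b r = pool_of g \<omega>' b r" by (rule pool_layers) (rule that)
      then show ?thesis by (simp only: V_def uncovered_def)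
    qed
  qed (use assms in auto)
  have eq: "{i \<in> (\<lambda>u. (snd u, b, r, fst u)) ` V \<omega>. \<omega> i} =
      (\<lambda>u. (snd u, b, r, fst u)) ` {u \<in> V \<omega>. sampled \<omega> b r (fst u) (snd u)}" for \<omega>
    by (auto simp: sampled_def)
  have "measure_pmf.prob seeds {\<omega>. real (card ((\<lambda>u. (snd u, b, r, fst u)) ` V \<omega>)) * rate r \<le> real X \<and>
      cap \<le> card {i \<in> (\<lambda>u. (snd u, b, r, fst u)) ` V \<omega>. \<omega> i}} \<le> exp (real X) * (1 / 2) ^ cap"
    unfolding seeds_def by (rule many_prob)
  also have "\<dots> \<le> exp (- real (w\<^sup>2))" unfolding cap_def by (rule exp_half_power_le) simp
  finally show ?thesis unfolding eq card_index_image unfolding V_def .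
qed

lemma prob_many_raw:
  assumes "b \<le> \<beta>" "x < T" "r \<le> R"
  shows "measure_pmf.prob seeds {\<omega>. raw \<le> card {i\<in>{1..n}. sampled \<omega> b r i x}} \<le> exp (- real (w\<^sup>2))"
proof -
  define V :: "(nat \<times> nat \<times> nat \<times> nat \<Rightarrow> bool) \<Rightarrow> (nat \<times> nat) set" where "V = (\<lambda>\<omega>. {1..n} \<times> {x})"
  interpret independent_block idx "{z \<in> idx. fst (snd z) = b \<and> fst (snd (snd z)) = r}" coin "rate r"
    "\<lambda>\<omega>. (\<lambda>u. (snd u, b, r, fst u)) ` V \<omega>"
    by (rule layer_block) (use assms in \<open>auto simp: V_def\<close>)
  have eq: "{i \<in> (\<lambda>u. (snd u, b, r, fst u)) ` V \<omega>. \<omega> i} = (\<lambda>i. (x, b, r, i)) ` {i\<in>{1..n}. sampled \<omega> b r i x}" for \<omega>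
    by (auto simp: sampled_def V_def image_iff)
  have card: "card ((\<lambda>i. (x, b, r, i)) ` S) = card S" for S by (intro card_image inj_onI) auto
  have "real n * rate r \<le> real n * q" using rate(2) by (intro mult_left_mono) auto
  also have "\<dots> = real k" using n_pos by (simp add: q_def)
  finally have "real (card ((\<lambda>u. (snd u, b, r, fst u)) ` V \<omega>)) * rate r \<le> real k" for \<omega>
    unfolding card_index_image by (simp add: V_def card_cartesian_product)
  then have "measure_pmf.prob seeds {\<omega>. raw \<le> card {i\<in>{1..n}. sampled \<omega> b r i x}} =
    measure_pmf.prob seeds {\<omega>. real (card ((\<lambda>u. (snd u, b, r, fst u)) ` V \<omega>)) * rate r \<le> real k \<and>
      raw \<le> card {i \<in> (\<lambda>u. (snd u, b, r, fst u)) ` V \<omega>. \<omega> i}}"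
    unfolding eq card by simp
  also have "\<dots> \<le> exp (real k) * (1 / 2) ^ raw" unfolding seeds_def by (rule many_prob)
  also have "\<dots> \<le> exp (- real (w\<^sup>2))" unfolding raw_def by (rule exp_half_power_le) simp
  finally show ?thesis .
qed

text \<open>The walk, and with it the set of early visits, is decided by the layers below
  \<open>R\<close> of all levels. The coins of layer \<open>R\<close>, which has the full rate
  \<open>q\<close>, are therefore fresh.\<close>

lemma prob_visits_missed:
  assumes "i \<in> {1..n}"
  shows "measure_pmf.prob seeds {\<omega>. visits \<le> card (early_visits T g \<beta> R (sampled \<omega>) D i visits) \<and>
      (\<forall>(b, x)\<in>early_visits T g \<beta> R (sampled \<omega>) D i visits. \<not> sampled \<omega> b R i x)} \<le> exp (- real (w\<^sup>2))"
proof -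
  define V where "V = (\<lambda>\<omega>. early_visits T g \<beta> R (sampled \<omega>) D i visits)"
  have Vb: "V \<omega> \<subseteq> {..\<beta>} \<times> {..<T}" for \<omega>
  proof (cases "card (bad_visits T g \<beta> R (sampled \<omega>) D i D) < visits")
    case True
    then show ?thesis by (simp add: V_def early_visits_def)
  next
    case False
    then have "(LEAST x. visits \<le> card (bad_visits T g \<beta> R (sampled \<omega>) D i x)) \<le> D"
      by (intro Least_le) simp
    then show ?thesis using False D_less by (auto simp: V_def early_visits_def bad_visits_def)
  qed
  interpret independent_block idx "{z \<in> idx. fst (snd (snd z)) = R}" coin q
    "\<lambda>\<omega>. (\<lambda>(b, x). (x, b, R, i)) ` V \<omega>"
  proof
    show "(\<lambda>(b, x). (x, b, R, i)) ` V \<omega> \<subseteq> {z \<in> idx. fst (snd (snd z)) = R}" for \<omega>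
      using Vb[of \<omega>] assms by (auto simp: idx_def)
    show "(\<lambda>(b, x). (x, b, R, i)) ` V \<omega> = (\<lambda>(b, x). (x, b, R, i)) ` V \<omega>'"
      if "\<And>i. i \<notin> {z \<in> idx. fst (snd (snd z)) = R} \<Longrightarrow> \<omega> i = \<omega>' i" for \<omega> \<omega>'
    proof -
      have "pool_of g \<omega> b R = pool_of g \<omega>' b R" for b
        by (rule pool_layers) (simp add: sampled_def that)
      then have "caught T g R (sampled \<omega>) = caught T g R (sampled \<omega>')"
        by (intro ext) (simp add: caught_def)
      then have "walk_step T g \<beta> R (sampled \<omega>) D i = walk_step T g \<beta> R (sampled \<omega>') D i"
        by (intro ext) (simp only: walk_step_def)
      then have "walk T g \<beta> R (sampled \<omega>) D i = walk T g \<beta> R (sampled \<omega>') D i"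
        by (intro ext) (simp only: walk_def)
      then have "V \<omega> = V \<omega>'"
        using \<open>caught T g R (sampled \<omega>) = caught T g R (sampled \<omega>')\<close>
        by (simp only: V_def early_visits_def bad_visits_def)
      then show ?thesis by simp
    qed
  qed (use finite_idx q in \<open>auto simp: coin_def rate_def\<close>)
  have card: "card ((\<lambda>(b, x). (x, b, R, i)) ` S) = card S" for S
    by (intro card_image inj_onI) auto
  have "measure_pmf.prob seeds {\<omega>. visits \<le> card (V \<omega>) \<and> (\<forall>(b, x)\<in>V \<omega>. \<not> sampled \<omega> b R i x)} =
    measure_pmf.prob seeds {\<omega>. visits \<le> card ((\<lambda>(b, x). (x, b, R, i)) ` V \<omega>) \<and>
      (\<forall>z\<in>(\<lambda>(b, x). (x, b, R, i)) ` V \<omega>. \<not> \<omega> z)}"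
    unfolding card by (rule arg_cong[where f = "measure_pmf.prob seeds"]) (auto simp: sampled_def)
  also have "\<dots> \<le> (1 - q) ^ visits" unfolding seeds_def by (rule miss_prob)
  also have "\<dots> \<le> exp (- real (w\<^sup>2))"
  proof (rule exp_power_le)
    have "real n * real (w\<^sup>2) / real k \<le> real visits" by (simp add: visits_def of_nat_ceiling)
    then have "real n * real (w\<^sup>2) \<le> real visits * real k" using k by (simp only: pos_divide_le_eq of_nat_0_less_iff)
    then show "real (w\<^sup>2) \<le> q * real visits" using n_pos by (simp add: q_def field_simps)
  qed (use q in auto)
  finally show ?thesis unfolding V_def .
qed

text \<open>The losses \<open>g\<close> are fixed before the seeds are drawn; this is where
  obliviousness enters. The first part yields the invariant \<open>good_potential\<close>, which
  supplies the premise of the second.\<close>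

definition good :: "(nat \<Rightarrow> nat \<Rightarrow> nat) \<Rightarrow> (nat \<times> nat \<times> nat \<times> nat \<Rightarrow> bool) \<Rightarrow> bool" where
  "good g \<omega> \<longleftrightarrow>
    (\<forall>b h c r. b \<le> \<beta> \<longrightarrow> b \<le> h \<longrightarrow> (c + 1) * 2 ^ h \<le> D \<longrightarrow> r \<le> R \<longrightarrow>
      \<rho> * real X < real (potential_of g \<omega> b r h c) * rate r \<longrightarrow>
      (\<exists>u\<in>critical_of g \<omega> b r h c L. sampled \<omega> b r (fst u) (snd u))) \<and>
    (\<forall>b h c r. b \<le> \<beta> \<longrightarrow> b \<le> h \<longrightarrow> (c + 1) * 2 ^ h \<le> D \<longrightarrow> r \<le> R \<longrightarrow>
      real (card (uncovered_of g \<omega> b r h c)) * rate r \<le> real X \<longrightarrow>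
      card {u \<in> uncovered_of g \<omega> b r h c. sampled \<omega> b r (fst u) (snd u)} < cap) \<and>
    (\<forall>b x r. b \<le> \<beta> \<longrightarrow> x < T \<longrightarrow> r \<le> R \<longrightarrow> card {i\<in>{1..n}. sampled \<omega> b r i x} < raw) \<and>
    (\<forall>i\<in>{1..n}. visits \<le> card (early_visits T g \<beta> R (sampled \<omega>) D i visits) \<longrightarrow>
      (\<exists>(b, x)\<in>early_visits T g \<beta> R (sampled \<omega>) D i visits. sampled \<omega> b R i x))"

lemma prob_UN_le:
  assumes "finite S" "\<And>s. s \<in> S \<Longrightarrow> measure_pmf.prob p (B s) \<le> c"
  shows "measure_pmf.prob p (\<Union>s\<in>S. B s) \<le> real (card S) * c"
proof -
  have "measure_pmf.prob p (\<Union>s\<in>S. B s) \<le> (\<Sum>s\<in>S. measure_pmf.prob p (B s))"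
    using assms(1) by (intro measure_pmf.finite_measure_subadditive_finite) auto
  also have "\<dots> \<le> (\<Sum>s\<in>S. c)" by (intro sum_mono assms(2))
  finally show ?thesis by simp
qed

text \<open>Union bound. A block that ends by \<open>D\<close> has \<open>h < w\<close> and
  \<open>c < T\<close>, which limits the number of events of the first three kinds; the last kind
  has one event per expert.\<close>

lemma prob_not_good:
  "measure_pmf.prob seeds {\<omega>. \<not> good g \<omega>} \<le> real (3 * ((w + 1) ^ 2 * T * (R + 1)) + n) * exp (- real (w\<^sup>2))"
proof -
  define S1 where "S1 = {(b, h, c, r). b \<le> \<beta> \<and> b \<le> h \<and> (c + 1) * 2 ^ h \<le> D \<and> r \<le> R}"
  define S3 where "S3 = {..\<beta>} \<times> {..<T} \<times> {..R}"
  define B1 where "B1 = (\<lambda>(b, h, c, r). {\<omega>.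
      \<rho> * real X < real (potential_of g \<omega> b r h c) * rate r \<and>
      (\<forall>u\<in>critical_of g \<omega> b r h c L. \<not> sampled \<omega> b r (fst u) (snd u))})"
  define B2 where "B2 = (\<lambda>(b, h, c, r). {\<omega>.
      real (card (uncovered_of g \<omega> b r h c)) * rate r \<le> real X \<and>
      cap \<le> card {u \<in> uncovered_of g \<omega> b r h c. sampled \<omega> b r (fst u) (snd u)}})"
  define B3 where "B3 = (\<lambda>(b, x, r). {\<omega>. raw \<le> card {i\<in>{1..n}. sampled \<omega> b r i x}})"
  define B4 where "B4 = (\<lambda>i. {\<omega>. visits \<le> card (early_visits T g \<beta> R (sampled \<omega>) D i visits) \<and>
      (\<forall>(b, x)\<in>early_visits T g \<beta> R (sampled \<omega>) D i visits. \<not> sampled \<omega> b R i x)})"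
  have sub: "S1 \<subseteq> {..w} \<times> {..w} \<times> {..<T} \<times> {..R}"
  proof
    fix s assume "s \<in> S1"
    then obtain b h c r where s: "s = (b, h, c, r)" "b \<le> \<beta>" "(c + 1) * 2 ^ h \<le> D" "r \<le> R"
      by (auto simp: S1_def)
    then show "s \<in> {..w} \<times> {..w} \<times> {..<T} \<times> {..R}"
      using block_bounds[OF s(3)] beta_le by auto
  qed
  have fin1: "finite S1" by (rule finite_subset[OF sub]) simp
  have c1: "card S1 \<le> (w + 1) ^ 2 * T * (R + 1)"
    using card_mono[OF _ sub] by (simp add: card_cartesian_product power2_eq_square algebra_simps)
  have c3: "card S3 \<le> (w + 1) ^ 2 * T * (R + 1)"
  proof -
    have "card S3 = (\<beta> + 1) * (T * (R + 1))" by (simp add: S3_def card_cartesian_product)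
    also have "\<dots> \<le> (w + 1) ^ 2 * (T * (R + 1))"
      using beta_le by (intro mult_le_mono1) (simp add: power2_eq_square)
    finally show ?thesis by (simp only: mult.assoc)
  qed
  have "{\<omega>. \<not> good g \<omega>} \<subseteq> (\<Union>s\<in>S1. B1 s) \<union> (\<Union>s\<in>S1. B2 s) \<union> (\<Union>s\<in>S3. B3 s) \<union> (\<Union>i\<in>{1..n}. B4 i)"
  proof (rule subsetI, rule ccontr)
    fix \<omega> assume "\<omega> \<in> {\<omega>. \<not> good g \<omega>}" and
      *: "\<omega> \<notin> (\<Union>s\<in>S1. B1 s) \<union> (\<Union>s\<in>S1. B2 s) \<union> (\<Union>s\<in>S3. B3 s) \<union> (\<Union>i\<in>{1..n}. B4 i)"
    have S1: "(b, h, c, r) \<in> S1" if "b \<le> \<beta>" "b \<le> h" "(c + 1) * 2 ^ h \<le> D" "r \<le> R" for b h c r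
      using that by (simp add: S1_def)
    have "good g \<omega>" unfolding good_def
    proof (intro conjI allI impI ballI)
      fix b h c r assume a: "b \<le> \<beta>" "b \<le> h" "(c + 1) * 2 ^ h \<le> D" "r \<le> R"
        and b: "\<rho> * real X < real (potential_of g \<omega> b r h c) * rate r"
      have "\<omega> \<notin> B1 (b, h, c, r)" using * S1[OF a] by blast
      then show "\<exists>u\<in>critical_of g \<omega> b r h c L. sampled \<omega> b r (fst u) (snd u)"
        using b unfolding B1_def by simp
    next
      fix b h c r assume a: "b \<le> \<beta>" "b \<le> h" "(c + 1) * 2 ^ h \<le> D" "r \<le> R"
        and b: "real (card (uncovered_of g \<omega> b r h c)) * rate r \<le> real X"
      have "\<omega> \<notin> B2 (b, h, c, r)" using * S1[OF a] by blast
      then show "card {u \<in> uncovered_of g \<omega> b r h c. sampled \<omega> b r (fst u) (snd u)} < cap"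
        using b unfolding B2_def by simp
    next
      fix b x r assume a: "b \<le> \<beta>" "x < T" "r \<le> R"
      then have "(b, x, r) \<in> S3" by (simp add: S3_def)
      then have "\<omega> \<notin> B3 (b, x, r)" using * by blast
      then show "card {i\<in>{1..n}. sampled \<omega> b r i x} < raw" unfolding B3_def by simp
    next
      fix i assume i: "i \<in> {1..n}"
        and v: "visits \<le> card (early_visits T g \<beta> R (sampled \<omega>) D i visits)"
      have "\<omega> \<notin> B4 i" using * i by blast
      then show "\<exists>(b, x)\<in>early_visits T g \<beta> R (sampled \<omega>) D i visits. sampled \<omega> b R i x"
        using v unfolding B4_def by auto
    qed
    then show False using \<open>\<omega> \<in> {\<omega>. \<not> good g \<omega>}\<close> by simp
  qed
  then have "measure_pmf.prob seeds {\<omega>. \<not> good g \<omega>} \<le>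
      measure_pmf.prob seeds ((\<Union>s\<in>S1. B1 s) \<union> (\<Union>s\<in>S1. B2 s) \<union> (\<Union>s\<in>S3. B3 s) \<union> (\<Union>i\<in>{1..n}. B4 i))"
    by (intro measure_pmf.finite_measure_mono) auto
  also have "\<dots> \<le> measure_pmf.prob seeds (\<Union>s\<in>S1. B1 s) + measure_pmf.prob seeds (\<Union>s\<in>S1. B2 s)
     + measure_pmf.prob seeds (\<Union>s\<in>S3. B3 s) + measure_pmf.prob seeds (\<Union>i\<in>{1..n}. B4 i)"
    by (intro order_trans[OF measure_Un_le] add_right_mono) auto
  also have "\<dots> \<le> real (card S1) * exp (- real (w\<^sup>2)) + real (card S1) * exp (- real (w\<^sup>2))
     + real (card S3) * exp (- real (w\<^sup>2)) + real (card {1..n}) * exp (- real (w\<^sup>2))"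
  proof (intro add_mono prob_UN_le fin1)
    show "measure_pmf.prob seeds (B1 s) \<le> exp (- real (w\<^sup>2))" if "s \<in> S1" for s
      using that prob_critical_missed by (auto simp: S1_def B1_def)
    show "measure_pmf.prob seeds (B2 s) \<le> exp (- real (w\<^sup>2))" if "s \<in> S1" for s
      using that prob_many_survivors by (auto simp: S1_def B2_def)
    show "measure_pmf.prob seeds (B3 s) \<le> exp (- real (w\<^sup>2))" if "s \<in> S3" for s
      using that prob_many_raw by (auto simp: S3_def B3_def)
    show "measure_pmf.prob seeds (B4 i) \<le> exp (- real (w\<^sup>2))" if "i \<in> {1..n}" for i
      using that prob_visits_missed unfolding B4_def by blast
  qed (auto simp: S3_def)
  also have "\<dots> = real (2 * card S1 + card S3 + n) * exp (- real (w\<^sup>2))" by (simp add: algebra_simps)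
  also have "\<dots> \<le> real (3 * ((w + 1) ^ 2 * T * (R + 1)) + n) * exp (- real (w\<^sup>2))"
    using c1 c3 by (intro mult_right_mono of_nat_mono) auto
  finally show ?thesis .
qed

end

subsection \<open>Memory states\<close>

context parameters
begin

lemma two_power_exp: "2 ^ w * exp (- real w) \<le> 1"
proof -
  have "(2::real) ^ w \<le> exp 1 ^ w" using exp_ge_add_one_self[of 1] by (intro power_mono) auto
  then show ?thesis by (simp add: exp_of_nat_mult[symmetric] exp_minus divide_simps)
qed

text \<open>\<open>R = 2 * L\<^sup>2 * w\<close> layers give
  \<open>\<rho> ^ R \<le> exp (- w)\<close>, which outweighs the at most \<open>2 ^ w\<close> pairs.
  What remains is \<open>L \<le> X\<close>.\<close>

lemma potential_start:
  assumes "E \<le> T"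
  shows "real (L * (n * E)) * (q * \<rho> ^ R) \<le> real X"
proof -
  have "\<rho> ^ R \<le> exp (- real w)"
    unfolding \<rho>_def
  proof (rule exp_power_le)
    show "real w \<le> 1 / (2 * (real L)\<^sup>2) * real R" using L_pos by (simp add: R_def)
    have "1 \<le> real L ^ 2" using L_pos by simp
    then show "1 / (2 * (real L)\<^sup>2) \<le> 1" by (simp add: divide_le_eq)
  qed simp
  then have "q * \<rho> ^ R \<le> 1 * exp (- real w)" using q rho by (intro mult_mono) auto
  moreover have "n * E \<le> n * T" using assms by simp
  then have "n * E \<le> 2 ^ w" using w(2) by linarith
  then have "real (L * (n * E)) \<le> real (L * 2 ^ w)" by (intro of_nat_mono mult_le_mono2)
  ultimately have "real (L * (n * E)) * (q * \<rho> ^ R) \<le> real (L * 2 ^ w) * (1 * exp (- real w))"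
    using q rho by (intro mult_mono[of "real (L * (n * E))"]) auto
  also have "\<dots> = real L * (2 ^ w * exp (- real w))" by simp
  also have "\<dots> \<le> real L * 1" by (intro mult_left_mono two_power_exp) simp
  also have "real L * 1 \<le> real X"
  proof -
    have "L \<le> L * (4 * L * w\<^sup>2)" using L_pos w(1) by simp
    also have "\<dots> = X" by (simp add: X_def power2_eq_square)
    finally show ?thesis by simp
  qed
  finally show ?thesis .
qed

context
  fixes g \<omega>
  assumes good: "good g \<omega>" and support: "\<And>z. \<omega> z \<Longrightarrow> z \<in> idx"
begin

lemma sampled_expert: "sampled \<omega> b r i e \<Longrightarrow> i \<in> {1..n}"
  using support[of "(e, b, r, i)"] by (simp add: sampled_def idx_def)

lemmas good_hit = good[unfolded good_def, THEN conjunct1, rule_format]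
lemmas good_few = good[unfolded good_def, THEN conjunct2, THEN conjunct1, rule_format]
lemmas good_raw = good[unfolded good_def, THEN conjunct2, THEN conjunct2, THEN conjunct1, rule_format]
lemmas good_visit = good[unfolded good_def, THEN conjunct2, THEN conjunct2, THEN conjunct2, rule_format]

lemma good_potential:
  assumes "b \<le> \<beta>" "b \<le> h" "(c + 1) * 2 ^ h \<le> D" "r \<le> R"
  shows "real (potential_of g \<omega> b r h c) * rate r \<le> real X"
  unfolding rate_def
proof (rule layer_potential_scaled[OF sampled_expert assms(2) TD_less[OF assms(3)] L_pos less_imp_le[OF q(1)] \<rho>_def
      potential_start _ assms(4)])
  show "(c + 1) * 2 ^ h \<le> T" using assms(3) D_less by linarith
  show "\<exists>u\<in>critical_of g \<omega> b r h c L. sampled \<omega> b r (fst u) (snd u)"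
    if "r < R" "\<rho> * real X < real (potential_of g \<omega> b r h c) * (q * \<rho> ^ (R - r))" for r
    using assms(1-3) less_imp_le[OF that(1)] by (rule good_hit) (use that(2) in \<open>simp only: rate_def\<close>)
qed

lemma card_survivors:
  assumes "b \<le> \<beta>" "b \<le> h" "(c + 1) * 2 ^ h \<le> D" "r \<le> R"
  shows "card {u \<in> uncovered_of g \<omega> b r h c. sampled \<omega> b r (fst u) (snd u)} \<le> cap"
proof -
  have "real (card (uncovered_of g \<omega> b r h c)) * rate r
      \<le> real (potential_of g \<omega> b r h c) * rate r"
    using card_uncovered_le[OF assms(2)] rate(1)[of r] by (intro mult_right_mono) (auto simp: less_imp_le)
  then have "real (card (uncovered_of g \<omega> b r h c)) * rate r \<le> real X"
    using good_potential[OF assms] by linarith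
  from good_few[OF assms this] show ?thesis by (rule less_imp_le)
qed

lemma card_pool:
  assumes "b \<le> \<beta>" "b \<le> h" "(c + 1) * 2 ^ h \<le> D" "r \<le> R"
  shows "finite (pool_of g \<omega> b r h c) \<and> card (pool_of g \<omega> b r h c) \<le> r * cap"
  using assms(4)
proof (induction r)
  case 0
  then show ?case by simp
next
  case (Suc r)
  then have IH: "finite (pool_of g \<omega> b r h c)" "card (pool_of g \<omega> b r h c) \<le> r * cap" by auto
  let ?S = "{u \<in> uncovered_of g \<omega> b r h c. sampled \<omega> b r (fst u) (snd u)}"
  have eq: "pool_of g \<omega> b (Suc r) h c = pool_of g \<omega> b r h c \<union> ?S"
    by (rule pool_Suc_eq[OF sampled_expert])
  have "card (pool_of g \<omega> b r h c \<union> ?S) \<le> card (pool_of g \<omega> b r h c) + card ?S"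
    by (rule card_Un_le)
  also have "\<dots> \<le> r * cap + cap"
    using IH(2) card_survivors[OF assms(1-3), of r] Suc.prems by (intro add_mono) auto
  finally show ?case unfolding eq using IH(1) finite_uncovered[of n T g b "sampled \<omega> b" r h c] by simp
qed

text \<open>The fresh samples of the current epoch, possibly about \<open>k\<close> many, are kept
  apart because they share one entry day. All older pairs fit into at most \<open>w\<close> finished
  blocks with at most \<open>cap\<close> survivors each. This is why \<open>live_entries\<close> is
  polylogarithmic while \<open>card_live\<close> is not.\<close>

lemma live_split:
  assumes "b \<le> \<beta>" "r \<le> R" "t \<le> D"
  shows "\<exists>S. finite S \<and> card S \<le> w * cap \<and>
    live_at g \<omega> b r t \<subseteq> (\<lambda>i. (i, t div 2 ^ b * 2 ^ b)) ` {i\<in>{1..n}. sampled \<omega> b r i (t div 2 ^ b * 2 ^ b)} \<union> S"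
proof -
  define H where "H = {h. h < w \<and> b \<le> h \<and> 1 \<le> t div 2 ^ h}"
  define U where "U = (\<lambda>h. {u \<in> uncovered_of g \<omega> b r h (t div 2 ^ h - 1). sampled \<omega> b r (fst u) (snd u)})"
  have "H \<subseteq> {..<w}" by (auto simp: H_def)
  then have H: "finite H" "card H \<le> w" using finite_subset card_mono[of "{..<w}" H] by auto
  have U: "card (U h) \<le> cap" if "h \<in> H" for h
  proof -
    have "t div 2 ^ h - 1 + 1 = t div 2 ^ h" using that by (simp add: H_def)
    moreover have "t div 2 ^ h * 2 ^ h \<le> D" using assms(3) div_times_less_eq_dividend order_trans by blast
    ultimately have "(t div 2 ^ h - 1 + 1) * 2 ^ h \<le> D" by (simp only:)
    moreover have "b \<le> h" using that by (simp add: H_def)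
    ultimately show ?thesis unfolding U_def using assms(1,2) by (intro card_survivors)
  qed
  have "card (\<Union>h\<in>H. U h) \<le> (\<Sum>h\<in>H. card (U h))" by (rule card_UN_le[OF H(1)])
  also have "\<dots> \<le> (\<Sum>h\<in>H. cap)" by (intro sum_mono U)
  also have "\<dots> \<le> w * cap" using H(2) by simp
  finally have c: "card (\<Union>h\<in>H. U h) \<le> w * cap" .
  have f: "finite (\<Union>h\<in>H. U h)" 
  proof (rule finite_UN_I[OF H(1)])
    show "finite (U h)" for h
      unfolding U_def by (rule finite_subset[OF _ finite_uncovered]) auto
  qed
  have "t < 2 ^ w" using assms(3) D_less T_le by linarith
  from live_subset[OF sampled_expert this]
  have "live_at g \<omega> b r t \<subseteq>
      {u. sampled \<omega> b r (fst u) (snd u) \<and> snd u = t div 2 ^ b * 2 ^ b} \<union> (\<Union>h\<in>H. U h)"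
    unfolding H_def U_def .
  also have "\<dots> \<subseteq> (\<lambda>i. (i, t div 2 ^ b * 2 ^ b)) ` {i\<in>{1..n}. sampled \<omega> b r i (t div 2 ^ b * 2 ^ b)} \<union> (\<Union>h\<in>H. U h)"
  proof (rule Un_mono[OF _ order_refl], rule subsetI)
    fix u assume "u \<in> {u. sampled \<omega> b r (fst u) (snd u) \<and> snd u = t div 2 ^ b * 2 ^ b}"
    then have u: "sampled \<omega> b r (fst u) (t div 2 ^ b * 2 ^ b)" "snd u = t div 2 ^ b * 2 ^ b" by auto
    show "u \<in> (\<lambda>i. (i, t div 2 ^ b * 2 ^ b)) ` {i\<in>{1..n}. sampled \<omega> b r i (t div 2 ^ b * 2 ^ b)}"
      by (rule image_eqI[of _ _ "fst u"]) (use u sampled_expert[OF u(1)] in \<open>auto simp: prod_eq_iff\<close>)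
  qed
  finally show ?thesis using c f by (intro exI[of _ "\<Union>h\<in>H. U h"] conjI)
qed

lemma card_live:
  assumes "b \<le> \<beta>" "r \<le> R" "t \<le> D"
  shows "finite (live_at g \<omega> b r t)" "card (live_at g \<omega> b r t) \<le> raw + w * cap"
proof -
  let ?x = "t div 2 ^ b * 2 ^ b"
  let ?A = "(\<lambda>i. (i, ?x)) ` {i\<in>{1..n}. sampled \<omega> b r i ?x}"
  obtain S where S: "finite S" "card S \<le> w * cap" "live_at g \<omega> b r t \<subseteq> ?A \<union> S"
    using live_split[OF assms] by blast
  have fin: "finite (?A \<union> S)" using S by simp
  then show "finite (live_at g \<omega> b r t)" by (rule finite_subset[OF S(3)])
  have "?x \<le> t" by simp
  then have "?x < T" using assms(3) D_less by linarith
  from good_raw[OF assms(1) this assms(2)] have "card {i\<in>{1..n}. sampled \<omega> b r i ?x} < raw" .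
  then have A: "card ?A \<le> raw" using card_image_le[of "{i\<in>{1..n}. sampled \<omega> b r i ?x}" "\<lambda>i. (i, ?x)"] by simp
  have "card (live_at g \<omega> b r t) \<le> card (?A \<union> S)" by (rule card_mono[OF fin S(3)])
  also have "\<dots> \<le> card ?A + card S" by (rule card_Un_le)
  finally show "card (live_at g \<omega> b r t) \<le> raw + w * cap" using A S(2) by simp
qed

lemma live_entries:
  assumes "b \<le> \<beta>" "t \<le> D"
  shows "card (\<Union>r\<in>{..R}. snd ` live_at g \<omega> b r t) \<le> 1 + (R + 1) * (w * cap)"
proof -
  let ?x = "t div 2 ^ b * 2 ^ b"
  have "\<forall>r\<in>{..R}. \<exists>S::(nat \<times> nat) set. finite S \<and> card S \<le> w * cap \<and> snd ` live_at g \<omega> b r t \<subseteq> insert ?x (snd ` S)"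
  proof
    fix r assume "r \<in> {..R}"
    then obtain S where S: "finite S" "card S \<le> w * cap"
      "live_at g \<omega> b r t \<subseteq> (\<lambda>i. (i, ?x)) ` {i\<in>{1..n}. sampled \<omega> b r i ?x} \<union> S"
      using live_split[of b r t] assms by auto
    from image_mono[OF S(3), of snd]
    have "snd ` live_at g \<omega> b r t
      \<subseteq> snd ` (\<lambda>i. (i, ?x)) ` {i\<in>{1..n}. sampled \<omega> b r i ?x} \<union> snd ` S" unfolding image_Un .
    also have "\<dots> \<subseteq> insert ?x (snd ` S)" unfolding image_image by auto
    finally have "snd ` live_at g \<omega> b r t \<subseteq> insert ?x (snd ` S)" .
    then show "\<exists>S::(nat \<times> nat) set. finite S \<and> card S \<le> w * cap \<and> snd ` live_at g \<omega> b r t \<subseteq> insert ?x (snd ` S)"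
      using S(1,2) by blast
  qed
  from bchoice[OF this] obtain S :: "nat \<Rightarrow> (nat \<times> nat) set" where S: "\<forall>r\<in>{..R}. finite (S r) \<and> card (S r) \<le> w * cap \<and>
      snd ` live_at g \<omega> b r t \<subseteq> insert ?x (snd ` S r)" ..
  have "(\<Union>r\<in>{..R}. snd ` live_at g \<omega> b r t) \<subseteq> insert ?x (\<Union>r\<in>{..R}. snd ` S r)"
  proof (rule UN_least)
    fix r assume r: "r \<in> {..R}"
    then have "snd ` live_at g \<omega> b r t \<subseteq> insert ?x (snd ` S r)" using S by simp
    also have "\<dots> \<subseteq> insert ?x (\<Union>r\<in>{..R}. snd ` S r)" using r by auto
    finally show "snd ` live_at g \<omega> b r t \<subseteq> insert ?x (\<Union>r\<in>{..R}. snd ` S r)" .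
  qed
  then have "card (\<Union>r\<in>{..R}. snd ` live_at g \<omega> b r t) \<le> card (insert ?x (\<Union>r\<in>{..R}. snd ` S r))"
    using S by (intro card_mono) auto
  also have "\<dots> \<le> 1 + card (\<Union>r\<in>{..R}. snd ` S r)" using S by (simp add: card_insert_if)
  also have "card (\<Union>r\<in>{..R}. snd ` S r) \<le> (\<Sum>r\<in>{..R}. card (snd ` S r))" by (rule card_UN_le) simp
  also have "\<dots> \<le> (\<Sum>r\<in>{..R}. w * cap)"
    using S by (intro sum_mono order_trans[OF card_image_le]) auto
  finally show ?thesis by simp
qed

lemma good_comparator:
  assumes "i \<in> {1..n}"
  shows "\<exists>\<sigma>. follows T g \<beta> R (sampled \<omega>) \<sigma> 0 D \<and>
      sched_cost T g \<sigma> 0 D \<le> cumloss g i 0 D + T * (D div 2 ^ \<beta> + visits) \<and>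
      card (changes \<sigma> 0 D) \<le> (D div 2 ^ \<beta> + visits) * (R * cap + 1) + 1"
proof (rule comparator_exists)
  show "finite (pool_of g \<omega> b R h c) \<and> card (pool_of g \<omega> b R h c) \<le> R * cap"
    if "b \<le> \<beta>" "b \<le> h" "(c + 1) * 2 ^ h \<le> D" for b h c
    using card_pool[OF that, of R] by simp
  show "\<exists>(b, x)\<in>early_visits T g \<beta> R (sampled \<omega>) D i visits. sampled \<omega> b R i x"
    if "visits \<le> card (early_visits T g \<beta> R (sampled \<omega>) D i visits)"
    using assms that by (rule good_visit)
  have "0 < real n * real (w\<^sup>2) / real k" using n_pos w(1) k(1) by simp
  then show "0 < visits" by (simp add: visits_def)
qed

end

section \<open>The tables held in memory and their transitions\<close>

definition "live_cap = (w + 1) * ((R + 1) * (raw + w * cap))"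
definition "entry_cap = (w + 1) * (1 + (R + 1) * (w * cap))"
definition "slots = live_cap + 1"
text \<open>Up to logarithms, \<open>\<eta>\<close> balances \<open>n / k\<close> switches against
  \<open>T * \<eta>\<^sup>2\<close>. Setting \<open>\<mu> = \<eta>\<^sup>2 / 2\<close> makes the
  daily cost of sharing equal to the quadratic term.\<close>

definition "\<eta> = sqrt (real n / (real k * real T))"
definition "\<mu> = real n / (2 * (real k * real T))"
text \<open>With this resolution the uniform share \<open>grid * \<mu> / slots\<close> equals
  \<open>2 * n\<close>, comfortably above the 2 units that rounding requires.\<close>

definition "grid = 4 * slots * k * T"

definition live_table :: "(nat \<Rightarrow> nat \<Rightarrow> nat) \<Rightarrow> (nat \<times> nat \<times> nat \<times> nat \<Rightarrow> bool) \<Rightarrow> nat \<Rightarrow> (nat \<times> nat \<times> nat \<times> nat) set" where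
  "live_table g \<omega> t = {(b, r, i, e). b \<le> \<beta> \<and> r \<le> R \<and> (i, e) \<in> live_at g \<omega> b r t}"

text \<open>Exactly the tails that \<open>cover_cost_determined\<close> reads: from the entry day
  \<open>c\<close> of some stored pair, for experts that entered at \<open>e \<le> c\<close>, within
  one level.\<close>

definition loss_table :: "(nat \<Rightarrow> nat \<Rightarrow> nat) \<Rightarrow> (nat \<times> nat \<times> nat \<times> nat \<Rightarrow> bool) \<Rightarrow> nat \<Rightarrow> (nat \<times> nat \<times> nat \<times> nat) set" where
  "loss_table g \<omega> t = {(b, i, c, v). v = cumloss g i c t \<and>
     (\<exists>r e r' i'. (b, r, i, e) \<in> live_table g \<omega> t \<and> (b, r', i', c) \<in> live_table g \<omega> t \<and> e \<le> c)}"

text \<open>Expert 1 is always included, so that there is an expert to draw even when nothing is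
  stored.\<close>

definition active :: "(nat \<Rightarrow> nat \<Rightarrow> nat) \<Rightarrow> (nat \<times> nat \<times> nat \<times> nat \<Rightarrow> bool) \<Rightarrow> nat \<Rightarrow> nat set" where
  "active g \<omega> t = insert 1 ((\<lambda>(b, r, i, e). i) ` live_table g \<omega> t)"

definition weight :: "(nat \<Rightarrow> nat \<Rightarrow> nat) \<Rightarrow> (nat \<times> nat \<times> nat \<times> nat \<Rightarrow> bool) \<Rightarrow> nat \<Rightarrow> nat \<Rightarrow> nat" where
  "weight g \<omega> t = share_weight \<eta> \<mu> T slots grid (active g \<omega>) g t"

definition weight_table :: "(nat \<Rightarrow> nat \<Rightarrow> nat) \<Rightarrow> (nat \<times> nat \<times> nat \<times> nat \<Rightarrow> bool) \<Rightarrow> nat \<Rightarrow> (nat \<times> nat) set" where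
  "weight_table g \<omega> t = (\<lambda>a. (a, weight g \<omega> t a)) ` active g \<omega> t"

definition state where
  "state g \<omega> t = (t, live_table g \<omega> t, loss_table g \<omega> t, weight_table g \<omega> t)"

lemma live_Suc_iff:
  "u \<in> live N g b sm r (Suc t) \<longleftrightarrow>
     snd u = Suc t \<and> sm r (fst u) (Suc t) \<and> 2 ^ b dvd Suc t \<or>
     u \<in> live N g b sm r t \<and> (\<forall>h. b \<le> h \<longrightarrow> block_end h (snd u) = Suc t \<longrightarrow> beats N g (pool N g b sm r) h u)"
  (is "?l \<longleftrightarrow> ?a \<or> ?b")
proof
  assume l: ?l
  show "?a \<or> ?b"
  proof (cases "snd u = Suc t")
    case True
    then show ?thesis using l by (auto simp: live_def)
  next
    case False
    then show ?thesis using l by (auto simp: live_def)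
  qed
next
  assume "?a \<or> ?b"
  then show ?l
  proof
    assume a: ?a
    have "\<not> block_end h (snd u) \<le> Suc t" for h using block_end_greater[of "snd u" h] a by simp
    then show ?l using a by (auto simp: live_def)
  next
    assume ?b
    then show ?l by (auto simp: live_def le_Suc_eq)
  qed
qed

lemma pool_Suc_iff:
  assumes "b \<le> h" "(c + 1) * 2 ^ h = Suc t"
  shows "u \<in> pool N g b sm (Suc r) h c \<longleftrightarrow> u \<in> pool N g b sm r h c \<or>
     u \<in> live N g b sm r t \<and> snd u div 2 ^ h = c \<and>
       (\<forall>h'. b \<le> h' \<longrightarrow> h' \<le> h \<longrightarrow> block_end h' (snd u) = Suc t \<longrightarrow> beats N g (pool N g b sm r) h' u)"
proof -
  have "(sm r (fst u) (snd u) \<and> 2 ^ b dvd snd u \<and> (\<forall>h'. b \<le> h' \<longrightarrow> h' \<le> h \<longrightarrow> beats N g (pool N g b sm r) h' u)) \<longleftrightarrow>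
     u \<in> live N g b sm r t \<and>
       (\<forall>h'. b \<le> h' \<longrightarrow> h' \<le> h \<longrightarrow> block_end h' (snd u) = Suc t \<longrightarrow> beats N g (pool N g b sm r) h' u)"
    if c: "snd u div 2 ^ h = c"
  proof -
    have E: "block_end h (snd u) = Suc t" using block_end_eq[OF c] assms(2) by simp
    have le: "snd u \<le> t" using block_end_greater[of "snd u" h] E by simp
    have 1: "h' \<le> h" if "block_end h' (snd u) \<le> t" for h'
    proof (rule ccontr)
      assume "\<not> h' \<le> h"
      then have "block_end h (snd u) \<le> block_end h' (snd u)" by (intro block_end_mono) simp
      then show False using that E by simp
    qed
    have 2: "block_end h' (snd u) \<le> t \<or> block_end h' (snd u) = Suc t" if "h' \<le> h" for h'
      using block_end_mono[OF that, of "snd u"] E by auto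
    show ?thesis using le 1 2 unfolding live_def by blast
  qed
  then show ?thesis by auto
qed

text \<open>The pool of a block ending at \<open>Suc t\<close> consists of pairs of lower layers
  that are live on day \<open>t\<close>. Hence every tail that the test reads is covered by the
  agreement of the tables.\<close>

lemma beats_agree:
  assumes "b \<le> h" "r \<le> R" and E: "block_end h (snd u) = Suc t" and u: "u \<in> live_at g \<omega> b r t"
    and pool: "pool_of g \<omega> b r h (snd u div 2 ^ h) = pool_of g' \<omega>' b r h (snd u div 2 ^ h)"
    and table: "\<And>r i e r' i' c. r \<le> R \<Longrightarrow> r' \<le> R \<Longrightarrow> (i, e) \<in> live_at g \<omega> b r t \<Longrightarrow>
      (i', c) \<in> live_at g \<omega> b r' t \<Longrightarrow> e \<le> c \<Longrightarrow> cumloss g i c (Suc t) = cumloss g' i c (Suc t)"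
  shows "beats T g (pool_of g \<omega> b r) h u = beats T g' (pool_of g' \<omega>' b r) h u"
proof -
  let ?F = "pool_of g \<omega> b r h (snd u div 2 ^ h)"
  have F: "\<exists>r'<r. v \<in> live_at g \<omega> b r' t" if "v \<in> ?F" for v
  proof (rule live_of_pool[OF that \<open>b \<le> h\<close>])
    have "snd v < block_end h (snd u)"
      using block_end_greater[of "snd v" h] pool_block[OF that] by (simp add: block_end_def)
    then show "snd v \<le> t" using E by simp
    show "t < (snd u div 2 ^ h + 1) * 2 ^ h" using E by (simp add: block_end_def)
  qed
  have u': "(fst u, snd u) \<in> live_at g \<omega> b r t" using u by simp
  have "cumloss g (fst u) (snd u) (Suc t) = cumloss g' (fst u) (snd u) (Suc t)"
    by (rule table[OF assms(2,2) u' u' order_refl])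
  moreover have "cover_cost T g ?F (snd u) (Suc t) = cover_cost T g' ?F (snd u) (Suc t)"
  proof (rule cover_cost_determined)
    show "snd u \<le> Suc t" using u by (simp add: live_def)
    fix j e c assume j: "(j, e) \<in> ?F" and c: "c \<in> insert (snd u) (snd ` ?F)" "e \<le> c"
    obtain r' where r': "r' < r" "(j, e) \<in> live_at g \<omega> b r' t" using F[OF j] by blast
    have "\<exists>r''\<le>R. \<exists>i'. (i', c) \<in> live_at g \<omega> b r'' t"
    proof (cases "c = snd u")
      case True
      then show ?thesis using u' assms(2) by blast
    next
      case False
      then obtain v where v: "v \<in> ?F" "c = snd v" using c by auto
      then obtain r'' where "r'' < r" "v \<in> live_at g \<omega> b r'' t" using F by blast
      moreover have "v = (fst v, c)" using v(2) by simp
      ultimately show ?thesis using assms(2) by (metis less_imp_le order_trans)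
    qed
    then show "cumloss g j c (Suc t) = cumloss g' j c (Suc t)"
      using table[of r' _ j e] r' assms(2) c(2) by (meson less_imp_le less_le_trans)
  qed
  ultimately show ?thesis unfolding beats_def E pool[symmetric] by simp
qed

text \<open>The state is defined from the whole history, but it evolves as a function of itself, the
  fresh coins and the new losses. Tests due at \<open>Suc t\<close> can be decided layer by layer,
  since each layer is tested against lower layers only.\<close>

lemma state_step:
  assumes st: "state g \<omega> t = state g' \<omega>' t"
    and fresh: "\<And>y. \<omega> (Suc t, y) = \<omega>' (Suc t, y)" and gt: "g t = g' t"
  shows "state g \<omega> (Suc t) = state g' \<omega>' (Suc t)"
proof -
  have lv: "live_table g \<omega> t = live_table g' \<omega>' t" and ls: "loss_table g \<omega> t = loss_table g' \<omega>' t"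
    and wt: "weight_table g \<omega> t = weight_table g' \<omega>' t" using st by (auto simp: state_def)
  have live_eq: "live_at g \<omega> b r t = live_at g' \<omega>' b r t" if "b \<le> \<beta>" "r \<le> R" for b r
    using lv that unfolding live_table_def set_eq_iff by auto
  have cum: "cumloss g i c t = cumloss g' i c t"
    if "(b, r, i, e) \<in> live_table g \<omega> t" "(b, r', i', c) \<in> live_table g \<omega> t" "e \<le> c" for b r i e r' i' c
  proof -
    have "(b, i, c, cumloss g i c t) \<in> loss_table g \<omega> t" using that by (auto simp: loss_table_def)
    then have "(b, i, c, cumloss g i c t) \<in> loss_table g' \<omega>' t" using ls by simp
    then show ?thesis by (simp add: loss_table_def)
  qed
  have cumS: "cumloss g i c (Suc t) = cumloss g' i c (Suc t)"
    if "(b, r, i, e) \<in> live_table g \<omega> t" "(b, r', i', c) \<in> live_table g \<omega> t" "e \<le> c" for b r i e r' i' c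
  proof -
    have "c \<le> t" using that(2) by (auto simp: live_table_def live_def)
    then show ?thesis using cum[OF that] gt by (simp add: cumloss_def)
  qed
  have table: "cumloss g i c (Suc t) = cumloss g' i c (Suc t)"
    if "b \<le> \<beta>" "r \<le> R" "r' \<le> R" "(i, e) \<in> live_at g \<omega> b r t"
      "(i', c) \<in> live_at g \<omega> b r' t" "e \<le> c" for b r i e r' i' c
    using that by (intro cumS[of b r i e r' i' c]) (auto simp: live_table_def)
  have pool_eq: "pool_of g \<omega> b r h c = pool_of g' \<omega>' b r h c"
    if "b \<le> \<beta>" "b \<le> h" "(c + 1) * 2 ^ h = Suc t" "r \<le> R" for b r h c
    using that(2-4)
  proof (induction r arbitrary: h c)
    case 0
    then show ?case by simp
  next
    case (Suc r)
    have r: "r \<le> R" using Suc.prems by simp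
    have be: "beats T g (pool_of g \<omega> b r) h' u = beats T g' (pool_of g' \<omega>' b r) h' u"
      if "u \<in> live_at g \<omega> b r t" "b \<le> h'" "block_end h' (snd u) = Suc t" for h' u
      using that(2) r that(3,1)
    proof (rule beats_agree)
      show "pool_of g \<omega> b r h' (snd u div 2 ^ h') = pool_of g' \<omega>' b r h' (snd u div 2 ^ h')"
        using that r by (intro Suc.IH) (auto simp: block_end_def)
    qed (rule table[OF \<open>b \<le> \<beta>\<close>])
    show ?case
      using Suc.IH[OF Suc.prems(1,2) r] be live_eq[OF \<open>b \<le> \<beta>\<close> r]
      by (intro set_eqI) (simp only: pool_Suc_iff[OF Suc.prems(1,2)], blast)
  qed
  have live_S: "live_at g \<omega> b r (Suc t) = live_at g' \<omega>' b r (Suc t)"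
    if "b \<le> \<beta>" "r \<le> R" for b r
  proof -
    have be: "beats T g (pool_of g \<omega> b r) h u = beats T g' (pool_of g' \<omega>' b r) h u"
      if "u \<in> live_at g \<omega> b r t" "b \<le> h" "block_end h (snd u) = Suc t" for h u
      using that(2) \<open>r \<le> R\<close> that(3,1)
    proof (rule beats_agree)
      show "pool_of g \<omega> b r h (snd u div 2 ^ h) = pool_of g' \<omega>' b r h (snd u div 2 ^ h)"
        using that \<open>r \<le> R\<close> \<open>b \<le> \<beta>\<close> by (intro pool_eq) (auto simp: block_end_def)
    qed (rule table[OF \<open>b \<le> \<beta>\<close>])
    have "sampled \<omega> b r i (Suc t) = sampled \<omega>' b r i (Suc t)" for i by (simp add: sampled_def fresh)
    then show ?thesis
      using be live_eq[OF that] by (intro set_eqI) (simp only: live_Suc_iff, blast)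
  qed
  have lvS: "live_table g \<omega> (Suc t) = live_table g' \<omega>' (Suc t)"
    using live_S unfolding live_table_def by blast
  have old: "(b, r, i, e) \<in> live_table g \<omega> t" if "(b, r, i, e) \<in> live_table g \<omega> (Suc t)" "e \<le> t" for b r i e
    using that live_Suc_iff[of "(i, e)" T g b "sampled \<omega> b" r t] by (auto simp: live_table_def)
  have cum': "cumloss g i c (Suc t) = cumloss g' i c (Suc t)"
    if "(b, r, i, e) \<in> live_table g \<omega> (Suc t)" "(b, r', i', c) \<in> live_table g \<omega> (Suc t)" "e \<le> c" for b r i e r' i' c
  proof (cases "c \<le> t")
    case True
    then show ?thesis using cumS old that by (meson order_trans)
  next
    \<comment> \<open>A tail that starts on \<open>Suc t\<close> is still empty.\<close>
    case False
    then show ?thesis by (simp add: cumloss_def)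
  qed
  have "v = cumloss g i c (Suc t) \<and>
       (\<exists>r e r' i'. (b, r, i, e) \<in> live_table g \<omega> (Suc t) \<and> (b, r', i', c) \<in> live_table g \<omega> (Suc t) \<and> e \<le> c)
     \<longleftrightarrow> v = cumloss g' i c (Suc t) \<and>
       (\<exists>r e r' i'. (b, r, i, e) \<in> live_table g \<omega> (Suc t) \<and> (b, r', i', c) \<in> live_table g \<omega> (Suc t) \<and> e \<le> c)"
    for b i c v
    using cum' by metis
  then have lsS: "loss_table g \<omega> (Suc t) = loss_table g' \<omega>' (Suc t)"
    unfolding loss_table_def lvS[symmetric] by (simp only:)
  have act: "active g \<omega> t = active g' \<omega>' t" using lv by (simp add: active_def)
  have actS: "active g \<omega> (Suc t) = active g' \<omega>' (Suc t)" using lvS by (simp add: active_def)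
  have "weight g \<omega> t a = weight g' \<omega>' t a" if "a \<in> active g' \<omega>' t" for a
  proof -
    have "(a, weight g' \<omega>' t a) \<in> weight_table g \<omega> t" using that wt by (simp add: weight_table_def)
    then show ?thesis by (auto simp: weight_table_def)
  qed
  then have "weight g \<omega> (Suc t) = weight g' \<omega>' (Suc t)"
    unfolding weight_def share_weight.simps by (intro share_update_cong act gt)
  then have "weight_table g \<omega> (Suc t) = weight_table g' \<omega>' (Suc t)"
    using actS by (simp add: weight_table_def)
  then show ?thesis using lvS lsS by (simp add: state_def)
qed

lemma live_determined:
  assumes "\<And>d. d < t \<Longrightarrow> g d = g' d" "\<And>x y. x \<le> t \<Longrightarrow> \<omega> (x, y) = \<omega>' (x, y)"
  shows "live_at g \<omega> b r t = live_at g' \<omega>' b r t"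
proof -
  have be: "beats T g (pool_of g \<omega> b r) h u = beats T g' (pool_of g' \<omega>' b r) h u"
    if le: "block_end h (snd u) \<le> t" for h u
  proof -
    have cl: "cumloss g j s (block_end h (snd u)) = cumloss g' j s (block_end h (snd u))" for j s
      unfolding cumloss_def by (rule sum.cong) (use assms(1) le in auto)
    have "cover_cost T g F (snd u) (block_end h (snd u)) = cover_cost T g' F (snd u) (block_end h (snd u))" for F
      using cl block_end_greater by (intro cover_cost_determined) (auto intro: less_imp_le)
    moreover have "pool_of g \<omega> b r h (snd u div 2 ^ h) = pool_of g' \<omega>' b r h (snd u div 2 ^ h)"
      using assms le unfolding block_end_def by (intro pool_determined) (auto simp: sampled_def)
    ultimately show ?thesis unfolding beats_def cl by simp
  qed
  have "sampled \<omega> b r i e = sampled \<omega>' b r i e" if "e \<le> t" for i e using assms(2)[OF that] by (simp add: sampled_def)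
  then show ?thesis using be unfolding live_def by blast
qed

text \<open>Causality: the state of day \<open>t\<close> sees losses before day \<open>t\<close> and
  coins up to day \<open>t\<close>, so it is available when the pick of that day is made.\<close>

lemma state_determined:
  assumes "\<And>d. d < t \<Longrightarrow> g d = g' d" "\<And>x y. x \<le> t \<Longrightarrow> \<omega> (x, y) = \<omega>' (x, y)"
  shows "state g \<omega> t = state g' \<omega>' t"
proof -
  have lv: "live_table g \<omega> s = live_table g' \<omega>' s" if "s \<le> t" for s
  proof -
    have "live_at g \<omega> b r s = live_at g' \<omega>' b r s" for b r
      by (rule live_determined) (use assms that in auto)
    then show ?thesis by (simp add: live_table_def)
  qed
  have act: "active g \<omega> s = active g' \<omega>' s" if "s \<le> t" for s using lv[OF that] by (simp add: active_def)
  have "weight g \<omega> s = weight g' \<omega>' s" if "s \<le> t" for s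
    using that
  proof (induction s)
    case 0
    then show ?case by (simp add: weight_def)
  next
    case (Suc s)
    then show ?case using act[of s] assms(1)[of s] by (simp add: weight_def)
  qed
  moreover have "cumloss g i c t = cumloss g' i c t" for i c
    unfolding cumloss_def by (rule sum.cong) (use assms(1) in auto)
  ultimately show ?thesis using lv act by (simp add: state_def loss_table_def weight_table_def)
qed

definition first_state where
  "first_state \<xi> = state (\<lambda>_ _. 0) (\<lambda>z. fst z = 0 \<and> \<xi> (snd z)) 0"

text \<open>\<open>next_state\<close> continues an arbitrary history with the given state; by \<open>state_step\<close> the choice of
  the history is irrelevant.\<close>

definition next_state where
  "next_state s \<xi> l = (let (t, \<omega>, g) = (SOME (t, \<omega>, g). state g \<omega> t = s)
     in state (g(t := l)) (\<lambda>z. if fst z = Suc t then \<xi> (snd z) else \<omega> z) (Suc t))"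

lemma first_state: "first_state (\<lambda>y. \<omega> (0, y)) = state g \<omega> 0"
  unfolding first_state_def by (rule state_determined) auto

lemma next_state: "next_state (state g \<omega> t) (\<lambda>y. \<omega> (Suc t, y)) (g t) = state g \<omega> (Suc t)"
proof -
  obtain t0 \<omega>0 g0 where c: "(SOME (t', \<omega>', g'). state g' \<omega>' t' = state g \<omega> t) = (t0, \<omega>0, g0)"
    by (metis prod_cases3)
  have "(\<lambda>(t', \<omega>', g'). state g' \<omega>' t' = state g \<omega> t) (t0, \<omega>0, g0)"
    unfolding c[symmetric] by (rule someI[of _ "(t, \<omega>, g)"]) simp
  then have eq: "state g0 \<omega>0 t0 = state g \<omega> t" by simp
  then have t: "t0 = t" by (simp add: state_def)
  define g1 where "g1 = g0(t := g t)"
  define \<omega>1 where "\<omega>1 = (\<lambda>z. if fst z = Suc t then \<omega> (Suc t, snd z) else \<omega>0 z)"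
  \<comment> \<open>The overwritten loss of day \<open>t\<close> and coins of day
    \<open>Suc t\<close> are not yet visible in the state of day \<open>t\<close>.\<close>
  have "state g1 \<omega>1 t = state g0 \<omega>0 t" by (rule state_determined) (auto simp: g1_def \<omega>1_def)
  then have "state g1 \<omega>1 t = state g \<omega> t" using eq t by simp
  then have "state g1 \<omega>1 (Suc t) = state g \<omega> (Suc t)"
    by (rule state_step) (auto simp: g1_def \<omega>1_def)
  moreover have "next_state (state g \<omega> t) (\<lambda>y. \<omega> (Suc t, y)) (g t) = state g1 \<omega>1 (Suc t)"
    unfolding next_state_def c by (simp add: g1_def \<omega>1_def t)
  ultimately show ?thesis by simp
qed

end

subsection \<open>Measurability\<close>

text \<open>The algorithm sees losses only through rounding, which has finite range on the space of
  losses; every kernel of the algorithm factors through it.\<close>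

lemma finite_range_measurable:
  assumes "finite (r ` space M)" and "\<And>a. a \<in> r ` space M \<Longrightarrow> {x \<in> space M. r x = a} \<in> sets M"
    and "\<And>x. x \<in> space M \<Longrightarrow> h (r x) \<in> space N"
  shows "(\<lambda>x. h (r x)) \<in> measurable M N"
proof -
  have r: "r \<in> measurable M (count_space (r ` space M))"
    unfolding measurable_count_space_eq2[OF assms(1)]
  proof (intro conjI ballI)
    fix a assume "a \<in> r ` space M"
    moreover have "r -` {a} \<inter> space M = {x \<in> space M. r x = a}" by auto
    ultimately show "r -` {a} \<inter> space M \<in> sets M" using assms(2) by simp
  qed simp
  have h: "h \<in> measurable (count_space (r ` space M)) N" using assms(3) by auto
  show ?thesis by (rule measurable_compose[OF r h])
qed

text \<open>The default 0 outside the experts places all values in the finite set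
  \<open>PiE_dflt {1..n} 0 (\<lambda>_. {..N})\<close>.\<close>

definition round_loss :: "nat \<Rightarrow> nat \<Rightarrow> (nat \<Rightarrow> real) \<Rightarrow> nat \<Rightarrow> nat" where
  "round_loss n N v i = (if i \<in> {1..n} then nat \<lfloor>real N * v i\<rfloor> else 0)"

lemma loss_vector_coord: "v \<in> space (loss_vectors n) \<Longrightarrow> i \<in> {1..n} \<Longrightarrow> 0 \<le> v i \<and> v i \<le> 1"
  by (auto simp: loss_vectors_def space_PiM PiE_def Pi_def space_restrict_space)

lemma loss_seq_vector: "l \<in> space (loss_seqs n T) \<Longrightarrow> t \<in> {1..T} \<Longrightarrow> l t \<in> space (loss_vectors n)"
  by (auto simp: loss_seqs_def space_PiM PiE_def Pi_def)

lemma round_loss_bounds: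
  assumes "v \<in> space (loss_vectors n)" "0 < N"
  shows "round_loss n N v i \<le> N"
    and "i \<in> {1..n} \<Longrightarrow> real (round_loss n N v i) / real N \<le> v i"
    and "i \<in> {1..n} \<Longrightarrow> v i \<le> real (round_loss n N v i) / real N + 1 / real N"
proof -
  have a: "0 \<le> real N * v i \<and> real N * v i \<le> real N" if "i \<in> {1..n}"
    using loss_vector_coord[OF assms(1) that] by (auto intro: mult_left_le)
  show "round_loss n N v i \<le> N"
    using a unfolding round_loss_def by (auto simp: nat_le_iff floor_le_iff)
  assume i: "i \<in> {1..n}"
  have r: "real (round_loss n N v i) = of_int \<lfloor>real N * v i\<rfloor>"
    using a[OF i] i by (simp add: round_loss_def)
  show "real (round_loss n N v i) / real N \<le> v i"
    using assms(2) unfolding r by (simp add: pos_divide_le_eq mult.commute)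
  have "real N * v i \<le> real (round_loss n N v i) + 1" unfolding r by linarith
  then show "v i \<le> real (round_loss n N v i) / real N + 1 / real N"
    using assms(2) by (simp add: add_divide_distrib[symmetric] pos_le_divide_eq mult.commute)
qed

lemma round_loss_finite:
  assumes "0 < N"
  shows "finite (round_loss n N ` space (loss_vectors n))"
proof (rule finite_subset)
  show "round_loss n N ` space (loss_vectors n) \<subseteq> PiE_dflt {1..n} 0 (\<lambda>_. {..N})"
    using round_loss_bounds(1)[OF _ assms] by (auto simp: PiE_dflt_def) (auto simp: round_loss_def)
qed (rule finite_PiE_dflt, auto)

lemma coord_measurable [measurable]: "i \<in> {1..n} \<Longrightarrow> (\<lambda>v. v i) \<in> borel_measurable (loss_vectors n)"
proof -
  assume "i \<in> {1..n}"
  then have "(\<lambda>v. v i) \<in> measurable (loss_vectors n) (restrict_space borel {0..1})"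
    unfolding loss_vectors_def by (rule measurable_component_singleton)
  then show ?thesis by (simp add: measurable_restrict_space2_iff)
qed

lemma round_loss_sets: "{v \<in> space (loss_vectors n). round_loss n N v = a} \<in> sets (loss_vectors n)"
proof -
  have coord: "{v \<in> space (loss_vectors n). nat \<lfloor>real N * v i\<rfloor> = a i} \<in> sets (loss_vectors n)" if "i \<in> {1..n}" for i
    using that by measurable
  have "{v \<in> space (loss_vectors n). round_loss n N v = a} =
    (if \<forall>i. i \<notin> {1..n} \<longrightarrow> a i = 0 then {v \<in> space (loss_vectors n). \<forall>i\<in>{1..n}. nat \<lfloor>real N * v i\<rfloor> = a i} else {})"
    by (auto simp: round_loss_def fun_eq_iff)
  also have "\<dots> \<in> sets (loss_vectors n)"
    using coord by (auto intro!: sets.sets_Collect_finite_All)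
  finally show ?thesis .
qed

lemma through_round_loss_measurable:
  assumes "0 < N" "\<And>a. h a \<in> space K"
  shows "(\<lambda>v. h (round_loss n N v)) \<in> measurable (loss_vectors n) K"
  by (rule finite_range_measurable[OF round_loss_finite[OF assms(1)]]) (use round_loss_sets assms(2) in auto)

definition round_losses :: "nat \<Rightarrow> nat \<Rightarrow> nat \<Rightarrow> (nat \<Rightarrow> nat \<Rightarrow> real) \<Rightarrow> nat \<Rightarrow> nat \<Rightarrow> nat" where
  "round_losses n N T l t = (if t \<in> {1..T} then round_loss n N (l t) else (\<lambda>_. 0))"

lemma through_round_losses_measurable:
  assumes N: "0 < N" and h: "\<And>a. h a \<in> space K"
  shows "(\<lambda>l. h (round_losses n N T l)) \<in> measurable (loss_seqs n T) K"
proof (rule finite_range_measurable[where r = "round_losses n N T"])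
  show "finite (round_losses n N T ` space (loss_seqs n T))"
  proof (rule finite_subset)
    show "round_losses n N T ` space (loss_seqs n T) \<subseteq>
        PiE_dflt {1..T} (\<lambda>_. 0) (\<lambda>_. round_loss n N ` space (loss_vectors n))"
      using loss_seq_vector by (auto simp: PiE_dflt_def round_losses_def)
  qed (rule finite_PiE_dflt, use round_loss_finite[OF N] in auto)
  fix a
  have comp: "(\<lambda>l. l t) \<in> measurable (loss_seqs n T) (loss_vectors n)" if "t \<in> {1..T}" for t
    unfolding loss_seqs_def using that by (rule measurable_component_singleton)
  have coord: "{l \<in> space (loss_seqs n T). round_loss n N (l t) = a t} \<in> sets (loss_seqs n T)" if "t \<in> {1..T}" for t
  proof -
    have "(\<lambda>l. l t) -` {v \<in> space (loss_vectors n). round_loss n N v = a t} \<inter> space (loss_seqs n T) \<in> sets (loss_seqs n T)"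
      by (rule measurable_sets[OF comp[OF that] round_loss_sets])
    also have "(\<lambda>l. l t) -` {v \<in> space (loss_vectors n). round_loss n N v = a t} \<inter> space (loss_seqs n T) =
        {l \<in> space (loss_seqs n T). round_loss n N (l t) = a t}"
      using loss_seq_vector that by blast
    finally show ?thesis .
  qed
  have "{l \<in> space (loss_seqs n T). round_losses n N T l = a} =
    (if \<forall>t. t \<notin> {1..T} \<longrightarrow> a t = (\<lambda>_. 0) then {l \<in> space (loss_seqs n T). \<forall>t\<in>{1..T}. round_loss n N (l t) = a t} else {})"
    unfolding round_losses_def fun_eq_iff[of "\<lambda>t. if t \<in> {1..T} then round_loss n N (l t) else (\<lambda>_. 0)" for l] by auto
  also have "\<dots> \<in> sets (loss_seqs n T)"
    using coord by (auto intro!: sets.sets_Collect_finite_All)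
  finally show "{l \<in> space (loss_seqs n T). round_losses n N T l = a} \<in> sets (loss_seqs n T)" .
qed (rule h)

lemma loss_measurable: "t \<in> {1..T} \<Longrightarrow> (\<lambda>l. l t i) \<in> borel_measurable (loss_seqs n T)"
proof (cases "i \<in> {1..n}")
  case True
  assume t: "t \<in> {1..T}"
  have "(\<lambda>l. l t) \<in> measurable (loss_seqs n T) (loss_vectors n)"
    unfolding loss_seqs_def using t by (rule measurable_component_singleton)
  then show ?thesis by (rule measurable_compose[OF _ coord_measurable[OF True]])
next
  case False
  assume t: "t \<in> {1..T}"
  \<comment> \<open>The event has to be measurable for all pick lists, even illegal ones; outside
    the experts a loss vector is constant by extensionality.\<close>
  have "l t i = undefined" if "l \<in> space (loss_seqs n T)" for l
    using loss_seq_vector[OF that t] False by (auto simp: loss_vectors_def space_PiM PiE_def extensional_def)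
  then show ?thesis by (subst measurable_cong[where g = "\<lambda>_. undefined"]) auto
qed

lemma sum_shift_one: "(\<Sum>t = 1..T. f t) = (\<Sum>s<T. f (Suc s))" for f :: "nat \<Rightarrow> real"
  by (simp add: sum.atLeast1_atMost_eq)

lemma regret_le_iff:
  assumes "1 \<le> n"
  shows "regret n T l is \<le> c \<longleftrightarrow> (\<forall>i\<in>{1..n}. (\<Sum>s<T. l (Suc s) (is ! s)) \<le> (\<Sum>s<T. l (Suc s) i) + c)"
proof -
  have "regret n T l is \<le> c \<longleftrightarrow>
      (\<Sum>t = 1..T. l t (is ! (t - 1))) - c \<le> (MIN i \<in> {1..n}. \<Sum>t = 1..T. l t i)"
    unfolding regret_def by linarith
  also have "\<dots> \<longleftrightarrow> (\<forall>i\<in>{1..n}. (\<Sum>t = 1..T. l t (is ! (t - 1))) - c \<le> (\<Sum>t = 1..T. l t i))"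
    using assms by (subst Min_ge_iff) auto
  also have "\<dots> \<longleftrightarrow> (\<forall>i\<in>{1..n}. (\<Sum>s<T. l (Suc s) (is ! s)) \<le> (\<Sum>s<T. l (Suc s) i) + c)"
    unfolding sum_shift_one by (simp add: diff_le_eq)
  finally show ?thesis .
qed

lemma regret_le_measurable:
  assumes "1 \<le> n"
  shows "Measurable.pred (loss_seqs n T \<Otimes>\<^sub>M count_space (UNIV :: (nat list \<times> memory) set))
     (\<lambda>(l, is, M). regret n T l is \<le> c)"
proof -
  have sum: "(\<lambda>l. \<Sum>s<T. l (Suc s) (f s)) \<in> borel_measurable (loss_seqs n T)" for f :: "nat \<Rightarrow> nat"
    by (intro borel_measurable_sum loss_measurable) simp
  have inner: "Measurable.pred (loss_seqs n T) (\<lambda>l. regret n T l is \<le> c)" for "is"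
  proof -
    have "Measurable.pred (loss_seqs n T)
      (\<lambda>l. (\<Sum>s<T. l (Suc s) (is ! s)) \<le> (\<Sum>s<T. l (Suc s) i) + c)" for i
      unfolding pred_def using sum[of "\<lambda>s. is ! s"] sum[of "\<lambda>_. i"]
      by (intro borel_measurable_le borel_measurable_add) auto
    then show ?thesis unfolding regret_le_iff[OF assms] by (intro pred_intros_finite) auto
  qed
  \<comment> \<open>There are countably many pairs of pick list and memory, so measurability in the
    losses for each single pair suffices.\<close>
  show ?thesis
    by (rule measurable_compose_countable'[where g = snd and I = UNIV and
          f = "\<lambda>\<omega> x. case (fst x, \<omega>) of (l, is, M) \<Rightarrow> regret n T l is \<le> c", simplified])
       (auto simp: split_beta intro: measurable_compose[OF measurable_fst inner])
qed

text \<open>\<open>play\<close> is a mixture over loss sequences, so a bound valid for every fixed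
  sequence survives integration against the adversary.\<close>

lemma play_prob_ge:
  assumes n: "1 \<le> n" and adv: "oblivious_adversary n T D"
    and kernel: "(\<lambda>l. measure_pmf (run A l T)) \<in> measurable (loss_seqs n T) (subprob_algebra (count_space UNIV))"
    and prob: "\<And>l. l \<in> space (loss_seqs n T) \<Longrightarrow>
      1 - \<delta> \<le> measure_pmf.prob (run A l T) {(is, M). regret n T l is \<le> c}"
  shows "1 - \<delta> \<le> \<P>((l, is, M) in play n T A D. regret n T l is \<le> c)"
proof -
  let ?N = "loss_seqs n T \<Otimes>\<^sub>M count_space (UNIV :: (nat list \<times> memory) set)"
  interpret D: prob_space D using adv by (simp add: oblivious_adversary_def)
  have sD: "sets D = sets (loss_seqs n T)" using adv by (simp add: oblivious_adversary_def)
  have spD: "space D = space (loss_seqs n T)" using sD by (rule sets_eq_imp_space_eq)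
  define K where "K = (\<lambda>l. distr (measure_pmf (run A l T)) ?N (\<lambda>\<omega>. (l, \<omega>)))"
  have "K \<in> measurable (loss_seqs n T) (subprob_algebra ?N)"
    unfolding K_def by (rule measurable_distr2[OF _ kernel]) simp
  then have K: "K \<in> measurable D (subprob_algebra ?N)" using measurable_cong_sets[OF sD refl] by blast
  define X where "X = {x \<in> space ?N. case x of (l, is, M) \<Rightarrow> regret n T l is \<le> c}"
  have X: "X \<in> sets ?N"
    unfolding X_def using regret_le_measurable[OF n, of T c] by (rule predE)
  have play: "play n T A D = D \<bind> K" unfolding play_def K_def ..
  have sp: "space (play n T A D) = space ?N"
    unfolding play by (rule space_bind[OF _ D.not_empty]) (use K in \<open>auto dest: sets_kernel\<close>)
  have em: "emeasure (play n T A D) X = (\<integral>\<^sup>+ l. emeasure (K l) X \<partial>D)"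
    unfolding play by (rule emeasure_bind[OF D.not_empty K X])
  have KX: "emeasure (K l) X = ennreal (measure_pmf.prob (run A l T) {(is, M). regret n T l is \<le> c})"
    if "l \<in> space D" for l
  proof -
    have l: "l \<in> space (loss_seqs n T)" using that spD by simp
    have "emeasure (K l) X = emeasure (measure_pmf (run A l T)) ((\<lambda>\<omega>. (l, \<omega>)) -` X \<inter> space (measure_pmf (run A l T)))"
      unfolding K_def by (rule emeasure_distr[OF _ X]) (use l in \<open>auto simp: space_pair_measure\<close>)
    also have "(\<lambda>\<omega>. (l, \<omega>)) -` X \<inter> space (measure_pmf (run A l T)) = {(is, M). regret n T l is \<le> c}"
      using l by (auto simp: X_def space_pair_measure)
    finally show ?thesis by (simp add: measure_pmf.emeasure_eq_measure)
  qed
  have "ennreal (1 - \<delta>) = (\<integral>\<^sup>+ l. ennreal (1 - \<delta>) \<partial>D)" by (simp add: D.emeasure_space_1)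
  also have "\<dots> \<le> (\<integral>\<^sup>+ l. emeasure (K l) X \<partial>D)"
    by (intro nn_integral_mono) (use KX prob spD in \<open>auto intro!: ennreal_leI\<close>)
  finally have lower: "ennreal (1 - \<delta>) \<le> emeasure (play n T A D) X" by (simp add: em)
  \<comment> \<open>Finiteness allows the bound on \<open>emeasure\<close> to be read as one on
    \<open>measure\<close>.\<close>
  have "(\<integral>\<^sup>+ l. emeasure (K l) X \<partial>D) \<le> (\<integral>\<^sup>+ l. 1 \<partial>D)"
    by (intro nn_integral_mono) (simp add: KX ennreal_le_1)
  then have "emeasure (play n T A D) X < \<top>"
    by (simp add: em D.emeasure_space_1) (meson ennreal_one_less_top le_less_trans)
  then have "emeasure (play n T A D) X = ennreal (measure (play n T A D) X)"
    by (intro emeasure_eq_ennreal_measure) simp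
  then have "1 - \<delta> \<le> measure (play n T A D) X"
    using lower by (simp add: ennreal_le_iff)
  then show ?thesis by (simp add: X_def sp case_prod_unfold)
qed

subsection \<open>The algorithm\<close>

text \<open>Enumerate the subset and pad with \<open>None\<close> to length \<open>m\<close>: lists
  of length \<open>m\<close> over one additional symbol map onto the subsets.\<close>

lemma card_bounded_subsets:
  assumes "finite \<Omega>"
  shows "finite {s. s \<subseteq> \<Omega> \<and> card s \<le> m}" "card {s. s \<subseteq> \<Omega> \<and> card s \<le> m} \<le> (card \<Omega> + 1) ^ m"
proof -
  define A where "A = insert None (Some ` \<Omega>)"
  have A: "finite A" "card A = card \<Omega> + 1"
    using assms by (auto simp: A_def card_insert_if card_image)
  define f :: "'a option list \<Rightarrow> 'a set" where "f = (\<lambda>xs. {x. Some x \<in> set xs})"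
  have sub: "{s. s \<subseteq> \<Omega> \<and> card s \<le> m} \<subseteq> f ` {xs. set xs \<subseteq> A \<and> length xs = m}"
  proof
    fix s assume "s \<in> {s. s \<subseteq> \<Omega> \<and> card s \<le> m}"
    then have s: "s \<subseteq> \<Omega>" "card s \<le> m" by auto
    obtain ys where ys: "set ys = s" "length ys = card s"
      using finite_distinct_list[OF finite_subset[OF s(1) assms]] distinct_card by metis
    let ?xs = "map Some ys @ replicate (m - length ys) None"
    have "?xs \<in> {xs. set xs \<subseteq> A \<and> length xs = m}" using s ys by (auto simp: A_def)
    moreover have "s = f ?xs" using ys by (auto simp: f_def)
    ultimately show "s \<in> f ` {xs. set xs \<subseteq> A \<and> length xs = m}" by blast
  qed
  have fin: "finite {xs. set xs \<subseteq> A \<and> length xs = m}" by (rule finite_lists_length_eq[OF A(1)])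
  show "finite {s. s \<subseteq> \<Omega> \<and> card s \<le> m}" by (rule finite_subset[OF sub finite_imageI[OF fin]])
  have "card {s. s \<subseteq> \<Omega> \<and> card s \<le> m} \<le> card {xs. set xs \<subseteq> A \<and> length xs = m}"
    using surj_card_le[OF fin sub] .
  also have "\<dots> = (card \<Omega> + 1) ^ m" using card_lists_length_eq[OF A(1)] A(2) by simp
  finally show "card {s. s \<subseteq> \<Omega> \<and> card s \<le> m} \<le> (card \<Omega> + 1) ^ m" .
qed

type_synonym table_state =
  "nat \<times> (nat \<times> nat \<times> nat \<times> nat) set \<times> (nat \<times> nat \<times> nat \<times> nat) set \<times> (nat \<times> nat) set"

text \<open>Integer weights are sampled exactly by a uniform point under their graph. The fallback 1
  keeps the pick legal for tables that no history produces.\<close>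

definition draw :: "nat \<Rightarrow> (nat \<times> nat) set \<Rightarrow> nat pmf" where
  "draw n Q = (let Z = {(a, j). \<exists>q. (a, q) \<in> Q \<and> j < q} in
     if finite Z \<and> Z \<noteq> {} \<and> fst ` Z \<subseteq> {1..n} then map_pmf fst (pmf_of_set Z) else return_pmf 1)"

lemma set_draw: "1 \<le> n \<Longrightarrow> set_pmf (draw n Q) \<subseteq> {1..n}"
  by (auto simp: draw_def Let_def)

lemma expectation_draw:
  fixes f :: "nat \<Rightarrow> real"
  assumes "finite A" "A \<noteq> {}" "A \<subseteq> {1..n}" "\<And>a. a \<in> A \<Longrightarrow> 0 < u a"
  shows "measure_pmf.expectation (draw n ((\<lambda>a. (a, u a)) ` A)) f = (\<Sum>a\<in>A. real (u a) * f a) / (\<Sum>a\<in>A. real (u a))"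
proof -
  define Z where "Z = Sigma A (\<lambda>a. {..<u a})"
  have Z: "{(a, j). \<exists>q. (a, q) \<in> (\<lambda>a. (a, u a)) ` A \<and> j < q} = Z" by (auto simp: Z_def)
  have fin: "finite Z" using assms(1) by (simp add: Z_def)
  obtain a where a: "a \<in> A" using assms(2) by blast
  then have "(a, 0) \<in> Z" using assms(4) by (simp add: Z_def)
  then have ne: "Z \<noteq> {}" by blast
  have "fst ` Z \<subseteq> {1..n}" using assms(3) by (auto simp: Z_def)
  then have "draw n ((\<lambda>a. (a, u a)) ` A) = map_pmf fst (pmf_of_set Z)"
    unfolding draw_def Z using fin ne by simp
  then have "measure_pmf.expectation (draw n ((\<lambda>a. (a, u a)) ` A)) f = (\<Sum>z\<in>Z. f (fst z)) / real (card Z)"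
    using fin ne by (simp add: integral_pmf_of_set)
  also have "(\<Sum>z\<in>Z. f (fst z)) = (\<Sum>a\<in>A. \<Sum>j\<in>{..<u a}. f a)"
    unfolding Z_def using assms(1) by (subst sum.Sigma) (auto simp: split_beta)
  also have "\<dots> = (\<Sum>a\<in>A. real (u a) * f a)" by simp
  also have "real (card Z) = (\<Sum>a\<in>A. real (u a))" unfolding Z_def using assms(1) by simp
  finally show ?thesis .
qed

text \<open>In \<open>capacity\<close> each table entry is charged 10 words; one more word pays for
  the day and another for the additional state \<open>None\<close>.\<close>

locale word_parameters = parameters +
  fixes S :: nat
  assumes w_eq: "w = ceillog2 (n * T)" and S_le: "S \<le> n"
    and capacity: "2 + 10 * (live_cap + live_cap * entry_cap + slots) \<le> S"
begin

definition states :: "table_state set" where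
  "states = {..<T} \<times> {s. s \<subseteq> {..\<beta>} \<times> {..R} \<times> {1..n} \<times> {..<T} \<and> card s \<le> live_cap} \<times>
     {s. s \<subseteq> {..\<beta>} \<times> {1..n} \<times> {..<T} \<times> {..T * T} \<and> card s \<le> live_cap * entry_cap} \<times>
     {s. s \<subseteq> {1..n} \<times> {..grid} \<and> card s \<le> slots}"

lemma less_two_power: "x \<le> w \<Longrightarrow> x + 1 \<le> 2 ^ w"
  using less_exp[of w] by linarith

lemma n_le: "n \<le> 2 ^ w"
proof -
  have "n \<le> n * T" using T by simp
  then show ?thesis using w(2) by linarith
qed

lemma two_le_power: "2 \<le> (2::nat) ^ w"
  using w(1) by (cases w) auto

text \<open>The \<open>+ 1\<close> is the padding symbol of \<open>card_bounded_subsets\<close>.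
  \<open>R\<close> is cubic in \<open>w\<close> and so below a fixed power of
  \<open>2 ^ w\<close>.\<close>

lemma live_universe: "card ({..\<beta>} \<times> {..R} \<times> {1..n} \<times> {..<T}) + 1 \<le> 2 ^ (10 * w)"
proof -
  define x where "x = (2::nat) ^ w"
  have x: "2 \<le> x" using two_le_power by (simp add: x_def)
  have wx: "w \<le> x" using less_two_power[of w] by (simp add: x_def)
  have "R = 8 * (w * w * w)" by (simp add: R_def L_def power2_eq_square)
  also have "\<dots> \<le> (x * x * x) * (x * x * x)"
  proof (rule mult_le_mono)
    have "2 * 2 * 2 \<le> x * x * x" using x by (intro mult_le_mono)
    then show "8 \<le> x * x * x" by simp
    show "w * w * w \<le> x * x * x" using wx by (intro mult_le_mono)
  qed
  finally have R: "R \<le> x ^ 6" by (simp add: eval_nat_numeral mult.assoc)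
  have "1 \<le> x ^ 6" using x by simp
  then have "R + 1 \<le> 2 * x ^ 6" using R by linarith
  also have "\<dots> \<le> x * x ^ 6" using x by (intro mult_le_mono) auto
  also have "\<dots> = x ^ 7" by (simp add: eval_nat_numeral)
  finally have R1: "R + 1 \<le> x ^ 7" .
  have "card ({..\<beta>} \<times> {..R} \<times> {1..n} \<times> {..<T}) = (\<beta> + 1) * ((R + 1) * (n * T))"
    by (simp add: card_cartesian_product)
  also have "\<dots> \<le> x * (x ^ 7 * x)"
    using less_two_power[OF beta_le] R1 w(2) by (intro mult_le_mono) (auto simp: x_def)
  also have "\<dots> = x ^ 9" by (simp add: eval_nat_numeral)
  finally have "card ({..\<beta>} \<times> {..R} \<times> {1..n} \<times> {..<T}) + 1 \<le> x ^ 9 + 1" by simp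
  also have "\<dots> \<le> 2 * x ^ 9" using x by simp
  also have "\<dots> \<le> x * x ^ 9" using x by (intro mult_le_mono) auto
  also have "\<dots> = x ^ 10" by (simp add: eval_nat_numeral)
  also have "\<dots> = 2 ^ (10 * w)" by (simp add: x_def power_mult[symmetric] mult.commute)
  finally show ?thesis .
qed

lemma loss_universe: "card ({..\<beta>} \<times> {1..n} \<times> {..<T} \<times> {..T * T}) + 1 \<le> 2 ^ (10 * w)"
proof -
  define x where "x = (2::nat) ^ w"
  have x: "2 \<le> x" using two_le_power by (simp add: x_def)
  have "T * T \<le> x * x" using T_le by (intro mult_le_mono) (auto simp: x_def)
  moreover have "1 \<le> x * x" using x by simp
  ultimately have "T * T + 1 \<le> 2 * (x * x)" by linarith
  also have "\<dots> \<le> x * (x * x)" using x by (intro mult_le_mono) auto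
  finally have T1: "T * T + 1 \<le> x * (x * x)" .
  have "card ({..\<beta>} \<times> {1..n} \<times> {..<T} \<times> {..T * T}) = (\<beta> + 1) * ((n * T) * (T * T + 1))"
    by (simp add: card_cartesian_product mult.assoc distrib_left)
  also have "\<dots> \<le> x * (x * (x * (x * x)))"
    using less_two_power[OF beta_le] T1 w(2) by (intro mult_le_mono) (auto simp: x_def)
  also have "\<dots> = x ^ 5" by (simp add: eval_nat_numeral)
  finally have "card ({..\<beta>} \<times> {1..n} \<times> {..<T} \<times> {..T * T}) + 1 \<le> x ^ 5 + 1" by simp
  also have "\<dots> \<le> 2 * x ^ 5" using x by simp
  also have "\<dots> \<le> x * x ^ 5" using x by (intro mult_le_mono) auto
  also have "\<dots> = x ^ 6" by (simp add: eval_nat_numeral)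
  also have "\<dots> \<le> x ^ 10" using x by (intro power_increasing) auto
  also have "\<dots> = 2 ^ (10 * w)" by (simp add: x_def power_mult[symmetric] mult.commute)
  finally show ?thesis .
qed

lemma weight_universe: "card ({1..n} \<times> {..grid}) + 1 \<le> 2 ^ (10 * w)"
proof -
  define x where "x = (2::nat) ^ w"
  have x: "2 \<le> x" using two_le_power by (simp add: x_def)
  have nx: "n \<le> x" using n_le by (simp add: x_def)
  have "slots \<le> 2 + 10 * (live_cap + live_cap * entry_cap + slots)" by simp
  then have sl: "slots \<le> x" using capacity S_le nx by (meson order_trans)
  have "grid = (2 * 2) * (slots * (k * T))" by (simp add: grid_def mult.assoc)
  also have "\<dots> \<le> (x * x) * (x * x)"
  proof (intro mult_le_mono)
    have "k * T \<le> n * T" using k(2) by (rule mult_le_mono1)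
    then show "k * T \<le> x" using w(2) unfolding x_def by linarith
  qed (use x sl in auto)
  finally have "grid + 1 \<le> (x * x) * (x * x) + 1" by simp
  also have "\<dots> \<le> 2 * ((x * x) * (x * x))" using x by simp
  also have "\<dots> \<le> x * ((x * x) * (x * x))" using x by (intro mult_le_mono) auto
  finally have g: "grid + 1 \<le> x ^ 5" by (simp add: eval_nat_numeral)
  have "card ({1..n} \<times> {..grid}) = n * (grid + 1)" by (simp add: card_cartesian_product)
  also have "\<dots> \<le> x * x ^ 5" using nx g by (intro mult_le_mono)
  also have "\<dots> = x ^ 6" by (simp add: eval_nat_numeral)
  finally have "card ({1..n} \<times> {..grid}) + 1 \<le> x ^ 6 + 1" by simp
  also have "\<dots> \<le> 2 * x ^ 6" using x by simp
  also have "\<dots> \<le> x * x ^ 6" using x by (intro mult_le_mono) auto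
  also have "\<dots> = x ^ 7" by (simp add: eval_nat_numeral)
  also have "\<dots> \<le> x ^ 10" using x by (intro power_increasing) auto
  also have "\<dots> = 2 ^ (10 * w)" by (simp add: x_def power_mult[symmetric] mult.commute)
  finally show ?thesis .
qed

lemma finite_states: "finite states"
  unfolding states_def by (intro finite_cartesian_product card_bounded_subsets(1)) auto

lemma card_states: "card states + 1 \<le> (2 ^ w) ^ S"
proof -
  let ?A = "2 ^ (10 * w)"
  have "card states \<le> T * (?A ^ live_cap * (?A ^ (live_cap * entry_cap) * ?A ^ slots))"
    unfolding states_def card_cartesian_product
  proof (intro mult_le_mono)
    show "card {s. s \<subseteq> {..\<beta>} \<times> {..R} \<times> {1..n} \<times> {..<T} \<and> card s \<le> live_cap} \<le> ?A ^ live_cap"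
      by (rule order_trans[OF card_bounded_subsets(2) power_mono[OF live_universe]]) auto
    show "card {s. s \<subseteq> {..\<beta>} \<times> {1..n} \<times> {..<T} \<times> {..T * T} \<and> card s \<le> live_cap * entry_cap}
        \<le> ?A ^ (live_cap * entry_cap)"
      by (rule order_trans[OF card_bounded_subsets(2) power_mono[OF loss_universe]]) auto
    show "card {s. s \<subseteq> {1..n} \<times> {..grid} \<and> card s \<le> slots} \<le> ?A ^ slots"
      by (rule order_trans[OF card_bounded_subsets(2) power_mono[OF weight_universe]]) auto
  qed simp
  also have "\<dots> = T * ?A ^ (live_cap + live_cap * entry_cap + slots)" by (simp add: power_add mult.assoc)
  also have "\<dots> \<le> 2 ^ w * ?A ^ (live_cap + live_cap * entry_cap + slots)" using T_le by (intro mult_le_mono1)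
  also have "\<dots> = 2 ^ (w + 10 * w * (live_cap + live_cap * entry_cap + slots))"
    by (simp only: power_add power_mult)
  finally have le: "card states \<le> 2 ^ (w + 10 * w * (live_cap + live_cap * entry_cap + slots))" .
  have "card states + 1 \<le> 2 * 2 ^ (w + 10 * w * (live_cap + live_cap * entry_cap + slots))"
    using le one_le_power[of "2::nat" "w + 10 * w * (live_cap + live_cap * entry_cap + slots)"] by linarith
  also have "\<dots> \<le> 2 ^ w * 2 ^ (w + 10 * w * (live_cap + live_cap * entry_cap + slots))"
    using two_le_power by (rule mult_le_mono1)
  also have "\<dots> = 2 ^ (w * (2 + 10 * (live_cap + live_cap * entry_cap + slots)))"
    by (simp add: power_add[symmetric] algebra_simps)
  also have "\<dots> \<le> 2 ^ (w * S)" using capacity by (intro power_increasing mult_le_mono2) auto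
  finally show ?thesis by (simp add: power_mult)
qed

text \<open>\<open>None\<close> is the initial state, to which the algorithm also returns when its tables overflow.\<close>

definition guard :: "table_state \<Rightarrow> table_state option" where
  "guard s = (if s \<in> states then Some s else None)"

fun advance :: "table_state option \<Rightarrow> (nat \<times> nat \<times> nat \<Rightarrow> bool) \<Rightarrow> (nat \<Rightarrow> nat) \<Rightarrow> table_state option" where
  "advance None \<xi> l = guard (first_state \<xi>)"
| "advance (Some s) \<xi> l = guard (next_state s \<xi> l)"

definition valid :: "table_state option set" where
  "valid = insert None (Some ` states)"

lemma advance_valid: "advance s \<xi> l \<in> valid"
  by (cases s) (auto simp: guard_def valid_def)

text \<open>The injection exists by counting; the model charges for words, not for
  computation.\<close>

definition encode :: "table_state option \<Rightarrow> memory" where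
  "encode = (SOME f. inj_on f valid \<and> f ` valid \<subseteq> {xs. set xs \<subseteq> mem_words n T \<and> length xs = S})"

lemma encode: "inj_on encode valid" "encode ` valid \<subseteq> {xs. set xs \<subseteq> mem_words n T \<and> length xs = S}"
proof -
  have fin: "finite valid" using finite_states by (simp add: valid_def)
  have "card valid = card states + 1"
    using finite_states by (simp add: valid_def card_insert_if card_image)
  also have "\<dots> \<le> card {xs. set xs \<subseteq> mem_words n T \<and> length xs = S}"
    using card_states by (subst card_lists_length_eq) (auto simp: mem_words_def w_eq)
  finally have "\<exists>f. inj_on f valid \<and> f ` valid \<subseteq> {xs. set xs \<subseteq> mem_words n T \<and> length xs = S}"
    using fin by (subst inj_on_iff_card_le) (auto intro: finite_lists_length_eq simp: mem_words_def)
  from someI_ex[OF this] show "inj_on encode valid"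
    "encode ` valid \<subseteq> {xs. set xs \<subseteq> mem_words n T \<and> length xs = S}"
    unfolding encode_def by blast+
qed

definition decode :: "memory \<Rightarrow> table_state option" where
  "decode M = (if M \<in> encode ` valid then inv_into valid encode M else None)"

lemma decode_encode: "s \<in> valid \<Longrightarrow> decode (encode s) = s"
  using encode(1) by (simp add: decode_def)

fun pick_from :: "table_state option \<Rightarrow> nat pmf" where
  "pick_from None = return_pmf 1"
| "pick_from (Some (t, LV, TB, Q)) = draw n Q"

lemma set_pick_from: "set_pmf (pick_from s) \<subseteq> {1..n}"
proof (cases s)
  case None
  then show ?thesis using n_pos by simp
next
  case (Some a)
  then show ?thesis using set_draw[of n] n_pos by (cases a) auto
qed

definition fresh :: "(nat \<times> nat \<times> nat \<Rightarrow> bool) pmf" where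
  "fresh = Pi_pmf ({..\<beta>} \<times> {..R} \<times> {1..n}) False (\<lambda>(b, r, i). bernoulli_pmf (rate r))"

definition alg :: expert_alg where
  "alg = \<lparr>init_mem = encode None, pick = (\<lambda>M. pick_from (decode M)),
     upd = (\<lambda>M i v. map_pmf (\<lambda>\<xi>. encode (advance (decode M) \<xi> (round_loss n T v))) fresh)\<rparr>"

lemma encode_mem: "s \<in> valid \<Longrightarrow> encode s \<in> lists (mem_words n T)" "s \<in> valid \<Longrightarrow> length (encode s) = S"
  using encode(2) by blast+

lemma None_valid: "None \<in> valid" by (simp add: valid_def)

lemma is_expert_alg: "is_expert_alg n T alg"
  unfolding is_expert_alg_def
proof (intro conjI ballI)
  show "init_mem alg \<in> lists (mem_words n T)" using encode_mem(1)[OF None_valid] by (simp add: alg_def)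
  fix M
  show "set_pmf (pick alg M) \<subseteq> {1..n}" using set_pick_from by (simp add: alg_def)
  fix i
  show "(\<lambda>v. measure_pmf (upd alg M i v)) \<in> loss_vectors n \<rightarrow>\<^sub>M subprob_algebra (count_space UNIV)"
    unfolding alg_def expert_alg.simps
    by (rule through_round_loss_measurable[where h = "\<lambda>a. measure_pmf (map_pmf (\<lambda>\<xi>. encode (advance (decode M) \<xi> a)) fresh)"])
      (use T in \<open>auto intro: measure_pmf_in_subprob_algebra\<close>)
  fix v
  show "set_pmf (upd alg M i v) \<subseteq> lists (mem_words n T)"
    using encode_mem(1)[OF advance_valid] by (auto simp: alg_def)
qed

text \<open>The joint process of picks and seeds, of which the memory state is a function.\<close>

primrec trajectory :: "(nat \<Rightarrow> nat \<Rightarrow> real) \<Rightarrow> (nat \<times> nat \<times> nat \<times> nat \<Rightarrow> bool) \<Rightarrow> nat \<Rightarrow> table_state option" where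
  "trajectory l \<omega> 0 = None"
| "trajectory l \<omega> (Suc t) = advance (trajectory l \<omega> t) (\<lambda>y. \<omega> (t, y)) (round_loss n T (l (Suc t)))"

definition extend_seeds :: "nat \<Rightarrow> (nat \<times> nat \<times> nat \<times> nat \<Rightarrow> bool) \<Rightarrow> (nat \<times> nat \<times> nat \<Rightarrow> bool)
    \<Rightarrow> nat \<times> nat \<times> nat \<times> nat \<Rightarrow> bool" where
  "extend_seeds t \<omega> \<xi> = (\<lambda>z. if fst z = t then \<xi> (snd z) else \<omega> z)"

text \<open>Seeds of days not yet played are \<open>False\<close>. The coins of a day are drawn
  independently of the pick, so picks never bias seeds; by \<open>joint_seeds\<close> the collected
  coins therefore have a product law.\<close>

primrec joint :: "(nat \<Rightarrow> nat \<Rightarrow> real) \<Rightarrow> nat \<Rightarrow> (nat list \<times> (nat \<times> nat \<times> nat \<times> nat \<Rightarrow> bool)) pmf" where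
  "joint l 0 = return_pmf ([], \<lambda>_. False)"
| "joint l (Suc t) = bind_pmf (joint l t) (\<lambda>(is, \<omega>). bind_pmf (pick_from (trajectory l \<omega> t)) (\<lambda>i.
     map_pmf (\<lambda>\<xi>. (is @ [i], extend_seeds t \<omega> \<xi>)) fresh))"

lemma trajectory_valid: "trajectory l \<omega> t \<in> valid"
  by (cases t) (auto simp: None_valid advance_valid)

lemma trajectory_cong: "(\<And>x y. x < t \<Longrightarrow> \<omega> (x, y) = \<omega>' (x, y)) \<Longrightarrow> trajectory l \<omega> t = trajectory l \<omega>' t"
  by (induction t) auto

lemma trajectory_extend: "s \<le> t \<Longrightarrow> trajectory l (extend_seeds t \<omega> \<xi>) s = trajectory l \<omega> s"
  by (rule trajectory_cong) (auto simp: extend_seeds_def)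

lemma run_alg: "run alg l t = map_pmf (\<lambda>(is, \<omega>). (is, encode (trajectory l \<omega> t))) (joint l t)"
proof (induction t)
  case 0
  then show ?case by (simp add: alg_def)
next
  case (Suc t)
  have d: "decode (encode (trajectory l \<omega> t)) = trajectory l \<omega> t" for \<omega>
    by (rule decode_encode[OF trajectory_valid])
  have "run alg l (Suc t) = bind_pmf (joint l t) (\<lambda>(is, \<omega>). bind_pmf (pick_from (trajectory l \<omega> t)) (\<lambda>i.
     map_pmf (\<lambda>\<xi>. (is @ [i], encode (advance (trajectory l \<omega> t) \<xi> (round_loss n T (l (Suc t)))))) fresh))"
    unfolding run.simps(2) Suc by (simp add: bind_map_pmf alg_def d map_pmf_comp case_prod_unfold)
  also have "\<dots> = map_pmf (\<lambda>(is, \<omega>). (is, encode (trajectory l \<omega> (Suc t)))) (joint l (Suc t))"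
    by (simp add: map_bind_pmf map_pmf_comp case_prod_unfold trajectory_extend) (simp add: extend_seeds_def)
  finally show ?case .
qed

lemma uses_memory: "uses_memory_at_most n T alg S"
  unfolding uses_memory_at_most_def run_alg using encode_mem(2)[OF trajectory_valid] by auto

lemma run_measurable:
  "(\<lambda>l. measure_pmf (run alg l T)) \<in> measurable (loss_seqs n T) (subprob_algebra (count_space UNIV))"
proof -
  have tr: "trajectory l \<omega> t = trajectory l' \<omega> t"
    if "\<And>s. s < t \<Longrightarrow> round_loss n T (l (Suc s)) = round_loss n T (l' (Suc s))" for l l' t \<omega>
    using that by (induction t) auto
  have jt: "joint l t = joint l' t"
    if "\<And>s. s < t \<Longrightarrow> round_loss n T (l (Suc s)) = round_loss n T (l' (Suc s))" for l l' t
    using that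
  proof (induction t)
    case 0
    then show ?case by simp
  next
    case (Suc t)
    have "trajectory l \<omega> t = trajectory l' \<omega> t" for \<omega> by (rule tr) (simp add: Suc.prems)
    moreover have "joint l t = joint l' t" by (rule Suc.IH) (simp add: Suc.prems)
    ultimately show ?case by (simp only: joint.simps)
  qed
  have runeq: "run alg l T = run alg l' T" if "round_losses n T T l = round_losses n T T l'" for l l'
  proof -
    have "round_loss n T (l (Suc s)) = round_loss n T (l' (Suc s))" if "s < T" for s
      using fun_cong[OF \<open>round_losses n T T l = round_losses n T T l'\<close>, of "Suc s"] that
      by (simp add: round_losses_def)
    then have "joint l T = joint l' T" "trajectory l \<omega> T = trajectory l' \<omega> T" for \<omega>
      by (intro jt tr; simp)+
    then show ?thesis unfolding run_alg by (simp only:)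
  qed
  \<comment> \<open>Any sequence with the given rounding will do: by \<open>runeq\<close> the run
    does not depend on the choice.\<close>
  define h where "h = (\<lambda>a. measure_pmf (run alg (SOME l. round_losses n T T l = a) T))"
  have "measure_pmf (run alg l T) = h (round_losses n T T l)" for l
  proof -
    have "round_losses n T T (SOME l'. round_losses n T T l' = round_losses n T T l) = round_losses n T T l"
      by (rule someI[where P = "\<lambda>l'. round_losses n T T l' = round_losses n T T l" and x = l]) (rule refl)
    from runeq[OF this] show ?thesis unfolding h_def by (simp only:)
  qed
  moreover have "(\<lambda>l. h (round_losses n T T l)) \<in> measurable (loss_seqs n T) (subprob_algebra (count_space UNIV))"
    using T by (intro through_round_losses_measurable) (auto simp: h_def intro: measure_pmf_in_subprob_algebra)
  ultimately show ?thesis by simp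
qed

lemma fresh_slice: "Pi_pmf ({t} \<times> ({..\<beta>} \<times> {..R} \<times> {1..n})) False coin =
    map_pmf (\<lambda>\<xi> z. if fst z = t then \<xi> (snd z) else False) fresh"
proof -
  have "Pi_pmf ({t} \<times> J) False coin = map_pmf (\<lambda>\<xi> z. if fst z = t then \<xi> (snd z) else False)
      (Pi_pmf J False (\<lambda>(b, r, i). bernoulli_pmf (rate r)))" if "finite J" for J :: "(nat \<times> nat \<times> nat) set"
    using that
  proof (induction J rule: finite_induct)
    case empty
    then show ?case by (simp add: fun_eq_iff)
  next
    case (insert y J)
    obtain b r i where y: "y = (b, r, i)" by (cases y)
    have "{t} \<times> insert y J = insert (t, y) ({t} \<times> J)" by auto
    then have "Pi_pmf ({t} \<times> insert y J) False coin =
        map_pmf (\<lambda>(v, f). f((t, y) := v)) (pair_pmf (coin (t, y)) (Pi_pmf ({t} \<times> J) False coin))"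
      using insert.hyps by (simp add: Pi_pmf_insert)
    also have "\<dots> = map_pmf (\<lambda>(v, \<xi>). (\<lambda>z. if fst z = t then \<xi> (snd z) else False)((t, y) := v))
        (pair_pmf (bernoulli_pmf (rate r)) (Pi_pmf J False (\<lambda>(b, r, i). bernoulli_pmf (rate r))))"
      unfolding insert.IH by (simp add: coin_def y pair_map_pmf2 map_pmf_comp case_prod_unfold)
    also have "\<dots> = map_pmf (\<lambda>\<xi> z. if fst z = t then \<xi> (snd z) else False)
        (map_pmf (\<lambda>(v, f). f(y := v))
          (pair_pmf (bernoulli_pmf (rate r)) (Pi_pmf J False (\<lambda>(b, r, i). bernoulli_pmf (rate r)))))"
      unfolding map_pmf_comp by (rule map_pmf_cong[OF refl]) (auto simp: fun_eq_iff)
    also have "\<dots> = map_pmf (\<lambda>\<xi> z. if fst z = t then \<xi> (snd z) else False)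
        (Pi_pmf (insert y J) False (\<lambda>(b, r, i). bernoulli_pmf (rate r)))"
      using insert.hyps by (subst Pi_pmf_insert) (auto simp: y)
    finally show ?case .
  qed
  then show ?thesis by (simp add: fresh_def)
qed

lemma joint_seeds: "map_pmf snd (joint l t) = Pi_pmf ({..<t} \<times> ({..\<beta>} \<times> {..R} \<times> {1..n})) False coin"
proof (induction t)
  case 0
  then show ?case by simp
next
  case (Suc t)
  let ?J = "{..\<beta>} \<times> {..R} \<times> {1..n}"
  have "map_pmf snd (joint l (Suc t)) = bind_pmf (joint l t) (\<lambda>z. map_pmf (extend_seeds t (snd z)) fresh)"
    by (simp add: map_bind_pmf map_pmf_comp case_prod_unfold)
  also have "\<dots> = bind_pmf (map_pmf snd (joint l t)) (\<lambda>\<omega>. map_pmf (extend_seeds t \<omega>) fresh)"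
    by (simp add: bind_map_pmf)
  also have "\<dots> = bind_pmf (Pi_pmf ({..<t} \<times> ?J) False coin) (\<lambda>\<omega>. map_pmf (extend_seeds t \<omega>) fresh)"
    unfolding Suc ..
  also have "\<dots> = bind_pmf (Pi_pmf ({..<t} \<times> ?J) False coin) (\<lambda>\<omega>.
      map_pmf (\<lambda>f z. if z \<in> {..<t} \<times> ?J then \<omega> z else f z) (Pi_pmf ({t} \<times> ?J) False coin))"
  proof (rule bind_pmf_cong[OF refl])
    fix \<omega> assume "\<omega> \<in> set_pmf (Pi_pmf ({..<t} \<times> ?J) False coin)"
    then have "\<omega> \<in> {f. \<forall>x. x \<notin> {..<t} \<times> ?J \<longrightarrow> f x = False}"
      by (intro subsetD[OF set_Pi_pmf_subset]) auto
    from CollectD[OF this] have "x \<notin> {..<t} \<times> ?J \<longrightarrow> \<omega> x = False" for x by (rule spec)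
    then have \<omega>: "\<omega> x = False" if "x \<notin> {..<t} \<times> ?J" for x using that by (rule mp)
    show "map_pmf (extend_seeds t \<omega>) fresh =
      map_pmf (\<lambda>f z. if z \<in> {..<t} \<times> ?J then \<omega> z else f z) (Pi_pmf ({t} \<times> ?J) False coin)"
      unfolding fresh_slice map_pmf_comp
    proof (rule map_pmf_cong[OF refl], rule ext)
      fix \<xi> and z :: "nat \<times> nat \<times> nat \<times> nat"
      show "extend_seeds t \<omega> \<xi> z = (if z \<in> {..<t} \<times> ?J then \<omega> z else if fst z = t then \<xi> (snd z) else False)"
        using \<omega>[of z] by (cases z) (auto simp: extend_seeds_def)
    qed
  qed
  also have "\<dots> = Pi_pmf ({..<t} \<times> ?J \<union> {t} \<times> ?J) False coin"
    by (subst Pi_pmf_union) (auto simp: pair_pmf_def map_bind_pmf map_pmf_def bind_assoc_pmf bind_return_pmf)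
  also have "{..<t} \<times> ?J \<union> {t} \<times> ?J = {..<Suc t} \<times> ?J" by auto
  finally show ?case .
qed

lemma joint_seeds_T: "map_pmf snd (joint l T) = seeds"
  unfolding joint_seeds seeds_def idx_def ..

lemma joint_picks:
  "(is, \<omega>) \<in> set_pmf (joint l t) \<Longrightarrow> length is = t \<and> (\<forall>s<t. is ! s \<in> {1..n})"
proof (induction t arbitrary: "is" \<omega>)
  case 0
  then show ?case by simp
next
  case (Suc t)
  then obtain is' \<omega>' i where "(is', \<omega>') \<in> set_pmf (joint l t)" "i \<in> set_pmf (pick_from (trajectory l \<omega>' t))"
      "is = is' @ [i]"
    by auto
  then show ?case using Suc.IH set_pick_from by (auto simp: nth_append less_Suc_eq dest!: subsetD[OF set_pick_from])
qed

end

subsection \<open>Regret of the algorithm\<close>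

lemma regret_le_horizon:
  assumes "1 \<le> n" and l: "l \<in> space (loss_seqs n T)" and "\<And>s. s < T \<Longrightarrow> is ! s \<in> {1..n}"
  shows "regret n T l is \<le> real T"
  unfolding regret_le_iff[OF assms(1)]
proof
  fix i assume i: "i \<in> {1..n}"
  have v: "l (Suc s) \<in> space (loss_vectors n)" if "s < T" for s
    using loss_seq_vector[OF l, of "Suc s"] that by simp
  have "(\<Sum>s<T. l (Suc s) (is ! s)) \<le> (\<Sum>s<T. 1)"
    using loss_vector_coord[OF v assms(3)] by (intro sum_mono) auto
  moreover have "0 \<le> (\<Sum>s<T. l (Suc s) i)"
    using loss_vector_coord[OF v i] by (intro sum_nonneg) auto
  ultimately show "(\<Sum>s<T. l (Suc s) (is ! s)) \<le> (\<Sum>s<T. l (Suc s) i) + real T" by simp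
qed

text \<open>Serves horizons so short that the claimed bound is at least \<open>T\<close>.\<close>

definition constant_alg :: expert_alg where
  "constant_alg = \<lparr>init_mem = [], pick = (\<lambda>M. return_pmf 1), upd = (\<lambda>M i v. return_pmf [])\<rparr>"

lemma run_constant_alg: "run constant_alg l t = return_pmf (replicate t 1, [])"
  by (induction t) (auto simp: constant_alg_def bind_return_pmf replicate_append_same)

lemma constant_alg:
  assumes "1 \<le> n"
  shows "is_expert_alg n T constant_alg" "uses_memory_at_most n T constant_alg S"
    and "oblivious_adversary n T D \<Longrightarrow> real T \<le> c \<Longrightarrow> 0 \<le> \<delta> \<Longrightarrow>
      1 - \<delta> \<le> \<P>((l, is, M) in play n T constant_alg D. regret n T l is \<le> c)"
proof -
  show "is_expert_alg n T constant_alg"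
    using assms by (auto simp: is_expert_alg_def constant_alg_def intro: measure_pmf_in_subprob_algebra)
  show "uses_memory_at_most n T constant_alg S"
    by (auto simp: uses_memory_at_most_def run_constant_alg)
  assume D: "oblivious_adversary n T D" and c: "real T \<le> c" "0 \<le> \<delta>"
  show "1 - \<delta> \<le> \<P>((l, is, M) in play n T constant_alg D. regret n T l is \<le> c)"
  proof (rule play_prob_ge[OF assms D])
    show "(\<lambda>l. measure_pmf (run constant_alg l T)) \<in> loss_seqs n T \<rightarrow>\<^sub>M subprob_algebra (count_space UNIV)"
      unfolding run_constant_alg by (auto intro: measure_pmf_in_subprob_algebra)
    fix l assume l: "l \<in> space (loss_seqs n T)"
    have "regret n T l (replicate T 1) \<le> real T"
      using assms by (intro regret_le_horizon[OF assms l]) auto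
    then show "1 - \<delta> \<le> measure_pmf.prob (run constant_alg l T) {(is, M). regret n T l is \<le> c}"
      using c unfolding run_constant_alg by (simp add: measure_return_pmf)
  qed
qed

context word_parameters
begin

section \<open>Regret as deviation of the picks plus deterministic slack\<close>

definition unit_loss :: "(nat \<Rightarrow> nat \<Rightarrow> real) \<Rightarrow> nat \<Rightarrow> nat \<Rightarrow> real" where
  "unit_loss l t i = real (round_loss n T (l (Suc t)) i) / real T"

definition mean_loss :: "(nat \<Rightarrow> nat \<Rightarrow> real) \<Rightarrow> (nat \<times> nat \<times> nat \<times> nat \<Rightarrow> bool) \<Rightarrow> nat \<Rightarrow> real" where
  "mean_loss l \<omega> t = measure_pmf.expectation (pick_from (trajectory l \<omega> t)) (unit_loss l t)"

definition deviation :: "(nat \<Rightarrow> nat \<Rightarrow> real) \<Rightarrow> nat \<Rightarrow> nat list \<Rightarrow> (nat \<times> nat \<times> nat \<times> nat \<Rightarrow> bool) \<Rightarrow> real" where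
  "deviation l t is \<omega> = (\<Sum>s<t. unit_loss l s (is ! s) - mean_loss l \<omega> s)"

text \<open>The initial state is deterministic, so the first day is spent without samples: day \<open>d\<close> of the
  sampling process is day \<open>d + 2\<close> of the original sequence.\<close>

definition game :: "(nat \<Rightarrow> nat \<Rightarrow> real) \<Rightarrow> nat \<Rightarrow> nat \<Rightarrow> nat" where
  "game l d = (if d < D then round_loss n T (l (Suc (Suc d))) else (\<lambda>_. 0))"

definition "jumps = real (D div 2 ^ \<beta> + visits)"
text \<open>The summand 2 pays for rounding the losses and for the first day, \<open>jumps\<close>
  for the days of the dummy, and the quotient is the fixed-share regret. Its \<open>+ 2\<close>
  consists of the switch to \<open>i\<close> itself and the opening segment.\<close>

definition "slack = 2 + jumps + ((jumps * (real R * real cap + 1) + 2) * ln (2 * real slots / \<mu>) + real D * (2 * \<eta>\<^sup>2)) / \<eta>"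

context
  fixes l assumes l: "l \<in> space (loss_seqs n T)"
begin

lemma day_vector: "s < T \<Longrightarrow> l (Suc s) \<in> space (loss_vectors n)"
  using loss_seq_vector[OF l, of "Suc s"] by simp

lemma unit_loss_range: "s < T \<Longrightarrow> 0 \<le> unit_loss l s i \<and> unit_loss l s i \<le> 1"
  using round_loss_bounds(1)[OF day_vector, of s T i] T by (simp add: unit_loss_def)

text \<open>Given the past, a day adds a centred variable with values in a unit interval before
  centring, so the moment grows by at most \<open>exp (s\<^sup>2)\<close>. The conditional mean
  \<open>mean_loss\<close> reads only coins of earlier days, so the coins drawn after the pick do
  not disturb it.\<close>

lemma deviation_moment:
  assumes s: "0 \<le> s" "s \<le> 1"
  shows "t \<le> T \<Longrightarrow> (\<integral>\<^sup>+ z. ennreal (exp (s * deviation l t (fst z) (snd z))) \<partial>joint l t) \<le> ennreal (exp (s\<^sup>2 * real t))"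
proof (induction t)
  case 0
  then show ?case by (simp add: deviation_def)
next
  case (Suc t)
  let ?P = "\<lambda>\<omega>. pick_from (trajectory l \<omega> t)"
  have "(\<integral>\<^sup>+ z. ennreal (exp (s * deviation l (Suc t) (fst z) (snd z))) \<partial>joint l (Suc t)) =
    (\<integral>\<^sup>+ z. (\<integral>\<^sup>+ i. (\<integral>\<^sup>+ \<xi>. ennreal (exp (s * deviation l (Suc t) (fst z @ [i]) (extend_seeds t (snd z) \<xi>))) \<partial>fresh)
        \<partial>?P (snd z)) \<partial>joint l t)"
    by (simp add: nn_integral_bind_pmf case_prod_unfold)
  also have "\<dots> \<le> (\<integral>\<^sup>+ z. ennreal (exp (s\<^sup>2)) * ennreal (exp (s * deviation l t (fst z) (snd z))) \<partial>joint l t)"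
  proof (rule nn_integral_mono_AE, unfold AE_measure_pmf_iff, rule ballI)
    fix z assume z: "z \<in> set_pmf (joint l t)"
    obtain "is" \<omega> where z': "z = (is, \<omega>)" by (cases z)
    have len: "length is = t" using joint_picks z z' by blast
    have dev: "deviation l (Suc t) (is @ [i]) (extend_seeds t \<omega> \<xi>) =
        deviation l t is \<omega> + (unit_loss l t i - mean_loss l \<omega> t)" for i \<xi>
    proof -
      have "(\<Sum>s<t. unit_loss l s ((is @ [i]) ! s) - mean_loss l (extend_seeds t \<omega> \<xi>) s) = deviation l t is \<omega>"
        unfolding deviation_def
        by (rule sum.cong) (auto simp: nth_append len mean_loss_def trajectory_extend)
      moreover have "mean_loss l (extend_seeds t \<omega> \<xi>) t = mean_loss l \<omega> t"
        by (simp add: mean_loss_def trajectory_extend)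
      ultimately show ?thesis
        unfolding deviation_def[of l "Suc t"] using len by (simp add: nth_append)
    qed
    have range: "0 \<le> unit_loss l t i \<and> unit_loss l t i \<le> 1" for i
      using unit_loss_range[of t i] Suc.prems by simp
    define Y where "Y = (\<lambda>i. exp (s * (unit_loss l t i - mean_loss l \<omega> t)))"
    have mean: "0 \<le> mean_loss l \<omega> t"
      unfolding mean_loss_def using range by (intro integral_nonneg_AE) auto
    have bound: "Y i \<le> exp 1" for i
    proof -
      have "s * (unit_loss l t i - mean_loss l \<omega> t) \<le> 1 * 1"
      proof (cases "0 \<le> unit_loss l t i - mean_loss l \<omega> t")
        case True
        then show ?thesis using s mean range[of i] by (intro mult_mono) auto
      next
        case False
        then have "s * (unit_loss l t i - mean_loss l \<omega> t) \<le> 0" using s by (intro mult_nonneg_nonpos) auto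
        then show ?thesis by simp
      qed
      then show ?thesis by (simp add: Y_def)
    qed
    have int: "integrable (measure_pmf (?P \<omega>)) Y"
      using bound by (intro measure_pmf.integrable_const_bound[where B = "exp 1"]) (auto simp: Y_def)
    have "(\<integral>\<^sup>+ i. ennreal (Y i) \<partial>?P \<omega>) = ennreal (measure_pmf.expectation (?P \<omega>) Y)"
      using int by (intro nn_integral_eq_integral) (auto simp: Y_def)
    also have "\<dots> \<le> ennreal (exp (s\<^sup>2))"
      unfolding Y_def mean_loss_def using exp_moment_pmf[of "?P \<omega>" "unit_loss l t" s] range s
      by (intro ennreal_leI) simp
    finally have EY: "(\<integral>\<^sup>+ i. ennreal (Y i) \<partial>?P \<omega>) \<le> ennreal (exp (s\<^sup>2))" .
    have "(\<integral>\<^sup>+ i. (\<integral>\<^sup>+ \<xi>. ennreal (exp (s * deviation l (Suc t) (fst z @ [i]) (extend_seeds t (snd z) \<xi>))) \<partial>fresh) \<partial>?P (snd z))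
      = (\<integral>\<^sup>+ i. ennreal (exp (s * deviation l t is \<omega>)) * ennreal (Y i) \<partial>?P \<omega>)"
      by (simp add: z' dev distrib_left exp_add ennreal_mult' Y_def)
    also have "\<dots> = ennreal (exp (s * deviation l t is \<omega>)) * (\<integral>\<^sup>+ i. ennreal (Y i) \<partial>?P \<omega>)"
      by (simp add: nn_integral_cmult)
    also have "\<dots> \<le> ennreal (exp (s * deviation l t is \<omega>)) * ennreal (exp (s\<^sup>2))"
      by (rule mult_left_mono[OF EY]) simp
    finally show "(\<integral>\<^sup>+ i. (\<integral>\<^sup>+ \<xi>. ennreal (exp (s * deviation l (Suc t) (fst z @ [i]) (extend_seeds t (snd z) \<xi>))) \<partial>fresh) \<partial>?P (snd z))
      \<le> ennreal (exp (s\<^sup>2)) * ennreal (exp (s * deviation l t (fst z) (snd z)))"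
      by (simp add: z' mult.commute)
  qed
  also have "\<dots> = ennreal (exp (s\<^sup>2)) * (\<integral>\<^sup>+ z. ennreal (exp (s * deviation l t (fst z) (snd z))) \<partial>joint l t)"
    by (simp add: nn_integral_cmult)
  also have "\<dots> \<le> ennreal (exp (s\<^sup>2)) * ennreal (exp (s\<^sup>2 * real t))"
    using Suc by (intro mult_left_mono) auto
  also have "\<dots> = ennreal (exp (s\<^sup>2 * real (Suc t)))"
    by (simp add: ennreal_mult[symmetric] exp_add[symmetric] algebra_simps)
  finally show ?case .
qed

lemma deviation_tail:
  assumes s: "0 \<le> s" "s \<le> 1"
  shows "measure_pmf.prob (joint l T) {(is, \<omega>). c \<le> deviation l T is \<omega>} \<le> exp (s\<^sup>2 * real T - s * c)"
proof -
  have "emeasure (joint l T) {(is, \<omega>). c \<le> deviation l T is \<omega>} =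
      (\<integral>\<^sup>+ z. indicator {(is, \<omega>). c \<le> deviation l T is \<omega>} z \<partial>joint l T)" by simp
  also have "\<dots> \<le> (\<integral>\<^sup>+ z. ennreal (exp (- (s * c))) * ennreal (exp (s * deviation l T (fst z) (snd z))) \<partial>joint l T)"
  proof (rule nn_integral_mono)
    fix z
    show "indicator {(is, \<omega>). c \<le> deviation l T is \<omega>} z
      \<le> ennreal (exp (- (s * c))) * ennreal (exp (s * deviation l T (fst z) (snd z)))"
    proof (cases "c \<le> deviation l T (fst z) (snd z)")
      case True
      then have "s * c \<le> s * deviation l T (fst z) (snd z)" using s by (intro mult_left_mono)
      then have "1 \<le> exp (- (s * c)) * exp (s * deviation l T (fst z) (snd z))"
        by (simp add: exp_add[symmetric])
      then have "1 \<le> ennreal (exp (- (s * c)) * exp (s * deviation l T (fst z) (snd z)))"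
        by (metis ennreal_1 ennreal_leI)
      then show ?thesis by (simp add: ennreal_mult indicator_def)
    next
      case False
      then show ?thesis by (simp add: indicator_def case_prod_unfold)
    qed
  qed
  also have "\<dots> = ennreal (exp (- (s * c))) * (\<integral>\<^sup>+ z. ennreal (exp (s * deviation l T (fst z) (snd z))) \<partial>joint l T)"
    by (simp add: nn_integral_cmult)
  also have "\<dots> \<le> ennreal (exp (- (s * c))) * ennreal (exp (s\<^sup>2 * real T))"
    by (intro mult_left_mono deviation_moment s) auto
  also have "\<dots> = ennreal (exp (s\<^sup>2 * real T - s * c))"
    by (simp add: ennreal_mult[symmetric] exp_add[symmetric])
  finally show ?thesis by (simp add: measure_pmf.emeasure_eq_measure)
qed

lemma game_le: "game l d i \<le> T"
  using round_loss_bounds(1)[OF day_vector, of "Suc d" T i] T by (auto simp: game_def D_def)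

context
  fixes \<omega> assumes good: "good (game l) \<omega>" and support: "\<And>z. \<omega> z \<Longrightarrow> z \<in> idx"
begin

lemma live_table_bounds:
  assumes "t < D"
  shows "live_table (game l) \<omega> t \<subseteq> {..\<beta>} \<times> {..R} \<times> {1..n} \<times> {..<T}"
    and "finite (live_table (game l) \<omega> t)" and "card (live_table (game l) \<omega> t) \<le> live_cap"
proof -
  have tD: "t \<le> D" using assms by simp
  show sub: "live_table (game l) \<omega> t \<subseteq> {..\<beta>} \<times> {..R} \<times> {1..n} \<times> {..<T}"
  proof
    fix z assume "z \<in> live_table (game l) \<omega> t"
    then obtain b r i e where z: "z = (b, r, i, e)" "b \<le> \<beta>" "r \<le> R"
        "(i, e) \<in> live_at (game l) \<omega> b r t" by (auto simp: live_table_def)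
    then have "sampled \<omega> b r i e" "e \<le> t" by (auto simp: live_def)
    then show "z \<in> {..\<beta>} \<times> {..R} \<times> {1..n} \<times> {..<T}"
      using z sampled_expert[OF good support, of b r i e] assms D_less by auto
  qed
  show "finite (live_table (game l) \<omega> t)" by (rule finite_subset[OF sub]) simp
  define F where "F = (\<lambda>b r. (\<lambda>u. (b, r, fst u, snd u)) ` live_at (game l) \<omega> b r t)"
  have fin: "finite (F b r)" "card (F b r) \<le> raw + w * cap" if "b \<le> \<beta>" "r \<le> R" for b r
    using card_live[OF good support that tD] card_image_le[of "live_at (game l) \<omega> b r t"]
    by (auto simp: F_def intro: order_trans)
  have eq: "live_table (game l) \<omega> t = (\<Union>b\<in>{..\<beta>}. \<Union>r\<in>{..R}. F b r)"
    by (auto simp: live_table_def F_def image_iff)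
  have "card (live_table (game l) \<omega> t) \<le> (\<Sum>b\<in>{..\<beta>}. card (\<Union>r\<in>{..R}. F b r))"
    unfolding eq by (rule card_UN_le) simp
  also have "\<dots> \<le> (\<Sum>b\<in>{..\<beta>}. \<Sum>r\<in>{..R}. card (F b r))" by (intro sum_mono card_UN_le) simp
  also have "\<dots> \<le> (\<Sum>b\<in>{..\<beta>}. \<Sum>r\<in>{..R}. raw + w * cap)" using fin by (intro sum_mono) auto
  also have "\<dots> = (\<beta> + 1) * ((R + 1) * (raw + w * cap))" by simp
  also have "\<dots> \<le> live_cap" unfolding live_cap_def using beta_le by (intro mult_le_mono1) simp
  finally show "card (live_table (game l) \<omega> t) \<le> live_cap" .
qed

lemma active_bounds:
  assumes "t < D"
  shows "active (game l) \<omega> t \<subseteq> {1..n}" "finite (active (game l) \<omega> t)" "active (game l) \<omega> t \<noteq> {}"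
    "card (active (game l) \<omega> t) \<le> slots"
proof -
  note lb = live_table_bounds[OF assms]
  show "active (game l) \<omega> t \<subseteq> {1..n}" using lb(1) n_pos by (auto simp: active_def)
  show "finite (active (game l) \<omega> t)" "active (game l) \<omega> t \<noteq> {}" using lb(2) by (auto simp: active_def)
  have "card (active (game l) \<omega> t) \<le> card ((\<lambda>(b, r, i, e). i) ` live_table (game l) \<omega> t) + 1"
    unfolding active_def using lb(2) by (simp add: card_insert_if)
  also have "\<dots> \<le> slots"
    unfolding slots_def using card_image_le[OF lb(2), of "\<lambda>(b, r, i, e). i"] lb(3) by linarith
  finally show "card (active (game l) \<omega> t) \<le> slots" .
qed

lemma n_le_kT: "n \<le> k * T"
proof -
  have "1 * n \<le> 2 ^ \<beta> * n" by (rule mult_le_mono1) simp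
  then show ?thesis using beta by linarith
qed

lemma kT_pos: "0 < real k * real T" using k T by simp

lemma eta_bounds: "0 < \<eta>" "\<eta> \<le> 1" "\<eta>\<^sup>2 = 2 * \<mu>"
proof -
  have "real n \<le> real k * real T" using n_le_kT by (metis of_nat_le_iff of_nat_mult)
  then show "\<eta> \<le> 1" "0 < \<eta>" using kT_pos n_pos unfolding \<eta>_def by auto
  show "\<eta>\<^sup>2 = 2 * \<mu>" using kT_pos by (simp add: \<eta>_def \<mu>_def)
qed

interpretation share: fixed_share \<eta> \<mu> T slots grid "active (game l) \<omega>" "game l" D
proof
  show "0 < \<eta>" "\<eta> \<le> 1" by (rule eta_bounds)+
  show "0 < \<mu>" using kT_pos n_pos by (simp add: \<mu>_def)
  have "\<eta>\<^sup>2 \<le> 1" using eta_bounds(1,2) by (simp add: power_le_one)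
  then show "\<mu> \<le> 1 / 2" using eta_bounds(3) by simp
  show "0 < T" using T by simp
  have "4 * s * a * (x / (2 * a) / s) = 2 * x" if "0 < s" "0 < a" for s a x :: real
    using that by (simp add: field_simps)
  from this[OF _ kT_pos, of "real slots" "real n"]
  have "real grid * (\<mu> / real slots) = 2 * real n"
    by (simp add: grid_def \<mu>_def slots_def[symmetric] mult.assoc) (simp add: slots_def)
  then show "2 \<le> real grid * (\<mu> / real slots)" using n_pos by simp
  show "finite (active (game l) \<omega> t) \<and> active (game l) \<omega> t \<noteq> {} \<and> card (active (game l) \<omega> t) \<le> slots"
    if "t < D" for t using active_bounds[OF that] by blast
  show "game l t a \<le> T" for t a by (rule game_le)
qed

lemma weight_le_grid: "t < D \<Longrightarrow> a \<in> active (game l) \<omega> t \<Longrightarrow> weight (game l) \<omega> t a \<le> grid"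
proof -
  assume t: "t < D" and a: "a \<in> active (game l) \<omega> t"
  have "real (weight (game l) \<omega> t a) \<le> share.W t"
    unfolding share.W_def weight_def using active_bounds(2)[OF t] a by (intro member_le_sum) auto
  then show ?thesis using share.W_le[OF t] by simp
qed

text \<open>On good seeds the tables never overflow, so \<open>guard\<close> never resets the
  algorithm. The loss table is bounded by stored pairs times distinct entry days.\<close>

lemma state_mem:
  assumes "t < D"
  shows "state (game l) \<omega> t \<in> states"
proof -
  note lb = live_table_bounds[OF assms]
  have tT: "t < T" using assms D_less by simp
  define E where "E = (\<Union>b\<in>{..\<beta>}. \<Union>r\<in>{..R}. snd ` live_at (game l) \<omega> b r t)"
  have finE: "finite E"
    unfolding E_def using card_live(1)[OF good support _ _ less_imp_le[OF assms]] by auto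
  have "card E \<le> (\<Sum>b\<in>{..\<beta>}. card (\<Union>r\<in>{..R}. snd ` live_at (game l) \<omega> b r t))"
    unfolding E_def by (rule card_UN_le) simp
  also have "\<dots> \<le> (\<Sum>b\<in>{..\<beta>}. 1 + (R + 1) * (w * cap))"
    using live_entries[OF good support _ less_imp_le[OF assms]] by (intro sum_mono) auto
  also have "\<dots> = (\<beta> + 1) * (1 + (R + 1) * (w * cap))" by simp
  also have "\<dots> \<le> entry_cap" unfolding entry_cap_def using beta_le by (intro mult_le_mono1) simp
  finally have cE: "card E \<le> entry_cap" .
  have sub: "loss_table (game l) \<omega> t \<subseteq>
      (\<lambda>((b, r, i, e), c). (b, i, c, cumloss (game l) i c t)) ` (live_table (game l) \<omega> t \<times> E)"
  proof
    fix z assume "z \<in> loss_table (game l) \<omega> t"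
    then obtain b i c r e r' i' where z: "z = (b, i, c, cumloss (game l) i c t)"
        "(b, r, i, e) \<in> live_table (game l) \<omega> t" "(b, r', i', c) \<in> live_table (game l) \<omega> t"
      by (auto simp: loss_table_def)
    have "c \<in> E" using z(3) by (force simp: E_def live_table_def)
    then show "z \<in> (\<lambda>((b, r, i, e), c). (b, i, c, cumloss (game l) i c t)) ` (live_table (game l) \<omega> t \<times> E)"
      using z by (intro image_eqI[of _ _ "((b, r, i, e), c)"]) auto
  qed
  have "card (loss_table (game l) \<omega> t) \<le>
      card ((\<lambda>((b, r, i, e), c). (b, i, c, cumloss (game l) i c t)) ` (live_table (game l) \<omega> t \<times> E))"
    using lb(2) finE by (intro card_mono sub) auto
  also have "\<dots> \<le> card (live_table (game l) \<omega> t \<times> E)" using lb(2) finE by (intro card_image_le) auto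
  also have "\<dots> \<le> live_cap * entry_cap" unfolding card_cartesian_product using lb(3) cE by (rule mult_le_mono)
  finally have c2: "card (loss_table (game l) \<omega> t) \<le> live_cap * entry_cap" .
  have cum: "cumloss (game l) i c t \<le> T * T" for i c
  proof -
    have "cumloss (game l) i c t \<le> (\<Sum>d = c..<t. T)" unfolding cumloss_def by (intro sum_mono game_le)
    also have "\<dots> \<le> T * T" using tT by simp
    finally show ?thesis .
  qed
  have r2: "loss_table (game l) \<omega> t \<subseteq> {..\<beta>} \<times> {1..n} \<times> {..<T} \<times> {..T * T}"
  proof
    fix z assume "z \<in> loss_table (game l) \<omega> t"
    then obtain b i c r e r' i' where z: "z = (b, i, c, cumloss (game l) i c t)"
        "(b, r, i, e) \<in> live_table (game l) \<omega> t" "(b, r', i', c) \<in> live_table (game l) \<omega> t"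
      by (auto simp: loss_table_def)
    then show "z \<in> {..\<beta>} \<times> {1..n} \<times> {..<T} \<times> {..T * T}"
      using subsetD[OF lb(1) z(2)] subsetD[OF lb(1) z(3)] cum[of i c] by simp
  qed
  have r3: "weight_table (game l) \<omega> t \<subseteq> {1..n} \<times> {..grid}"
    using active_bounds(1)[OF assms] weight_le_grid[OF assms] unfolding weight_table_def by blast
  have c3: "card (weight_table (game l) \<omega> t) \<le> slots"
    unfolding weight_table_def
    using card_image_le[OF active_bounds(2)[OF assms], of "\<lambda>a. (a, weight (game l) \<omega> t a)"] active_bounds(4)[OF assms]
    by linarith
  show ?thesis using tT lb(1,3) r2 c2 r3 c3 unfolding states_def state_def by simp
qed

lemma trajectory_state: "t < D \<Longrightarrow> trajectory l \<omega> (Suc t) = Some (state (game l) \<omega> t)"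
proof (induction t)
  case 0
  have "trajectory l \<omega> (Suc 0) = guard (state (game l) \<omega> 0)"
    by (simp add: first_state[where g = "game l"])
  then show ?case using state_mem[OF 0] by (simp add: guard_def)
next
  case (Suc t)
  have t: "t < D" using Suc.prems by simp
  have "round_loss n T (l (Suc (Suc t))) = game l t" using t by (simp add: game_def)
  then have "trajectory l \<omega> (Suc (Suc t)) = guard (next_state (state (game l) \<omega> t) (\<lambda>y. \<omega> (Suc t, y)) (game l t))"
    using Suc.IH[OF t] trajectory.simps(2)[of l \<omega> "Suc t"] by simp
  also have "\<dots> = guard (state (game l) \<omega> (Suc t))" by (simp only: next_state)
  finally show ?case using state_mem[OF Suc.prems] by (simp add: guard_def)
qed

lemma mean_loss_share:
  assumes "t < D"
  shows "mean_loss l \<omega> (Suc t) = share.loss t"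
proof -
  have "unit_loss l (Suc t) = (\<lambda>i. real (game l t i) / real T)"
    using assms by (simp add: unit_loss_def game_def fun_eq_iff)
  then have "mean_loss l \<omega> (Suc t) = measure_pmf.expectation
      (draw n ((\<lambda>a. (a, weight (game l) \<omega> t a)) ` active (game l) \<omega> t)) (\<lambda>i. real (game l t i) / real T)"
    unfolding mean_loss_def trajectory_state[OF assms] by (simp add: state_def weight_table_def)
  also have "\<dots> = share.loss t"
    unfolding share.loss_def weighted_loss_def weight_def[symmetric]
    using active_bounds[OF assms] share.weight_pos[OF less_imp_le[OF assms]]
    by (intro expectation_draw) (auto simp: weight_def)
  finally show ?thesis .
qed

lemma good_regret:
  assumes picks: "\<And>s. s < T \<Longrightarrow> is ! s \<in> {1..n}"
  shows "regret n T l is \<le> deviation l T is \<omega> + slack"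
proof -
  have D0: "0 < D" using T by (simp add: D_def)
  have days: "{..<T} = {..<Suc D}" using T by (simp add: D_def)
  have next_day: "Suc d < T" if "d < D" for d using that by (simp add: D_def)
  have "1 \<le> n" using n_pos by simp
  then show ?thesis
  proof (subst regret_le_iff, assumption, intro ballI)
    fix i assume i: "i \<in> {1..n}"
    obtain \<sigma> where \<sigma>: "follows T (game l) \<beta> R (sampled \<omega>) \<sigma> 0 D"
        "sched_cost T (game l) \<sigma> 0 D \<le> cumloss (game l) i 0 D + T * (D div 2 ^ \<beta> + visits)"
        "card (changes \<sigma> 0 D) \<le> (D div 2 ^ \<beta> + visits) * (R * cap + 1) + 1"
      using good_comparator[OF good support i] by blast
    have "a \<in> active (game l) \<omega> t" if a: "t < D" "\<sigma> t = Some a" for t a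
    proof -
      have "a \<in> live_experts T (game l) \<beta> R (sampled \<omega>) t" using \<sigma>(1) a by (simp add: follows_def)
      then obtain b r e where "b \<le> \<beta>" "r \<le> R" "(a, e) \<in> live_at (game l) \<omega> b r t"
        by (auto simp: live_experts_def)
      then have "(b, r, a, e) \<in> live_table (game l) \<omega> t" by (simp add: live_table_def)
      then show ?thesis by (force simp: active_def)
    qed
    from share.switching_regret[OF D0 this]
    have sw: "\<eta> * (\<Sum>t<D. share.loss t - real (choice_cost T (game l) t (\<sigma> t)) / real T)
      \<le> (real (card (changes \<sigma> 0 D)) + 1) * share.\<Gamma> + real D * (\<eta>\<^sup>2 + 2 * \<mu>)" by blast
    have G: "0 \<le> share.\<Gamma>" using share.psi_bounds[of 0 None] D0 by simp
    have "real (card (changes \<sigma> 0 D)) + 1 \<le> jumps * (real R * real cap + 1) + 2"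
    proof -
      have "real (card (changes \<sigma> 0 D)) \<le> real ((D div 2 ^ \<beta> + visits) * (R * cap + 1) + 1)"
        using \<sigma>(3) by (rule of_nat_mono)
      then show ?thesis by (simp add: jumps_def distrib_left)
    qed
    then have "(real (card (changes \<sigma> 0 D)) + 1) * share.\<Gamma> \<le> (jumps * (real R * real cap + 1) + 2) * share.\<Gamma>"
      using G by (rule mult_right_mono)
    then have "\<eta> * (\<Sum>t<D. share.loss t - real (choice_cost T (game l) t (\<sigma> t)) / real T)
      \<le> (jumps * (real R * real cap + 1) + 2) * share.\<Gamma> + real D * (2 * \<eta>\<^sup>2)"
      using sw eta_bounds(3) by simp
    then have "(\<Sum>t<D. share.loss t - real (choice_cost T (game l) t (\<sigma> t)) / real T)
      \<le> ((jumps * (real R * real cap + 1) + 2) * share.\<Gamma> + real D * (2 * \<eta>\<^sup>2)) / \<eta>"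
      using eta_bounds(1) by (simp add: pos_le_divide_eq mult.commute)
    then have loss: "(\<Sum>t<D. share.loss t) \<le> (\<Sum>t<D. real (choice_cost T (game l) t (\<sigma> t)) / real T) + (slack - 2 - jumps)"
      by (simp add: sum_subtractf slack_def share.\<Gamma>_def)
    have "(\<Sum>t<D. real (choice_cost T (game l) t (\<sigma> t)) / real T) = real (sched_cost T (game l) \<sigma> 0 D) / real T"
      by (simp add: sched_cost_def sum_divide_distrib atLeast0LessThan)
    also have "\<dots> \<le> real (cumloss (game l) i 0 D + T * (D div 2 ^ \<beta> + visits)) / real T"
      using \<sigma>(2) by (intro divide_right_mono of_nat_mono) auto
    also have "\<dots> = real (cumloss (game l) i 0 D) / real T + jumps"
      using T by (simp add: jumps_def add_divide_distrib)
    also have "real (cumloss (game l) i 0 D) / real T = (\<Sum>d<D. real (game l d i) / real T)"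
      by (simp add: cumloss_def sum_divide_distrib atLeast0LessThan)
    also have "\<dots> \<le> (\<Sum>d<D. l (Suc (Suc d)) i)"
      using round_loss_bounds(2)[OF day_vector[OF next_day] _ i] T by (intro sum_mono) (auto simp: game_def)
    finally have cost: "(\<Sum>t<D. real (choice_cost T (game l) t (\<sigma> t)) / real T) \<le> (\<Sum>d<D. l (Suc (Suc d)) i) + jumps"
      by simp
    have "(\<Sum>s<T. l (Suc s) (is ! s)) \<le> (\<Sum>s<T. unit_loss l s (is ! s) + 1 / real T)"
      using round_loss_bounds(3)[OF day_vector _ picks] T by (intro sum_mono) (auto simp: unit_loss_def)
    also have "\<dots> = (\<Sum>s<T. unit_loss l s (is ! s)) + 1" using T by (simp add: sum.distrib)
    also have "(\<Sum>s<T. unit_loss l s (is ! s)) = deviation l T is \<omega> + (\<Sum>s<T. mean_loss l \<omega> s)"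
      by (simp add: deviation_def sum_subtractf)
    also have "(\<Sum>s<T. mean_loss l \<omega> s) = mean_loss l \<omega> 0 + (\<Sum>d<D. mean_loss l \<omega> (Suc d))"
      unfolding days by (rule sum.lessThan_Suc_shift)
    also have "(\<Sum>d<D. mean_loss l \<omega> (Suc d)) = (\<Sum>d<D. share.loss d)"
      by (intro sum.cong) (auto simp: mean_loss_share)
    also have "mean_loss l \<omega> 0 \<le> 1" using unit_loss_range[of 0 1] T by (simp add: mean_loss_def)
    finally have "(\<Sum>s<T. l (Suc s) (is ! s)) \<le> deviation l T is \<omega> + (1 + (\<Sum>d<D. share.loss d)) + 1" by simp
    moreover have "(\<Sum>d<D. l (Suc (Suc d)) i) \<le> (\<Sum>s<T. l (Suc s) i)"
      unfolding days sum.lessThan_Suc_shift using loss_vector_coord[OF day_vector i, of 0] T by simp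
    ultimately show "(\<Sum>s<T. l (Suc s) (is ! s)) \<le> (\<Sum>s<T. l (Suc s) i) + (deviation l T is \<omega> + slack)"
      using loss cost by linarith
  qed
qed

end

lemma run_regret:
  assumes wT: "w\<^sup>2 \<le> T"
  shows "1 - (real (3 * ((w + 1) ^ 2 * T * (R + 1)) + n) + 1) * exp (- real (w\<^sup>2)) \<le>
    measure_pmf.prob (run alg l T) {(is, M). regret n T l is \<le> 2 * real w * sqrt (real T) + slack}"
proof -
  let ?c = "2 * real w * sqrt (real T)"
  have T0: "0 < sqrt (real T)" using T by simp
  \<comment> \<open>This \<open>s\<close> minimises \<open>s\<^sup>2 * T - s * ?c\<close>, with
    value \<open>- w\<^sup>2\<close>. The assumption \<open>w\<^sup>2 \<le> T\<close> gives
    \<open>s \<le> 1\<close>.\<close>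
  define s where "s = real w / sqrt (real T)"
  have "(real w)\<^sup>2 \<le> real T" using wT by (metis of_nat_le_iff of_nat_power)
  then have "real w \<le> sqrt (real T)" by (rule real_le_rsqrt)
  then have s: "0 \<le> s" "s \<le> 1" using T0 by (auto simp: s_def)
  have "s\<^sup>2 * real T = real (w\<^sup>2)" using T by (simp add: s_def power_divide)
  moreover have "s * ?c = 2 * real (w\<^sup>2)" using T0 by (simp add: s_def power2_eq_square)
  ultimately have ex: "s\<^sup>2 * real T - s * ?c = - real (w\<^sup>2)" by simp
  define A where "A = {z :: nat list \<times> (nat \<times> nat \<times> nat \<times> nat \<Rightarrow> bool). regret n T l (fst z) \<le> ?c + slack}"
  define B where "B = {z :: nat list \<times> (nat \<times> nat \<times> nat \<times> nat \<Rightarrow> bool). \<not> good (game l) (snd z)}"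
  define C where "C = {(is, \<omega>). ?c \<le> deviation l T is \<omega>}"
  have pB: "measure_pmf.prob (joint l T) B \<le> real (3 * ((w + 1) ^ 2 * T * (R + 1)) + n) * exp (- real (w\<^sup>2))"
  proof -
    have "measure_pmf.prob (joint l T) B = measure_pmf.prob (map_pmf snd (joint l T)) {\<omega>. \<not> good (game l) \<omega>}"
      by (simp add: B_def vimage_def)
    then show ?thesis using prob_not_good[of "game l"] by (simp add: joint_seeds_T)
  qed
  have pC: "measure_pmf.prob (joint l T) C \<le> exp (- real (w\<^sup>2))"
    using deviation_tail[OF s, of ?c] unfolding ex C_def .
  have "z \<in> A \<union> (B \<union> C)" if z: "z \<in> set_pmf (joint l T)" for z
  proof (rule ccontr)
    assume n: "z \<notin> A \<union> (B \<union> C)"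
    obtain "is" \<omega> where z': "z = (is, \<omega>)" by (cases z)
    have "\<omega> \<in> set_pmf (map_pmf snd (joint l T))" using z z' by force
    then have \<omega>: "\<omega> \<in> set_pmf seeds" by (simp only: joint_seeds_T)
    have g: "good (game l) \<omega>" "deviation l T is \<omega> < ?c" "\<not> regret n T l is \<le> ?c + slack"
      using n z' by (auto simp: A_def B_def C_def)
    have "regret n T l is \<le> deviation l T is \<omega> + slack"
    proof (rule good_regret[OF g(1)])
      show "\<omega> z \<Longrightarrow> z \<in> idx" for z by (rule seeds_support[OF \<omega>])
      show "s < T \<Longrightarrow> is ! s \<in> {1..n}" for s using joint_picks z z' by blast
    qed
    then show False using g by linarith
  qed
  then have "1 \<le> measure_pmf.prob (joint l T) (A \<union> (B \<union> C))"
    using measure_pmf.finite_measure_mono_AE[of UNIV "A \<union> (B \<union> C)" "joint l T"]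
    by (simp add: AE_measure_pmf_iff)
  also have "\<dots> \<le> measure_pmf.prob (joint l T) A + (measure_pmf.prob (joint l T) B + measure_pmf.prob (joint l T) C)"
    by (intro order_trans[OF measure_Un_le] add_left_mono measure_Un_le) auto
  finally have "1 - (real (3 * ((w + 1) ^ 2 * T * (R + 1)) + n) + 1) * exp (- real (w\<^sup>2)) \<le> measure_pmf.prob (joint l T) A"
    using pB pC by (simp add: distrib_right)
  also have "measure_pmf.prob (joint l T) A =
      measure_pmf.prob (run alg l T) {(is, M). regret n T l is \<le> ?c + slack}"
    unfolding run_alg by (simp add: A_def vimage_def case_prod_unfold)
  finally show ?thesis .
qed

end

end

subsection \<open>Choice of the parameters\<close>

context parameters
begin

lemma power_w_mono: "a \<le> b \<Longrightarrow> w ^ a \<le> w ^ b"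
  using w(1) by (intro power_increasing) auto

lemma R_le: "R = 8 * w ^ 3" "R + 1 \<le> 9 * w ^ 3"
proof -
  show "R = 8 * w ^ 3" unfolding R_def L_def by algebra
  then show "R + 1 \<le> 9 * w ^ 3" using power_w_mono[of 0 3] by simp
qed

lemma cap_le: "cap \<le> 34 * w ^ 4"
proof -
  have "cap = 32 * w ^ 4 + 2 * w ^ 2" unfolding cap_def X_def L_def by algebra
  then show ?thesis using power_w_mono[of 2 4] by simp
qed

lemma w_cap_le: "w * cap \<le> 34 * w ^ 5"
proof -
  have "w * cap \<le> w * (34 * w ^ 4)" by (rule mult_le_mono2[OF cap_le])
  also have "\<dots> = 34 * w ^ 5" by algebra
  finally show ?thesis .
qed

lemma live_cap_le: "live_cap \<le> 684 * (k * w ^ 9)"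
proof -
  have k1: "x \<le> k * x" for x using k(1) by simp
  have "raw \<le> 2 * (k * w ^ 5) + 2 * (k * w ^ 5)"
    unfolding raw_def
  proof (intro add_mono mult_le_mono2)
    have "k * w ^ 0 \<le> k * w ^ 5" by (intro mult_le_mono2 power_w_mono) simp
    then show "k \<le> k * w ^ 5" by simp
    show "w\<^sup>2 \<le> k * w ^ 5" using power_w_mono[of 2 5] k1[of "w ^ 5"] by linarith
  qed
  then have "raw + w * cap \<le> 38 * (k * w ^ 5)" using w_cap_le k1[of "w ^ 5"] by linarith
  then have "live_cap \<le> (2 * w) * ((9 * w ^ 3) * (38 * (k * w ^ 5)))"
    unfolding live_cap_def using w(1) R_le(2) by (intro mult_le_mono) auto
  also have "\<dots> = 684 * (k * w ^ 9)" by algebra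
  finally show ?thesis .
qed

lemma entry_cap_le: "entry_cap \<le> 614 * w ^ 9"
proof -
  have "(R + 1) * (w * cap) \<le> (9 * w ^ 3) * (34 * w ^ 5)" by (rule mult_le_mono[OF R_le(2) w_cap_le])
  also have "\<dots> = 306 * w ^ 8" by algebra
  finally have "1 + (R + 1) * (w * cap) \<le> 307 * w ^ 8" using power_w_mono[of 0 8] by simp
  then have "entry_cap \<le> (2 * w) * (307 * w ^ 8)"
    unfolding entry_cap_def using w(1) by (intro mult_le_mono) auto
  also have "\<dots> = 614 * w ^ 9" by algebra
  finally show ?thesis .
qed

text \<open>The loss table dominates: of order \<open>k * w ^ 9\<close> stored pairs times
  \<open>w ^ 9\<close> entry days.\<close>

lemma capacity_le: "2 + 10 * (live_cap + live_cap * entry_cap + slots) \<le> 5000000 * (k * w ^ 18)"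
proof -
  have "live_cap * entry_cap \<le> (684 * (k * w ^ 9)) * (614 * w ^ 9)"
    by (rule mult_le_mono[OF live_cap_le entry_cap_le])
  also have "\<dots> = 419976 * (k * w ^ 18)" by algebra
  finally have 1: "live_cap * entry_cap \<le> 419976 * (k * w ^ 18)" .
  have "k * w ^ 9 \<le> k * w ^ 18" by (intro mult_le_mono2 power_w_mono) simp
  then have 2: "live_cap \<le> 684 * (k * w ^ 18)" using live_cap_le by linarith
  have "1 \<le> k * w ^ 18" using k(1) w(1) by simp
  moreover have "2 + 10 * (A + B + (A + 1)) \<le> 5000000 * Y" if "1 \<le> Y" "A \<le> 684 * Y" "B \<le> 419976 * Y" for A B Y :: nat
  proof -
    have "2 + 10 * (A + B + (A + 1)) = 12 + 20 * A + 10 * B" by simp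
    then show ?thesis using that by linarith
  qed
  ultimately show ?thesis using 1 2 unfolding slots_def by blast
qed

end

context word_parameters
begin

text \<open>Up to constants: \<open>w\<^sup>2 * n / k\<close> jumps, \<open>w ^ 7\<close> switches
  in each, and \<open>\<Gamma>\<close> of order \<open>w\<close> give
  \<open>w ^ 10 * n / k = w ^ 10 * \<eta>\<^sup>2 * T\<close>. Division by \<open>\<eta>\<close>
  leaves \<open>\<eta> * T\<close>, which is the square root in the claim. The assumption bounds the
  number of longest epochs by \<open>2 * n / k\<close>.\<close>

lemma slack_le:
  assumes "k * T < 2 ^ Suc \<beta> * n"
  shows "2 * real w * sqrt (real T) + slack \<le> 4000 * real w ^ 10 * sqrt (real (n * T) / real k)"
proof -
  define Z where "Z = sqrt (real (n * T) / real k)"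
  have kp: "0 < real k" and np: "0 < real n" and Tp: "0 < real T" using k n_pos T by auto
  have w1: "1 \<le> real w" using w(1) by simp
  have eta: "0 < \<eta>" "\<eta> \<le> 1" "\<eta>\<^sup>2 = real n / (real k * real T)"
  proof -
    have "1 * n \<le> 2 ^ \<beta> * n" by (rule mult_le_mono1) simp
    then have "n \<le> k * T" using beta by linarith
    then have "real n \<le> real k * real T" by (metis of_nat_le_iff of_nat_mult)
    then show "\<eta> \<le> 1" "0 < \<eta>" using kp np Tp unfolding \<eta>_def by auto
    show "\<eta>\<^sup>2 = real n / (real k * real T)" using kp np Tp by (simp add: \<eta>_def)
  qed
  have ratio: "real n / real k = \<eta>\<^sup>2 * real T" using eta(3) kp Tp by simp
  have Z: "Z = \<eta> * real T"
    unfolding Z_def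
  proof (rule real_sqrt_unique)
    show "(\<eta> * real T)\<^sup>2 = real (n * T) / real k"
      unfolding power_mult_distrib eta(3) using kp Tp by (simp add: power2_eq_square)
    show "0 \<le> \<eta> * real T" using eta Tp by simp
  qed
  have nk: "1 \<le> real n / real k" using k kp by simp
  have "real T * 1 \<le> real T * (real n / real k)" using nk by (intro mult_left_mono) auto
  then have TZ: "sqrt (real T) \<le> Z" unfolding Z_def by (intro real_sqrt_le_mono) (simp add: mult.commute)
  have Z1: "1 \<le> Z"
  proof -
    have "1 \<le> sqrt (real T)" using T by simp
    then show ?thesis using TZ by linarith
  qed
  have ratio_Z: "real n / real k \<le> Z"
  proof -
    have "\<eta> * (\<eta> * real T) \<le> 1 * (\<eta> * real T)" using eta Tp by (intro mult_right_mono) auto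
    then show ?thesis unfolding ratio Z by (simp add: power2_eq_square)
  qed
  have jumps: "jumps \<le> 4 * real w ^ 2 * (real n / real k)"
  proof -
    have "real (D div 2 ^ \<beta>) \<le> real D / 2 ^ \<beta>" using of_nat_div_le_of_nat[of D "2 ^ \<beta>", where 'a = real] by simp
    also have "\<dots> \<le> real T / 2 ^ \<beta>" using D_less by (intro divide_right_mono) auto
    also have "\<dots> \<le> 2 * (real n / real k)"
    proof -
      have "real (k * T) \<le> real (2 ^ Suc \<beta> * n)" using assms by (intro of_nat_mono less_imp_le)
      then have "real k * real T \<le> 2 * 2 ^ \<beta> * real n" by simp
      then show ?thesis using kp by (simp add: field_simps)
    qed
    finally have 1: "real (D div 2 ^ \<beta>) \<le> 2 * (real n / real k)" .
    have "0 \<le> real n * real (w\<^sup>2) / real k" by simp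
    then have "real visits \<le> real n * real (w\<^sup>2) / real k + 1" unfolding visits_def by linarith
    also have "real n * real (w\<^sup>2) / real k = real w ^ 2 * (real n / real k)" by simp
    finally have 2: "real visits \<le> real w ^ 2 * (real n / real k) + 1" .
    have "1 \<le> real w ^ 2" using w1 by simp
    then have "1 * (real n / real k) \<le> real w ^ 2 * (real n / real k)" using nk by (intro mult_right_mono) auto
    then show ?thesis using 1 2 nk unfolding jumps_def by simp
  qed
  have pw: "real w ^ a \<le> real w ^ b" if "a \<le> b" for a b using that w1 by (intro power_increasing)
  have Rc: "real R * real cap + 1 \<le> 273 * real w ^ 7"
  proof -
    have "R * cap \<le> (8 * w ^ 3) * (34 * w ^ 4)" using R_le(1) cap_le by (intro mult_le_mono) auto
    also have "\<dots> = 272 * w ^ 7" by algebra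
    finally have "real (R * cap) \<le> real (272 * w ^ 7)" by (rule of_nat_mono)
    then show ?thesis using pw[of 0 7] by simp
  qed
  have G: "ln (2 * real slots / \<mu>) \<le> 3 * real w" "0 \<le> ln (2 * real slots / \<mu>)"
  proof -
    have e: "2 * real slots / \<mu> = 4 * real slots * (real k * real T) / real n"
      using kp np Tp by (simp add: \<mu>_def)
    have "slots \<le> 2 + 10 * (live_cap + live_cap * entry_cap + slots)" by simp
    then have sn: "slots \<le> n" using capacity S_le by (meson order_trans)
    have "real slots * (real k * real T) \<le> real n * (real n * real T)"
      using sn k by (intro mult_mono) auto
    then have "4 * real slots * (real k * real T) / real n \<le> 4 * (real n * (real n * real T)) / real n"
      using np by (intro divide_right_mono) auto
    also have "\<dots> = 4 * real (n * T)" using np by simp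
    also have "\<dots> \<le> 4 * 2 ^ w" using w(2) by (metis mult_left_mono of_nat_le_iff of_nat_numeral of_nat_power zero_le_numeral)
    also have "\<dots> = 2 ^ (w + 2)" by (simp add: power_add)
    finally have ub: "2 * real slots / \<mu> \<le> 2 ^ (w + 2)" unfolding e .
    have "real n \<le> real k * real T" using eta Tp kp np unfolding \<eta>_def by (simp add: divide_le_eq)
    moreover have "1 \<le> real slots" by (simp add: slots_def)
    ultimately have "1 * real n \<le> real slots * (real k * real T)" using np by (intro mult_mono) auto
    then have "1 * real n \<le> 4 * real slots * (real k * real T)" using np by simp
    then have lb: "1 \<le> 2 * real slots / \<mu>" unfolding e using np by (simp only: pos_le_divide_eq)
    then show "0 \<le> ln (2 * real slots / \<mu>)" by simp
    have "ln (2 * real slots / \<mu>) \<le> ln (2 ^ (w + 2))" using ub lb by (subst ln_le_cancel_iff) auto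
    also have "\<dots> = real (w + 2) * ln 2" by (rule ln_realpow)
    also have "\<dots> \<le> real (w + 2) * 1" using ln_2_less_1 by (intro mult_left_mono) auto
    also have "\<dots> \<le> 3 * real w" using w1 by simp
    finally show "ln (2 * real slots / \<mu>) \<le> 3 * real w" .
  qed
  have "jumps * (real R * real cap + 1) + 2 \<le> 1094 * real w ^ 9 * (real n / real k)"
  proof -
    have "jumps * (real R * real cap + 1) \<le> (4 * real w ^ 2 * (real n / real k)) * (273 * real w ^ 7)"
      using jumps Rc nk by (intro mult_mono) auto
    also have "\<dots> = 1092 * real w ^ 9 * (real n / real k)" by algebra
    finally have 1: "jumps * (real R * real cap + 1) \<le> 1092 * real w ^ 9 * (real n / real k)" .
    have "1 * 1 \<le> real w ^ 9 * (real n / real k)" using pw[of 0 9] nk by (intro mult_mono) auto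
    then show ?thesis using 1 by simp
  qed
  then have "(jumps * (real R * real cap + 1) + 2) * ln (2 * real slots / \<mu>)
      \<le> (1094 * real w ^ 9 * (real n / real k)) * (3 * real w)"
    using G nk by (intro mult_mono) auto
  also have "\<dots> = 3282 * real w ^ 10 * (\<eta>\<^sup>2 * real T)" unfolding ratio by algebra
  finally have main: "(jumps * (real R * real cap + 1) + 2) * ln (2 * real slots / \<mu>) + real D * (2 * \<eta>\<^sup>2)
      \<le> 3282 * real w ^ 10 * (\<eta>\<^sup>2 * real T) + real T * (2 * \<eta>\<^sup>2)"
    using D_less by (intro add_mono mult_right_mono) auto
  have "((jumps * (real R * real cap + 1) + 2) * ln (2 * real slots / \<mu>) + real D * (2 * \<eta>\<^sup>2)) / \<eta>
      \<le> (3282 * real w ^ 10 * (\<eta>\<^sup>2 * real T) + real T * (2 * \<eta>\<^sup>2)) / \<eta>"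
    using main eta(1) by (intro divide_right_mono) auto
  also have "\<dots> = 3282 * real w ^ 10 * Z + 2 * Z"
    unfolding Z using eta(1) by (simp add: field_simps power2_eq_square)
  finally have s1: "slack \<le> 2 + jumps + 3282 * real w ^ 10 * Z + 2 * Z" unfolding slack_def by linarith
  have ww: "real w ^ a * Z \<le> real w ^ 10 * Z" if "a \<le> 10" for a
    using pw[OF that] Z1 by (intro mult_right_mono) auto
  have "jumps \<le> 4 * real w ^ 2 * Z"
    using jumps mult_left_mono[OF ratio_Z, of "4 * real w ^ 2"] by simp
  then have j2: "jumps \<le> 4 * (real w ^ 10 * Z)" using ww[of 2] by simp
  have one: "Z \<le> real w ^ 10 * Z" using ww[of 0] by simp
  have "real w * sqrt (real T) \<le> real w * Z" using TZ w1 by (intro mult_left_mono) auto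
  then have "real w * sqrt (real T) \<le> real w ^ 10 * Z" using ww[of 1] by simp
  then show ?thesis unfolding Z_def[symmetric] using s1 j2 one Z1 by linarith
qed

end

text \<open>If \<open>T < w\<^sup>2\<close>, then \<open>T \<le> w * sqrt T\<close>; if
  \<open>k * T < n\<close>, then \<open>T\<^sup>2 \<le> n * T / k\<close>. In both cases the trivial
  regret \<open>T\<close> is good enough.\<close>

lemma horizon_le:
  assumes "1 \<le> w" "1 \<le> k" "k \<le> n" "0 < T" and "T < w\<^sup>2 \<or> k * T < n"
  shows "real T \<le> real w * sqrt (real (n * T) / real k)"
  using assms(5)
proof
  assume "T < w\<^sup>2"
  then have "real T \<le> real (w\<^sup>2)" by (intro of_nat_mono less_imp_le)
  then have "real T \<le> (real w)\<^sup>2" by simp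
  then have "sqrt (real T) \<le> real w" by (rule real_le_lsqrt[rotated]) simp
  then have "sqrt (real T) * sqrt (real T) \<le> real w * sqrt (real T)" by (intro mult_right_mono) auto
  then have "real T \<le> real w * sqrt (real T)" by simp
  also have "real T * 1 \<le> real T * (real n / real k)" using assms by (intro mult_left_mono) auto
  then have "sqrt (real T) \<le> sqrt (real (n * T) / real k)" by (intro real_sqrt_le_mono) (simp add: mult.commute)
  then have "real w * sqrt (real T) \<le> real w * sqrt (real (n * T) / real k)" by (intro mult_left_mono) auto
  finally show ?thesis .
next
  assume "k * T < n"
  then have "real (k * T) \<le> real n" by (intro of_nat_mono less_imp_le)
  then have "real k * real T \<le> real n" by simp
  then have "real k * real T * real T \<le> real n * real T" by (intro mult_right_mono) auto
  then have "(real T)\<^sup>2 \<le> real (n * T) / real k"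
    using assms(2) by (simp add: pos_le_divide_eq power2_eq_square mult.commute mult.left_commute)
  then have "real T \<le> sqrt (real (n * T) / real k)" by (rule real_le_rsqrt)
  also have "1 * sqrt (real (n * T) / real k) \<le> real w * sqrt (real (n * T) / real k)"
    using assms(1) by (intro mult_right_mono) auto
  finally show ?thesis by simp
qed

lemma level_exists:
  assumes "1 \<le> n" "n \<le> (m::nat)"
  shows "\<exists>\<beta>. 2 ^ \<beta> * n \<le> m \<and> m < 2 ^ Suc \<beta> * n"
proof -
  define P where "P = (\<lambda>\<beta>. 2 ^ \<beta> * n \<le> m)"
  have P0: "P 0" using assms by (simp add: P_def)
  have bd: "\<beta> \<le> m" if "P \<beta>" for \<beta>
  proof -
    have "\<beta> < 2 ^ \<beta>" by (rule less_exp)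
    moreover have "2 ^ \<beta> * 1 \<le> 2 ^ \<beta> * n" using assms(1) by (rule mult_le_mono2)
    ultimately show ?thesis using that unfolding P_def mult_1_right by linarith
  qed
  obtain b where "P b" "\<not> P (Suc b)" by (rule last_true_nat[of P, OF P0 bd])
  then show ?thesis by (auto simp: P_def)
qed

lemma expert_alg_exists:
  assumes S: "S \<le> n" and T: "2 \<le> T" and word: "w = ceillog2 (n * T)" "5000000 \<le> w" "w ^ 19 \<le> S"
    and c: "4000 * real w ^ 20 * sqrt (real (n * T) / real S) \<le> c"
    and \<delta>: "real (200 * (w ^ 5 * (n * T))) * exp (- real (w\<^sup>2)) \<le> \<delta>"
  shows "\<exists>A. is_expert_alg n T A \<and> uses_memory_at_most n T A S \<and>
    (\<forall>D. oblivious_adversary n T D \<longrightarrow> 1 - \<delta> \<le> \<P>((l, is, M) in play n T A D. regret n T l is \<le> c))"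
proof -
  \<comment> \<open>\<open>w ^ 18\<close> comes from \<open>capacity_le\<close>; the further
    \<open>w \<ge> 5000000\<close> absorbs its constant.\<close>
  define k where "k = S div w ^ 19"
  have wp: "0 < w ^ 19" using word(2) by simp
  have k1: "1 \<le> k" unfolding k_def using word(3) wp by (simp add: Suc_le_eq div_greater_zero_iff)
  have kS: "k * w ^ 19 \<le> S" unfolding k_def by simp
  have "k * 1 \<le> k * w ^ 19" by (rule mult_le_mono2) (use wp in simp)
  then have kn: "k \<le> n" using S kS by linarith
  have n1: "1 \<le> n" using k1 kn by simp
  have \<delta>0: "0 \<le> \<delta>" using \<delta> by (rule order_trans[rotated]) simp
  \<comment> \<open>Truncation in the quotient costs at most a factor 2, absorbed by one more
    \<open>w\<close>. So \<open>S \<le> k * w ^ 20\<close>, and passing from \<open>k\<close> to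
    \<open>S\<close> costs \<open>w ^ 10\<close>.\<close>
  have Z: "sqrt (real (n * T) / real k) \<le> real w ^ 10 * sqrt (real (n * T) / real S)"
  proof -
    have "S < (k + 1) * w ^ 19" unfolding k_def using dividend_less_div_times[OF wp, of S] by simp
    also have "\<dots> \<le> (2 * k) * w ^ 19" using k1 by (intro mult_le_mono1) simp
    also have "\<dots> \<le> k * w ^ 20"
    proof -
      have "2 * w ^ 19 \<le> w * w ^ 19" using word(2) by (intro mult_le_mono1) simp
      also have "\<dots> = w ^ 20" by algebra
      finally show ?thesis using mult_le_mono2[of "2 * w ^ 19" "w ^ 20" k] by simp
    qed
    finally have "real S \<le> real (k * w ^ 20)" by (intro of_nat_mono) simp
    then have Sk: "real S \<le> real k * real w ^ 20" by simp
    have Sp: "0 < real S" using word(3) wp by linarith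
    have "real (n * T) / real k \<le> real w ^ 20 * (real (n * T) / real S)"
    proof -
      have "real (n * T) * real S \<le> real (n * T) * (real k * real w ^ 20)" using Sk by (intro mult_left_mono) auto
      then show ?thesis using Sp k1 by (simp add: field_simps)
    qed
    then have "sqrt (real (n * T) / real k) \<le> sqrt (real w ^ 20 * (real (n * T) / real S))"
      by (rule real_sqrt_le_mono)
    also have "\<dots> = sqrt (real w ^ 20) * sqrt (real (n * T) / real S)" by (rule real_sqrt_mult)
    also have "sqrt (real w ^ 20) = real w ^ 10" by (rule real_sqrt_unique) (simp_all add: power_mult[symmetric])
    finally show ?thesis .
  qed
  have main: "4000 * real w ^ 10 * sqrt (real (n * T) / real k) \<le> c"
  proof -
    have "4000 * real w ^ 10 * sqrt (real (n * T) / real k)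
        \<le> 4000 * real w ^ 10 * (real w ^ 10 * sqrt (real (n * T) / real S))"
      using Z by (intro mult_left_mono) auto
    also have "\<dots> = 4000 * real w ^ 20 * sqrt (real (n * T) / real S)" by algebra
    finally show ?thesis using c by linarith
  qed
  show ?thesis
  \<comment> \<open>The main case needs \<open>w\<^sup>2 \<le> T\<close> for the deviation bound and
    \<open>n \<le> k * T\<close> for a level \<open>\<beta>\<close> to exist.\<close>
  proof (cases "T < w\<^sup>2 \<or> k * T < n")
    case True
    have "real T \<le> real w * sqrt (real (n * T) / real k)"
      using True word(2) k1 kn T by (intro horizon_le) auto
    also have "real w ^ 1 \<le> 4000 * real w ^ 10"
    proof -
      have "real w ^ 1 \<le> real w ^ 10" using word(2) by (intro power_increasing) auto
      also have "\<dots> \<le> 4000 * real w ^ 10" by simp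
      finally show ?thesis .
    qed
    then have "real w * sqrt (real (n * T) / real k) \<le> 4000 * real w ^ 10 * sqrt (real (n * T) / real k)"
      by (intro mult_right_mono) auto
    also have "\<dots> \<le> c" by (rule main)
    finally have Tc: "real T \<le> c" .
    then show ?thesis
      using constant_alg[OF n1] \<delta>0 by (intro exI[of _ constant_alg]) auto
  next
    case False
    then have wT: "w\<^sup>2 \<le> T" and nk: "n \<le> k * T" by auto
    obtain \<beta> where \<beta>: "2 ^ \<beta> * n \<le> k * T" "k * T < 2 ^ Suc \<beta> * n" using level_exists[OF n1 nk] by blast
    interpret parameters n T k w \<beta>
      by standard (use k1 kn T word(2) \<beta> in \<open>auto simp: word(1) le_two_power_ceillog2\<close>)
    interpret word_parameters n T k w \<beta> S
    proof
      have "2 + 10 * (live_cap + live_cap * entry_cap + slots) \<le> 5000000 * (k * w ^ 18)" by (rule capacity_le)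
      also have "\<dots> \<le> w * (k * w ^ 18)" using word(2) by (rule mult_le_mono1)
      also have "\<dots> = k * w ^ 19" by algebra
      finally show "2 + 10 * (live_cap + live_cap * entry_cap + slots) \<le> S" using kS by linarith
    qed (rule word(1), rule S)
    have fail: "(real (3 * ((w + 1) ^ 2 * T * (R + 1)) + n) + 1) * exp (- real (w\<^sup>2)) \<le> \<delta>"
    proof -
      have "(w + 1) ^ 2 \<le> (2 * w) ^ 2" using word(2) by (intro power_mono) auto
      then have "(w + 1) ^ 2 * T * (R + 1) \<le> (2 * w) ^ 2 * T * (9 * w ^ 3)"
        using R_le(2) by (intro mult_le_mono) auto
      also have "\<dots> = 36 * (w ^ 5 * T)" by algebra
      also have "\<dots> \<le> 36 * (w ^ 5 * (n * T))" using n1 by simp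
      finally have 1: "(w + 1) ^ 2 * T * (R + 1) \<le> 36 * (w ^ 5 * (n * T))" .
      have "n * 1 \<le> n * T" using T by (intro mult_le_mono2) simp
      also have "1 * (n * T) \<le> w ^ 5 * (n * T)" using word(2) by (intro mult_le_mono1) simp
      finally have 2: "n \<le> w ^ 5 * (n * T)" by simp
      have "3 * ((w + 1) ^ 2 * T * (R + 1)) + n + 1 \<le> 200 * (w ^ 5 * (n * T))"
        using 1 2 n1 by linarith
      then have "real (3 * ((w + 1) ^ 2 * T * (R + 1)) + n + 1) \<le> real (200 * (w ^ 5 * (n * T)))"
        by (rule of_nat_mono)
      then have "(real (3 * ((w + 1) ^ 2 * T * (R + 1)) + n) + 1) * exp (- real (w\<^sup>2))
          \<le> real (200 * (w ^ 5 * (n * T))) * exp (- real (w\<^sup>2))"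
        by (intro mult_right_mono) auto
      then show ?thesis using \<delta> by linarith
    qed
    have "1 - \<delta> \<le> \<P>((l, is, M) in play n T alg E. regret n T l is \<le> c)" if E: "oblivious_adversary n T E" for E
    proof (rule play_prob_ge[OF n1 E run_measurable])
      fix l assume l: "l \<in> space (loss_seqs n T)"
      have "1 - \<delta> \<le> 1 - (real (3 * ((w + 1) ^ 2 * T * (R + 1)) + n) + 1) * exp (- real (w\<^sup>2))" using fail by simp
      also have "\<dots> \<le> measure_pmf.prob (run alg l T) {(is, M). regret n T l is \<le> 2 * real w * sqrt (real T) + slack}"
        by (rule run_regret[OF l wT])
      also have "\<dots> \<le> measure_pmf.prob (run alg l T) {(is, M). regret n T l is \<le> c}"
        using slack_le[OF \<beta>(2)] main by (intro measure_pmf.finite_measure_mono) auto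
      finally show "1 - \<delta> \<le> measure_pmf.prob (run alg l T) {(is, M). regret n T l is \<le> c}" .
    qed
    then show ?thesis using is_expert_alg uses_memory by blast
  qed
qed

theorem theorem1p1:
  shows "\<exists>(a::nat) (b::nat) (C::real) (N::nat) (w :: nat \<Rightarrow> real).
    filterlim w at_top at_top \<and>
    (\<forall>n T S :: nat.
       n \<ge> N \<longrightarrow> T \<ge> N \<longrightarrow> ln (real (n * T)) ^ a \<le> real S \<longrightarrow> S \<le> n \<longrightarrow>
       (\<exists>A. is_expert_alg n T A \<and> uses_memory_at_most n T A S \<and>
          (\<forall>D. oblivious_adversary n T D \<longrightarrow>
             \<P>((l, is, M) in play n T A D.
                  regret n T l is \<le> C * ln (real (n * T)) ^ b * sqrt (real (n * T) / real S))
               \<ge> 1 - 1 / real (n * T) powr w (n * T))))"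
proof -
  have "eventually (\<lambda>x::real. 200 * ((2 * x) ^ 5 * exp x) * exp (- (x\<^sup>2)) \<le> exp (- (x\<^sup>2 / 2))) at_top"
    by real_asymp
  then have "eventually (\<lambda>x::real. 200 * ((2 * x) ^ 5 * exp x) * exp (- (x\<^sup>2)) \<le> exp (- (x\<^sup>2 / 2)) \<and>
      5000000 \<le> x) at_top"
    using eventually_ge_at_top by (rule eventually_conj)
  then obtain x0 where x0: "\<And>x. x0 \<le> x \<Longrightarrow> 200 * ((2 * x) ^ 5 * exp x) * exp (- (x\<^sup>2)) \<le> exp (- (x\<^sup>2 / 2)) \<and>
      5000000 \<le> (x::real)"
    unfolding eventually_at_top_linorder by blast
  define N where "N = nat \<lceil>exp x0\<rceil> + 2"
  \<comment> \<open>With \<open>x = ln (n * T)\<close> the failure probability is at most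
    \<open>exp (- x\<^sup>2 / 2)\<close>, that is, \<open>n * T\<close> to the power
    \<open>- x / 2\<close>.\<close>
  define wf :: "nat \<Rightarrow> real" where "wf = (\<lambda>m. ln (real m) / 2)"
  have wf: "filterlim wf at_top at_top" unfolding wf_def by real_asymp
  have "\<exists>A. is_expert_alg n T A \<and> uses_memory_at_most n T A S \<and>
          (\<forall>D. oblivious_adversary n T D \<longrightarrow>
             1 - 1 / real (n * T) powr wf (n * T) \<le> \<P>((l, is, M) in play n T A D.
                  regret n T l is \<le> (4000 * 2 ^ 20) * ln (real (n * T)) ^ 20 * sqrt (real (n * T) / real S)))"
    if n: "n \<ge> N" and T: "T \<ge> N" and S: "ln (real (n * T)) ^ 20 \<le> real S" "S \<le> n" for n T S
  proof -
    define x where "x = ln (real (n * T))"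
    define w where "w = ceillog2 (n * T)"
    have T2: "2 \<le> T" and n2: "2 \<le> n" using n T by (auto simp: N_def)
    have nT: "0 < n * T" using T2 n2 by simp
    have "n * 1 \<le> n * T" using T2 by (intro mult_le_mono2) simp
    then have "N \<le> n * T" using n by linarith
    then have "real N \<le> real (n * T)" by (rule of_nat_mono)
    moreover have "exp x0 \<le> real N" unfolding N_def by linarith
    ultimately have "exp x0 \<le> real (n * T)" by linarith
    then have "x0 \<le> x" unfolding x_def using nT by (subst ln_ge_iff) auto
    note X = x0[OF this]
    have x1: "5000000 \<le> x" using X by blast
    have expx: "exp x = real (n * T)" using nT by (simp add: x_def)
    have ln2: "1 / 2 \<le> ln (2::real)" "ln (2::real) \<le> 1" using ln_2_less_1 ln2_ge_two_thirds by auto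
    have "x \<le> log 2 (real (n * T))"
      unfolding log_def x_def[symmetric] using x1 ln2 by (simp add: le_divide_eq mult_left_le)
    also have "\<dots> \<le> real w" unfolding w_def by (rule ceillog2_ge_log[OF nT])
    finally have xw: "x \<le> real w" .
    have "real w < log 2 (real (n * T)) + 1" unfolding w_def by (rule ceillog2_less_log[OF nT])
    also have "log 2 (real (n * T)) \<le> 3 / 2 * x"
    proof -
      have "x * 1 \<le> x * (3 / 2 * ln 2)" using x1 ln2_ge_two_thirds by (intro mult_left_mono) auto
      then show ?thesis unfolding log_def x_def[symmetric] using ln2 by (simp add: divide_le_eq mult_ac)
    qed
    finally have wx: "real w \<le> 2 * x" using x1 by simp
    have w0: "5000000 \<le> w"
    proof -
      have "real 5000000 \<le> real w" using xw x1 by simp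
      then show ?thesis by (simp only: of_nat_le_iff)
    qed
    \<comment> \<open>The spare factor \<open>x\<close> in \<open>x ^ 20\<close> absorbs the
      \<open>2 ^ 19\<close> that stems from \<open>w \<le> 2 * x\<close>.\<close>
    have w19: "w ^ 19 \<le> S"
    proof -
      have "real w ^ 19 \<le> (2 * x) ^ 19" using wx by (intro power_mono) auto
      also have "\<dots> = 2 ^ 19 * x ^ 19" by (rule power_mult_distrib)
      also have "\<dots> \<le> x * x ^ 19" using x1 by (intro mult_right_mono) auto
      also have "\<dots> = x ^ 20" by algebra
      also have "\<dots> \<le> real S" using S(1) by (simp add: x_def)
      finally have "real (w ^ 19) \<le> real S" by simp
      then show ?thesis by (simp only: of_nat_le_iff)
    qed
    show ?thesis
    proof (rule expert_alg_exists[OF S(2) T2 w_def w0 w19])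
      have "real w ^ 20 \<le> (2 * x) ^ 20" using wx by (intro power_mono) auto
      also have "\<dots> = 2 ^ 20 * x ^ 20" by (rule power_mult_distrib)
      finally have "4000 * real w ^ 20 \<le> (4000 * 2 ^ 20) * x ^ 20" by simp
      then show "4000 * real w ^ 20 * sqrt (real (n * T) / real S)
          \<le> (4000 * 2 ^ 20) * ln (real (n * T)) ^ 20 * sqrt (real (n * T) / real S)"
        unfolding x_def by (rule mult_right_mono) simp
      have "real w ^ 5 * exp x \<le> (2 * x) ^ 5 * exp x" using wx by (intro mult_right_mono power_mono) auto
      moreover have "exp (- real (w\<^sup>2)) \<le> exp (- (x\<^sup>2))"
        using xw x1 by (simp add: power_mono)
      ultimately have "200 * (real w ^ 5 * exp x) * exp (- real (w\<^sup>2)) \<le> 200 * ((2 * x) ^ 5 * exp x) * exp (- (x\<^sup>2))"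
        using x1 by (intro mult_mono) auto
      also have "\<dots> \<le> exp (- (x\<^sup>2 / 2))" using X by blast
      also have "\<dots> = 1 / real (n * T) powr wf (n * T)"
      proof -
        have "ln (real (n * T)) = x" by (simp only: x_def)
        then have "real (n * T) powr wf (n * T) = exp (x\<^sup>2 / 2)"
          unfolding wf_def powr_def using nT by (simp del: of_nat_mult add: power2_eq_square)
        then show ?thesis by (simp add: exp_minus inverse_eq_divide)
      qed
      finally show "real (200 * (w ^ 5 * (n * T))) * exp (- real (w\<^sup>2)) \<le> 1 / real (n * T) powr wf (n * T)"
        unfolding expx by simp
    qed
  qed
  then show ?thesis using wf by blast
qed

end
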